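(* The inclusion $\mathcal{W}\subset\mathcal{D}$ is proper. More specifically, there exists a metric minimal distal flow $(X,T)$ which is not strictly ergodic, and hence is not in $\mathcal{W}$ (that is, for a point $x_0\in X$ the algebra $al(X,x_0)$ is contained in $\mathcal{D}$ but not in $\mathcal{W}$).
   Context: A flow $(X,T)$ is a compact Hausdorff space $X$ with a self-homeomorphism $T$; it is minimal if every orbit is dense, and strictly ergodic if it is minimal and has exactly one $T$-invariant Borel probability measure. A flow is metric if $X$ is metrizable. A metric flow is distal if $x\ne y$ implies $\inf_{n\in\mathbb{Z}}d(T^nx,T^ny)>0$; a general flow is distal if for all $x\neq y$ there is a neighborhood $V$ of the diagonal in $X\times X$ with $(T^nx,T^ny)\notin V$ for all $n\in\mathbb{Z}$. For a point $x_0$ with dense orbit in a flow $(X,T)$, $al(X,x_0)=\{f\in\ell^\infty(\mathbb{Z}):\exists F\in C(X),\ f(n)=F(T^nx_0)\ \forall n\in\mathbb{Z}\}$. $\mathcal{D}$, the algebra of distal functions, is the set of $f\in\ell^\infty(\mathbb{Z})$ for which there are a minimal distal flow $(X,T)$, $F\in C(X)$ and $x_0\in X$ with $f(n)=F(T^nx_0)$ for all $n\in\mathbb{Z}$. The Weyl algebra $\mathcal{W}$ is the smallest uniformly closed, translation invariant, conjugation-closed subalgebra (containing the constants) of $\ell^\infty(\mathbb{Z})$ containing all functions $n\mapsto e^{2\pi i n^k\alpha}$, $\alpha\in\mathbb{R}$, $k\in\mathbb{N}$. *)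

theory Defs
  imports "HOL-Probability.Probability"
begin

section \<open>Flows\<close>

text \<open>A flow is a pair \<open>(X, T)\<close>; only the values of \<open>T\<close> on \<open>topspace X\<close> matter. The space is
  required to be nonempty, since otherwise the empty flow would be vacuously minimal and distal, and
  for want of a probability measure not strictly ergodic.\<close>

definition flow :: "'a topology \<Rightarrow> ('a \<Rightarrow> 'a) \<Rightarrow> bool" where
  "flow X T \<longleftrightarrow> topspace X \<noteq> {} \<and> compact_space X \<and> Hausdorff_space X \<and> homeomorphic_map X X T"

definition flow_pow :: "'a topology \<Rightarrow> ('a \<Rightarrow> 'a) \<Rightarrow> int \<Rightarrow> 'a \<Rightarrow> 'a" where
  "flow_pow X T n =
     (if 0 \<le> n then T ^^ nat n else inv_into (topspace X) T ^^ nat (- n))"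

definition orbit :: "'a topology \<Rightarrow> ('a \<Rightarrow> 'a) \<Rightarrow> 'a \<Rightarrow> 'a set" where
  "orbit X T x = range (\<lambda>n. flow_pow X T n x)"

definition minimal_flow :: "'a topology \<Rightarrow> ('a \<Rightarrow> 'a) \<Rightarrow> bool" where
  "minimal_flow X T \<longleftrightarrow>
     flow X T \<and> (\<forall>x\<in>topspace X. X closure_of orbit X T x = topspace X)"

definition distal_flow :: "'a topology \<Rightarrow> ('a \<Rightarrow> 'a) \<Rightarrow> bool" where
  "distal_flow X T \<longleftrightarrow> flow X T \<and>
     (\<forall>x\<in>topspace X. \<forall>y\<in>topspace X. x \<noteq> y \<longrightarrow>
        (\<exists>V. openin (prod_topology X X) V \<and> (\<forall>z\<in>topspace X. (z, z) \<in> V) \<and>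
             (\<forall>n. (flow_pow X T n x, flow_pow X T n y) \<notin> V)))"

definition borel_sigma :: "'a topology \<Rightarrow> 'a measure" where
  "borel_sigma X = sigma (topspace X) {U. openin X U}"

definition invariant_prob :: "'a topology \<Rightarrow> ('a \<Rightarrow> 'a) \<Rightarrow> 'a measure \<Rightarrow> bool" where
  "invariant_prob X T M \<longleftrightarrow>
     space M = topspace X \<and> sets M = sets (borel_sigma X) \<and> prob_space M \<and>
     (\<forall>A\<in>sets M. emeasure M (T -` A \<inter> topspace X) = emeasure M A)"

definition strictly_ergodic :: "'a topology \<Rightarrow> ('a \<Rightarrow> 'a) \<Rightarrow> bool" where
  "strictly_ergodic X T \<longleftrightarrow> minimal_flow X T \<and> (\<exists>!M. invariant_prob X T M)"


section \<open>Subalgebras of bounded functions on the integers\<close>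

definition linf :: "(int \<Rightarrow> complex) set" where
  "linf = {f. bounded (range f)}"

definition al :: "'a topology \<Rightarrow> ('a \<Rightarrow> 'a) \<Rightarrow> 'a \<Rightarrow> (int \<Rightarrow> complex) set" where
  "al X T x0 = {f \<in> linf. \<exists>F. continuous_map X euclidean F \<and> (\<forall>n. f n = F (flow_pow X T n x0))}"

text \<open>The definition of the distal functions ranges over all minimal distal flows, whereas a HOL
  definition can only quantify over the topologies on one fixed type. A Hausdorff space with a
  countable dense subset has at most as many points as there are sets of sets of natural numbers, so
  every minimal flow is isomorphic to one on a space whose points have type \<open>nat set set\<close>. The
  theorem \<open>distal_functionsI\<close> below shows that flows on arbitrary types give nothing new.\<close>

type_synonym universe = "nat set set"

definition distal_functions :: "(int \<Rightarrow> complex) set" where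
  "distal_functions = {f \<in> linf. \<exists>(X :: universe topology) T F x0.
     minimal_flow X T \<and> distal_flow X T \<and> continuous_map X euclidean F \<and> x0 \<in> topspace X \<and>
     (\<forall>n. f n = F (flow_pow X T n x0))}"

text \<open>Closure under scalar multiples follows from constants and products.\<close>

definition invariant_closed_algebra :: "(int \<Rightarrow> complex) set \<Rightarrow> bool" where
  "invariant_closed_algebra A \<longleftrightarrow> A \<subseteq> linf \<and>
     (\<forall>c. (\<lambda>n. c) \<in> A) \<and>
     (\<forall>f\<in>A. \<forall>g\<in>A. (\<lambda>n. f n + g n) \<in> A) \<and>
     (\<forall>f\<in>A. \<forall>g\<in>A. (\<lambda>n. f n * g n) \<in> A) \<and>
     (\<forall>f\<in>A. (\<lambda>n. cnj (f n)) \<in> A) \<and>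
     (\<forall>f\<in>A. \<forall>k. (\<lambda>n. f (n + k)) \<in> A) \<and>
     (\<forall>fs f. (\<forall>i::nat. fs i \<in> A) \<and> uniform_limit UNIV fs f sequentially \<longrightarrow> f \<in> A)"

definition weyl_generator :: "nat \<Rightarrow> real \<Rightarrow> int \<Rightarrow> complex" where
  "weyl_generator k \<alpha> n = exp (2 * of_real pi * \<i> * of_int (n ^ k) * of_real \<alpha>)"

definition weyl_algebra :: "(int \<Rightarrow> complex) set" where
  "weyl_algebra = \<Inter>{A. invariant_closed_algebra A \<and> (\<forall>k \<alpha>. weyl_generator k \<alpha> \<in> A)}"


section \<open>Isomorphic flows\<close>

lemma flow_pow_in_topspace:
  assumes "flow X T" "x \<in> topspace X"
  shows "flow_pow X T n x \<in> topspace X"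
proof -
  have im: "T ` topspace X = topspace X"
    using assms(1) homeomorphic_imp_surjective_map unfolding flow_def by blast
  have "(T ^^ m) x \<in> topspace X" for m
    using assms(2) im by (induction m) auto
  moreover have "(inv_into (topspace X) T ^^ m) x \<in> topspace X" for m
    using assms(2) im by (induction m) (auto intro: inv_into_into)
  ultimately show ?thesis
    by (simp add: flow_pow_def)
qed

context
  fixes X :: "'a topology" and Y :: "'b topology" and h T S
  assumes hom: "homeomorphic_map X Y h" and X: "flow X T"
    and S: "\<And>x. x \<in> topspace X \<Longrightarrow> S (h x) = h (T x)"
begin

lemma flow_iso: "flow Y S"
proof -
  obtain g where g: "homeomorphic_maps X Y h g"
    using hom homeomorphic_map_maps by blast
  have gY: "homeomorphic_map Y X g"
    using g homeomorphic_maps_map by blast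
  have TX: "homeomorphic_map X X T"
    using X by (simp add: flow_def)
  have "homeomorphic_map Y Y (h \<circ> (T \<circ> g))"
    by (intro homeomorphic_map_compose[OF homeomorphic_map_compose[OF gY TX] hom])
  moreover have "(h \<circ> (T \<circ> g)) y = S y" if "y \<in> topspace Y" for y
  proof -
    have "g y \<in> topspace X" "h (g y) = y"
      using g that by (auto simp: homeomorphic_maps_def continuous_map_def)
    with S[of "g y"] show ?thesis by simp
  qed
  ultimately have "homeomorphic_map Y Y S"
    by (rule homeomorphic_map_eq)
  moreover have "X homeomorphic_space Y"
    using hom homeomorphic_map_imp_homeomorphic_space by blast
  moreover have "topspace Y \<noteq> {}"
    using X homeomorphic_imp_surjective_map[OF hom] by (auto simp: flow_def)
  ultimately show ?thesis
    using X homeomorphic_compact_space homeomorphic_Hausdorff_space unfolding flow_def by blast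
qed

lemma flow_pow_iso:
  assumes "x \<in> topspace X"
  shows "flow_pow Y S n (h x) = h (flow_pow X T n x)"
proof -
  have im: "T ` topspace X = topspace X" and imh: "h ` topspace X = topspace Y"
    and injS: "inj_on S (topspace Y)"
    using X hom flow_iso homeomorphic_imp_surjective_map homeomorphic_imp_injective_map
    unfolding flow_def by blast+
  have "(T ^^ m) x \<in> topspace X \<and> (S ^^ m) (h x) = h ((T ^^ m) x)" for m
    using assms im by (induction m) (auto simp: S)
  moreover have inv: "inv_into (topspace Y) S (h z) = h (inv_into (topspace X) T z)"
    if "z \<in> topspace X" for z
  proof -
    have z: "inv_into (topspace X) T z \<in> topspace X" "T (inv_into (topspace X) T z) = z"
      using that im by (auto intro: inv_into_into f_inv_into_f)
    show ?thesis
      by (rule inv_into_f_eq[OF injS]) (use z S[OF z(1)] imh in auto)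
  qed
  have "(inv_into (topspace X) T ^^ m) x \<in> topspace X \<and>
      (inv_into (topspace Y) S ^^ m) (h x) = h ((inv_into (topspace X) T ^^ m) x)" for m
    using assms im by (induction m) (auto simp: inv intro: inv_into_into)
  ultimately show ?thesis
    by (simp add: flow_pow_def)
qed

lemma minimal_flow_iso:
  assumes "minimal_flow X T"
  shows "minimal_flow Y S"
  unfolding minimal_flow_def
proof (intro conjI ballI)
  show "flow Y S" by (rule flow_iso)
  fix y assume "y \<in> topspace Y"
  then obtain x where x: "x \<in> topspace X" "y = h x"
    using homeomorphic_imp_surjective_map[OF hom] by auto
  have orb: "orbit Y S y = h ` orbit X T x"
    using x by (auto simp: orbit_def flow_pow_iso)
  have sub: "orbit X T x \<subseteq> topspace X"
    using flow_pow_in_topspace[OF X x(1)] by (auto simp: orbit_def)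
  show "Y closure_of orbit Y S y = topspace Y"
    unfolding orb homeomorphic_map_closure_of[OF hom sub]
    using assms x homeomorphic_imp_surjective_map[OF hom] by (simp add: minimal_flow_def)
qed

lemma distal_flow_iso:
  assumes "distal_flow X T"
  shows "distal_flow Y S"
  unfolding distal_flow_def
proof (intro conjI ballI impI)
  show "flow Y S" by (rule flow_iso)
  obtain g where g: "homeomorphic_maps X Y h g"
    using hom homeomorphic_map_maps by blast
  have gh: "g (h x) = x" if "x \<in> topspace X" for x
    using g that by (auto simp: homeomorphic_maps_def)
  have gY: "continuous_map Y X g"
    using g by (auto simp: homeomorphic_maps_def)
  fix y y' assume y: "y \<in> topspace Y" "y' \<in> topspace Y" "y \<noteq> y'"
  then obtain x x' where x: "x \<in> topspace X" "y = h x" "x' \<in> topspace X" "y' = h x'" "x \<noteq> x'"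
    using homeomorphic_imp_surjective_map[OF hom] by (metis imageE)
  then obtain V where V: "openin (prod_topology X X) V" "\<forall>z\<in>topspace X. (z, z) \<in> V"
    "\<And>n. (flow_pow X T n x, flow_pow X T n x') \<notin> V"
    using assms unfolding distal_flow_def by blast
  let ?W = "{p \<in> topspace (prod_topology Y Y). (g (fst p), g (snd p)) \<in> V}"
  have "continuous_map (prod_topology Y Y) (prod_topology X X) (\<lambda>p. (g (fst p), g (snd p)))"
    using gY by (auto simp: continuous_map_pairwise o_def
        intro: continuous_map_compose[OF continuous_map_fst, unfolded o_def]
               continuous_map_compose[OF continuous_map_snd, unfolded o_def])
  then have "openin (prod_topology Y Y) ?W"
    using V(1) by (rule openin_continuous_map_preimage)
  moreover have "\<forall>z\<in>topspace Y. (z, z) \<in> ?W"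
    using V(2) gY by (auto simp: continuous_map_def)
  moreover have "(flow_pow Y S n y, flow_pow Y S n y') \<notin> ?W" for n
    using V(3)[of n] x flow_pow_in_topspace[OF X] by (simp add: flow_pow_iso gh)
  ultimately show "\<exists>V. openin (prod_topology Y Y) V \<and> (\<forall>z\<in>topspace Y. (z, z) \<in> V) \<and>
             (\<forall>n. (flow_pow Y S n y, flow_pow Y S n y') \<notin> V)"
    by blast
qed

end

lemma separable_Hausdorff_embeds_in_universe:
  fixes X :: "'a topology" and e :: "int \<Rightarrow> 'a"
  assumes "Hausdorff_space X" and "X closure_of range e = topspace X"
  obtains Y :: "universe topology" and h where "homeomorphic_map X Y h"
proof -
  define c :: "nat \<Rightarrow> 'a" where "c = e \<circ> int_decode"
  have rc: "range c = range e"
    unfolding c_def image_comp[symmetric] using surj_int_decode by simp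
  define h :: "'a \<Rightarrow> universe" where "h x = {A. x \<in> X closure_of (c ` A)}" for x
  have inj: "inj_on h (topspace X)"
  proof (rule inj_onI, rule ccontr)
    fix x y assume xy: "x \<in> topspace X" "y \<in> topspace X" "h x = h y" "x \<noteq> y"
    then obtain U V where UV: "openin X U" "openin X V" "x \<in> U" "y \<in> V" "disjnt U V"
      using assms(1) unfolding Hausdorff_space_def by metis
    define A where "A = {n. c n \<in> U}"
    have "x \<in> X closure_of (c ` A)"
      unfolding in_closure_of
    proof (intro conjI allI impI)
      fix W assume W: "x \<in> W \<and> openin X W"
      then have "openin X (U \<inter> W)" "x \<in> U \<inter> W" using UV by auto
      moreover have "x \<in> X closure_of range c" using assms(2) xy(1) rc by simp
      ultimately obtain n where "c n \<in> U \<inter> W"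
        unfolding in_closure_of by blast
      then show "\<exists>y. y \<in> c ` A \<and> y \<in> W" by (auto simp: A_def)
    qed (use xy in simp)
    then have "A \<in> h x" by (simp add: h_def)
    then have "A \<in> h y" using xy(3) by simp
    then have "y \<in> X closure_of (c ` A)" by (simp add: h_def)
    then obtain n where "n \<in> A" "c n \<in> V" using UV unfolding in_closure_of by blast
    then show False using UV(5) by (auto simp: A_def disjnt_def)
  qed
  define g where "g = inv_into (topspace X) h"
  have gh: "g (h x) = x" if "x \<in> topspace X" for x
    using inj that by (simp add: g_def)
  define Y where "Y = pullback_topology (h ` topspace X) g X"
  have tY: "topspace Y = h ` topspace X"
    by (auto simp: Y_def topspace_pullback_topology gh)
  have "continuous_map Y X g"
    using continuous_map_pullback[OF continuous_map_id, of "h ` topspace X" g X]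
    by (simp add: Y_def)
  moreover have "continuous_map X Y h"
    unfolding Y_def
  proof (rule continuous_map_pullback')
    show "continuous_map X X (g \<circ> h)"
      by (rule continuous_map_eq[OF continuous_map_id]) (simp add: gh)
  qed auto
  ultimately have "homeomorphic_maps X Y h g"
    by (auto simp: homeomorphic_maps_def tY gh)
  then show thesis
    using that homeomorphic_map_maps by blast
qed

theorem distal_functionsI:
  fixes X :: "'a topology"
  assumes "minimal_flow X T" "distal_flow X T" "continuous_map X euclidean F" "x0 \<in> topspace X"
    and "\<And>n. f n = F (flow_pow X T n x0)"
  shows "f \<in> distal_functions"
proof -
  have X: "flow X T" using assms(1) by (simp add: minimal_flow_def)
  have "X closure_of range (\<lambda>n. flow_pow X T n x0) = topspace X"
    using assms(1,4) by (auto simp: minimal_flow_def orbit_def)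
  then obtain Y :: "universe topology" and h where h: "homeomorphic_map X Y h"
    using X by (auto simp: flow_def elim: separable_Hausdorff_embeds_in_universe)
  then obtain g where g: "homeomorphic_maps X Y h g"
    using homeomorphic_map_maps by blast
  then have gh: "\<And>x. x \<in> topspace X \<Longrightarrow> g (h x) = x" and gY: "continuous_map Y X g"
    by (auto simp: homeomorphic_maps_def)
  define S where "S = h \<circ> T \<circ> g"
  have S: "S (h x) = h (T x)" if "x \<in> topspace X" for x
    using that gh by (simp add: S_def)
  have pow: "flow_pow Y S n (h x) = h (flow_pow X T n x)" if "x \<in> topspace X" for n x
    by (rule flow_pow_iso[OF h X]) (use S that in auto)
  have min: "minimal_flow Y S"
    by (rule minimal_flow_iso[OF h X _ assms(1)]) (rule S)
  have dist: "distal_flow Y S"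
    by (rule distal_flow_iso[OF h X _ assms(2)]) (rule S)
  have "compactin euclidean (F ` topspace X)"
    using X assms(3) image_compactin unfolding flow_def compact_space_def by blast
  then have "bounded (F ` topspace X)"
    using compact_imp_bounded by simp
  then have "f \<in> linf"
    unfolding linf_def using assms(4,5) flow_pow_in_topspace[OF X]
    by (auto intro: bounded_subset)
  moreover have "continuous_map Y euclidean (F \<circ> g)"
    using gY assms(3) by (rule continuous_map_compose)
  moreover have "h x0 \<in> topspace Y"
    using assms(4) homeomorphic_imp_surjective_map[OF h] by auto
  moreover have "f n = (F \<circ> g) (flow_pow Y S n (h x0))" for n
    using assms(4,5) flow_pow_in_topspace[OF X] by (simp add: gh pow)
  ultimately show ?thesis
    using min dist unfolding distal_functions_def mem_Collect_eq by (intro conjI exI) auto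
qed

corollary al_subset_distal_functions:
  "minimal_flow X T \<Longrightarrow> distal_flow X T \<Longrightarrow> x0 \<in> topspace X \<Longrightarrow> al X T x0 \<subseteq> distal_functions"
  by (auto simp: al_def intro: distal_functionsI)


section \<open>Distality of metric flows\<close>

text \<open>On a metric flow the definition by neighbourhoods of the diagonal is the usual one.\<close>

theorem (in Metric_space) distal_flow_metric_iff:
  assumes X: "flow mtopology T"
  shows "distal_flow mtopology T \<longleftrightarrow> (\<forall>x\<in>M. \<forall>y\<in>M. x \<noteq> y \<longrightarrow>
     0 < (INF n. d (flow_pow mtopology T n x) (flow_pow mtopology T n y)))"
proof -
  let ?p = "flow_pow mtopology T"
  let ?X2 = "prod_topology mtopology mtopology"
  have inM: "?p n x \<in> M" if "x \<in> M" for n x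
    using flow_pow_in_topspace[OF X] that by simp
  have bdd: "bdd_below (range (\<lambda>n. d (?p n x) (?p n y)))" for x y
    by (rule bdd_belowI[of _ 0]) auto
  have "continuous_map ?X2 euclideanreal
      (\<lambda>q. mdist (metric (M, d)) (fst q) (snd q))"
    by (rule continuous_map_mdist) (auto simp: mtopology_of_def continuous_map_fst continuous_map_snd)
  then have cont: "continuous_map ?X2 euclideanreal (\<lambda>q. d (fst q) (snd q))"
    by simp
  show ?thesis
  proof (intro iffI ballI impI)
    fix x y assume D: "distal_flow mtopology T" and xy: "x \<in> M" "y \<in> M" "x \<noteq> y"
    obtain V where V: "openin ?X2 V" "\<forall>z\<in>M. (z, z) \<in> V" "\<And>n. (?p n x, ?p n y) \<notin> V"
      using D xy unfolding distal_flow_def topspace_mtopology by blast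
    let ?K = "topspace ?X2 - V"
    have "compact_space ?X2"
      using X by (simp add: flow_def compact_space_prod_topology)
    moreover have "closedin ?X2 ?K"
      using V(1) by blast
    ultimately have "compactin ?X2 ?K"
      using closedin_compact_space by blast
    then have "compactin euclideanreal ((\<lambda>q. d (fst q) (snd q)) ` ?K)"
      using cont image_compactin by blast
    then have cpt: "compact ((\<lambda>q. d (fst q) (snd q)) ` ?K)" by simp
    have inK: "(?p n x, ?p n y) \<in> ?K" for n
      using V(3) inM xy by simp
    then have "(\<lambda>q. d (fst q) (snd q)) ` ?K \<noteq> {}" by blast
    then obtain q where q: "q \<in> ?K" "\<And>r. r \<in> ?K \<Longrightarrow> d (fst q) (snd q) \<le> d (fst r) (snd r)"
      using compact_attains_inf[OF cpt] by blast
    obtain a b where "q = (a, b)" by fastforce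
    then have "fst q \<in> M" "snd q \<in> M" "fst q \<noteq> snd q"
      using q(1) V(2) by auto
    then have "0 < d (fst q) (snd q)" by simp
    also have "\<dots> \<le> (INF n. d (?p n x) (?p n y))"
      using q(2)[OF inK] by (intro cINF_greatest) auto
    finally show "0 < (INF n. d (?p n x) (?p n y))" .
  next
    assume I: "\<forall>x\<in>M. \<forall>y\<in>M. x \<noteq> y \<longrightarrow> 0 < (INF n. d (?p n x) (?p n y))"
    have "\<exists>V. openin ?X2 V \<and> (\<forall>z\<in>M. (z, z) \<in> V) \<and> (\<forall>n. (?p n x, ?p n y) \<notin> V)"
      if xy: "x \<in> M" "y \<in> M" "x \<noteq> y" for x y
    proof -
      let ?c = "INF n. d (?p n x) (?p n y)"
      let ?V = "{q \<in> topspace ?X2. d (fst q) (snd q) \<in> {..<?c}}"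
      have "openin ?X2 ?V"
        by (rule openin_continuous_map_preimage[OF cont]) simp
      moreover have "\<forall>z\<in>M. (z, z) \<in> ?V"
        using I xy by simp
      moreover have "(?p n x, ?p n y) \<notin> ?V" for n
        using cINF_lower[OF bdd, of n x y] by (simp add: not_less)
      ultimately show ?thesis by blast
    qed
    then show "distal_flow mtopology T"
      using X unfolding distal_flow_def topspace_mtopology by blast
  qed
qed

end

theory Submission
  imports Defs
begin

text \<open>The inclusion of the Weyl algebra in the distal functions is witnessed by a single flow, the shift
  on the orbit closure of the family of all sequences \<open>n \<mapsto> e(n ^ k \<alpha>)\<close>, where \<open>e(t)\<close> denotes
  \<open>exp (2 pi i t)\<close>. All sequences that occur in points of this space are polynomial phases: functions of
  modulus one that become constant after finitely many steps \<open>f \<mapsto> (\<lambda>n. f (n + 1) * cnj (f n))\<close>. If two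
  points differ, then some iterated difference of the quotient of two corresponding sequences is a
  constant other than \<open>1\<close> (\<open>phase_nontrivial_difference\<close>), and it stays the same along the orbit; so
  the flow is distal. In a distal flow every orbit closure is minimal
  (\<open>distal_flow_dense_orbit_imp_minimal\<close>), because the identity is the only idempotent of the Ellis
  semigroup. The functions read off a flow with a dense orbit form a closed invariant algebra, which
  here contains the generators, and therefore all of the Weyl algebra.

  That the inclusion is proper comes from means. By van der Corput's inequality the averages of a
  phase over intervals of length \<open>N\<close> are independent of the position of the interval up to an error that
  tends to zero, and this property extends to the whole Weyl algebra
  (\<open>weyl_algebra_uniform_means\<close>). Consequently, if all functions read off a minimal flow were Weyl
  functions, any two invariant probability measures would give the same integral to every continuous
  function (\<open>uniform_means_integral_eq\<close>).

  A minimal distal flow with several invariant measures is obtained, after Furstenberg, as a circle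
  extension \<open>(z, w) \<mapsto> (z + 1, w e(\<phi> z))\<close> of an odometer. Here \<open>\<phi> z = R (z + 1) - R z\<close> for a sum \<open>R\<close>
  of tents, one for each digit of \<open>z\<close>. The tents become flatter with the level, so that the series
  of differences converges uniformly and \<open>\<phi>\<close> is continuous; they occupy a summable proportion of
  the digits, so that \<open>R\<close> is almost everywhere a finite sum and each graph \<open>w = c e(R z)\<close> carries an
  invariant measure; and each of them has height one, so that an orbit can reach every point of the
  circle by climbing a single tent (\<open>skew_orbit_approximation\<close>), which gives a dense orbit.\<close>


section \<open>Orbits and powers\<close>

lemma flow_pow_0 [simp]: "flow_pow X T 0 x = x"
  by (simp add: flow_pow_def)

lemma flow_pow_add1:
  assumes "flow X T" "x \<in> topspace X"
  shows "flow_pow X T (n + 1) x = T (flow_pow X T n x)"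
proof (cases "0 \<le> n")
  case True
  then have "nat (n + 1) = Suc (nat n)" by simp
  with True show ?thesis by (simp add: flow_pow_def)
next
  case False
  let ?g = "inv_into (topspace X) T"
  have im: "T ` topspace X = topspace X"
    using assms(1) homeomorphic_imp_surjective_map unfolding flow_def by blast
  define m where "m = nat (- (n + 1))"
  have "(?g ^^ m) x = flow_pow X T (n + 1) x"
    using False by (cases "n = -1") (auto simp: flow_pow_def m_def)
  moreover have "nat (- n) = Suc m" using False by (simp add: m_def)
  ultimately have "flow_pow X T n x = ?g (flow_pow X T (n + 1) x)"
    using False by (simp add: flow_pow_def)
  moreover have "flow_pow X T (n + 1) x \<in> T ` topspace X"
    using flow_pow_in_topspace[OF assms] im by simp
  ultimately show ?thesis by (simp add: f_inv_into_f)
qed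

lemma flow_inj:
  assumes "flow X T" "x \<in> topspace X" "y \<in> topspace X" "T x = T y"
  shows "x = y"
  using assms homeomorphic_imp_injective_map unfolding flow_def inj_on_def by blast

text \<open>A two-sided orbit is determined by one step of the recursion: backwards because \<open>T\<close> is injective.\<close>

lemma flow_pow_eqI:
  assumes "flow X T" and "\<And>n. g n \<in> topspace X" and "\<And>n. g (n + 1) = T (g n)"
  shows "flow_pow X T n (g 0) = g n"
proof (induction n rule: int_induct[where k = 0])
  case (step1 i)
  then show ?case using flow_pow_add1[OF assms(1,2)] assms(3) by simp
next
  case (step2 i)
  have "T (flow_pow X T (i - 1) (g 0)) = T (g (i - 1))"
    using flow_pow_add1[OF assms(1,2), of "i - 1" 0] assms(3)[of "i - 1"] step2 by simp
  then show ?case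
    by (rule flow_inj[OF assms(1) flow_pow_in_topspace[OF assms(1,2)] assms(2)])
qed simp

lemma flow_pow_add:
  assumes "flow X T" "x \<in> topspace X"
  shows "flow_pow X T (m + n) x = flow_pow X T m (flow_pow X T n x)"
proof -
  have "flow_pow X T (m + 1 + n) x = T (flow_pow X T (m + n) x)" for m
    using flow_pow_add1[OF assms, of "m + n"] by (metis add.assoc add.commute)
  then have "flow_pow X T m (flow_pow X T (0 + n) x) = flow_pow X T (m + n) x"
    by (rule flow_pow_eqI[OF assms(1) flow_pow_in_topspace[OF assms]])
  then show ?thesis by simp
qed

lemma flow_pow_invariant:
  assumes X: "flow X T" and xy: "x \<in> topspace X" "y \<in> topspace X"
    and I: "\<And>x y. x \<in> topspace X \<Longrightarrow> y \<in> topspace X \<Longrightarrow> I (T x) (T y) = I x y"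
  shows "I (flow_pow X T n x) (flow_pow X T n y) = I x y"
proof (induction n rule: int_induct[where k = 0])
  case (step1 i)
  then show ?case using flow_pow_add1[OF X] flow_pow_in_topspace[OF X] xy I by simp
next
  case (step2 i)
  then show ?case
    using flow_pow_add1[OF X, of _ "i - 1"] flow_pow_in_topspace[OF X] xy
      I[of "flow_pow X T (i - 1) x" "flow_pow X T (i - 1) y"] by simp
qed simp

lemma continuous_map_flow_pow:
  assumes "flow X T"
  shows "continuous_map X X (flow_pow X T n)"
proof -
  have step: "continuous_map X X (f ^^ m)" if "continuous_map X X f" for f :: "'a \<Rightarrow> 'a" and m
  proof (induction m)
    case (Suc m)
    then show ?case using continuous_map_compose[OF Suc that] by (simp add: o_def)
  qed (simp add: id_def[symmetric])
  have T: "continuous_map X X T" and inj: "inj_on T (topspace X)"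
    using assms homeomorphic_imp_continuous_map homeomorphic_imp_injective_map
    unfolding flow_def by blast+
  obtain g where g: "homeomorphic_maps X X T g"
    using assms homeomorphic_map_maps unfolding flow_def by blast
  have "continuous_map X X (inv_into (topspace X) T)"
  proof (rule continuous_map_eq)
    show "continuous_map X X g" using g by (simp add: homeomorphic_maps_def)
    fix x assume "x \<in> topspace X"
    then have "g x \<in> topspace X" "T (g x) = x"
      using g by (auto simp: homeomorphic_maps_def continuous_map_def)
    then show "g x = inv_into (topspace X) T x"
      using inv_into_f_f[OF inj, of "g x"] by simp
  qed
  with T step show ?thesis by (simp add: flow_pow_def)
qed

text \<open>Both flows below are distal for the same reason: two distinct points are told apart by a
  continuous function of pairs that is constant along their joint orbit.\<close>

lemma distal_flowI_invariant:
  assumes X: "flow X T"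
    and sep: "\<And>x y. x \<in> topspace X \<Longrightarrow> y \<in> topspace X \<Longrightarrow> x \<noteq> y \<Longrightarrow>
      \<exists>I (c :: 'b :: t1_space). continuous_map (prod_topology X X) euclidean I \<and>
          (\<forall>n. I (flow_pow X T n x, flow_pow X T n y) = c) \<and>
          (\<forall>z\<in>topspace X. I (z, z) \<noteq> c)"
  shows "distal_flow X T"
  unfolding distal_flow_def
proof (intro conjI ballI impI X)
  fix x y assume "x \<in> topspace X" "y \<in> topspace X" "x \<noteq> y"
  then obtain I and c :: 'b where I: "continuous_map (prod_topology X X) euclidean I"
    "\<And>n. I (flow_pow X T n x, flow_pow X T n y) = c" "\<And>z. z \<in> topspace X \<Longrightarrow> I (z, z) \<noteq> c"
    using sep by meson
  let ?V = "{p \<in> topspace (prod_topology X X). I p \<in> - {c}}"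
  have "openin (prod_topology X X) ?V"
    by (rule openin_continuous_map_preimage[OF I(1)]) auto
  with I(2,3) show "\<exists>V. openin (prod_topology X X) V \<and> (\<forall>z\<in>topspace X. (z, z) \<in> V) \<and>
             (\<forall>n. (flow_pow X T n x, flow_pow X T n y) \<notin> V)"
    by (intro exI[of _ ?V]) auto
qed

section \<open>The Ellis semigroup of a distal flow\<close>

lemma closed_chain_has_nonempty_Inter:
  assumes "compact_space E" "\<C> \<noteq> {}"
    and C: "\<And>A. A \<in> \<C> \<Longrightarrow> closedin E A" "\<And>A. A \<in> \<C> \<Longrightarrow> A \<noteq> {}"
    and chain: "\<And>A B. A \<in> \<C> \<Longrightarrow> B \<in> \<C> \<Longrightarrow> A \<subseteq> B \<or> B \<subseteq> A"
  shows "\<Inter>\<C> \<noteq> {}"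
proof -
  have "\<Inter>\<F> \<noteq> {}" if "finite \<F>" "\<F> \<subseteq> \<C>" for \<F>
  proof (cases "\<F> = {}")
    case False
    have "subset.chain \<C> \<F>"
      unfolding subset_chain_def using that(2) chain by (meson subsetD)
    then have "\<Inter>\<F> \<in> \<F>" by (rule Inter_in_chain[OF that(1) False])
    then show ?thesis using that(2) C(2) by (meson subsetD)
  qed simp
  then have "\<forall>\<F>. finite \<F> \<and> \<F> \<subseteq> \<C> \<longrightarrow> \<Inter>\<F> \<noteq> {}" by simp
  moreover have "\<forall>A\<in>\<C>. closedin E A" using C(1) by simp
  ultimately show ?thesis
    using assms(1)[unfolded compact_space_fip, THEN spec, of \<C>] by simp
qed

text \<open>A compact semigroup in which only the right translations \<open>p \<mapsto> m p q\<close> are continuous still has an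
  idempotent. By Zorn there is a minimal closed subsemigroup \<open>A\<close>; for \<open>u \<in> A\<close> both \<open>A u\<close> and
  the stabiliser \<open>{p \<in> A. p u = u}\<close> are closed subsemigroups inside \<open>A\<close>, so each is all of
  \<open>A\<close>, and the second one contains \<open>u\<close>.\<close>

lemma Ellis_Numakura:
  assumes cpt: "compact_space E" and haus: "Hausdorff_space E" and ne: "topspace E \<noteq> {}"
    and closed: "\<And>p q. p \<in> topspace E \<Longrightarrow> q \<in> topspace E \<Longrightarrow> m p q \<in> topspace E"
    and assoc: "\<And>p q r. p \<in> topspace E \<Longrightarrow> q \<in> topspace E \<Longrightarrow> r \<in> topspace E \<Longrightarrow>
      m (m p q) r = m p (m q r)"
    and cont: "\<And>q. q \<in> topspace E \<Longrightarrow> continuous_map E E (\<lambda>p. m p q)"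
  obtains u where "u \<in> topspace E" "m u u = u"
proof -
  define \<S> where "\<S> = {A. closedin E A \<and> A \<noteq> {} \<and> (\<forall>p\<in>A. \<forall>q\<in>A. m p q \<in> A)}"
  have top: "topspace E \<in> \<S>" unfolding \<S>_def mem_Collect_eq
    by (intro conjI ballI ne closed closedin_topspace)
  have "\<exists>A\<in>\<S>. \<forall>B\<in>\<S>. B \<subseteq> A \<longrightarrow> B = A"
  proof (rule predicate_Zorn[where P = "\<lambda>A B. B \<subseteq> A"])
    show "partial_order_on \<S> (relation_of (\<lambda>A B. B \<subseteq> A) \<S>)"
      by (rule partial_order_on_relation_ofI) auto
    fix \<C> assume \<C>: "\<C> \<in> Chains (relation_of (\<lambda>A B. B \<subseteq> A) \<S>)"
    then have sub: "\<C> \<subseteq> \<S>" unfolding Chains_def relation_of_def by blast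
    have lin: "A \<subseteq> B \<or> B \<subseteq> A" if "A \<in> \<C>" "B \<in> \<C>" for A B
      using \<C> that unfolding Chains_def relation_of_def by blast
    show "\<exists>A\<in>\<S>. \<forall>B\<in>\<C>. A \<subseteq> B"
    proof (cases "\<C> = {}")
      case True then show ?thesis using top by auto
    next
      case False
      have C: "closedin E A" "A \<noteq> {}" if "A \<in> \<C>" for A
        using subsetD[OF sub that] by (simp_all add: \<S>_def)
      have *: "\<Inter>\<C> \<noteq> {}" "closedin E (\<Inter>\<C>)"
        using closed_chain_has_nonempty_Inter[OF cpt False C lin] closedin_Inter[OF False C(1)]
        by simp_all
      have "m p q \<in> \<Inter>\<C>" if "p \<in> \<Inter>\<C>" "q \<in> \<Inter>\<C>" for p q
      proof (rule InterI)
        fix A assume "A \<in> \<C>"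
        with sub that have "A \<in> \<S>" "p \<in> A" "q \<in> A" by auto
        then show "m p q \<in> A" by (simp add: \<S>_def)
      qed
      with * have "\<Inter>\<C> \<in> \<S>" unfolding \<S>_def mem_Collect_eq by (intro conjI ballI)
      then show ?thesis by (intro bexI[of _ "\<Inter>\<C>"] ballI Inter_lower)
    qed
  qed
  then obtain A where A: "A \<in> \<S>" and min': "\<forall>B\<in>\<S>. B \<subseteq> A \<longrightarrow> B = A"
    by (rule bexE)
  have min: "B = A" if "B \<in> \<S>" "B \<subseteq> A" for B
    using min' that by simp
  from A have clA: "closedin E A" and neA: "A \<noteq> {}"
    and semi: "\<And>p q. p \<in> A \<Longrightarrow> q \<in> A \<Longrightarrow> m p q \<in> A"
    by (simp_all add: \<S>_def)
  have AE: "p \<in> topspace E" if "p \<in> A" for p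
    using that closedin_subset[OF clA] by (rule subsetD[rotated])
  obtain u where u: "u \<in> A" using neA by (meson ex_in_conv)
  let ?r = "\<lambda>p. m p u"
  have r: "continuous_map E E ?r" using cont AE[OF u] .
  have "?r ` A \<in> \<S>"
    unfolding \<S>_def mem_Collect_eq
  proof (intro conjI ballI)
    have "compactin E (?r ` A)"
      by (rule image_compactin[OF closedin_compact_space[OF cpt clA] r])
    then show "closedin E (?r ` A)" by (rule compactin_imp_closedin[OF haus])
    show "?r ` A \<noteq> {}" using neA by simp
    fix a b assume "a \<in> ?r ` A" "b \<in> ?r ` A"
    then obtain p q where pq: "p \<in> A" "q \<in> A" "a = m p u" "b = m q u" by auto
    have pu: "m p u \<in> A" by (rule semi[OF pq(1) u])
    have "m a b = m (m (m p u) q) u"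
      unfolding pq(3,4) by (rule assoc[symmetric, OF AE[OF pu] AE[OF pq(2)] AE[OF u]])
    then show "m a b \<in> ?r ` A" by (rule image_eqI) (rule semi[OF pu pq(2)])
  qed
  moreover have "?r ` A \<subseteq> A" by (intro image_subsetI semi u)
  ultimately have "?r ` A = A" by (rule min)
  let ?B = "{p \<in> A. m p u = u}"
  have "?B \<in> \<S>"
    unfolding \<S>_def mem_Collect_eq
  proof (intro conjI ballI)
    have "closedin E {u}" using AE[OF u] haus
      by (simp add: closedin_Hausdorff_singleton)
    then have "closedin E (A \<inter> {p \<in> topspace E. m p u \<in> {u}})"
      by (intro closedin_Int clA closedin_continuous_map_preimage[OF r])
    moreover have "A \<inter> {p \<in> topspace E. m p u \<in> {u}} = ?B" using AE by auto
    ultimately show "closedin E ?B" by simp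
    have "u \<in> ?r ` A" using u \<open>?r ` A = A\<close> by simp
    then obtain p where "p \<in> A" "u = m p u" by (rule imageE)
    then have "p \<in> ?B" by simp
    then show "?B \<noteq> {}" by (metis empty_iff)
    fix p q assume "p \<in> ?B" "q \<in> ?B"
    then show "m p q \<in> A" "m (m p q) u = u"
      using semi[of p q] assoc[OF AE AE AE[OF u], of p q] by simp_all
  qed
  then have "?B = A" by (rule min) auto
  then have "m u u = u" using u by blast
  with AE[OF u] show thesis by (rule that)
qed

text \<open>The Ellis semigroup \<open>E\<close> is the closure of the powers of \<open>T\<close> in the product topology on
  self-maps of the space. If \<open>u \<in> E\<close> is idempotent then \<open>x\<close> and \<open>u x\<close> have the same image
  under \<open>u\<close>, hence are proximal; in a distal flow this forces \<open>u = id\<close>. Write \<open>y = q x\<close> with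
  \<open>q \<in> E\<close>. The left ideal \<open>E q\<close> is a compact semigroup, so it contains an idempotent
  \<open>s q = id\<close>, and then \<open>x = s y\<close> lies in the orbit closure of \<open>y\<close>.\<close>

lemma distal_flow_orbit_closure_sym:
  assumes D: "distal_flow X T" and x: "x \<in> topspace X" and y: "y \<in> X closure_of orbit X T x"
  shows "x \<in> X closure_of orbit X T y"
proof -
  have X: "flow X T" using D by (simp add: distal_flow_def)
  define K where "K = topspace X"
  define P where "P = product_topology (\<lambda>_. X) K"
  define t where "t n = restrict (flow_pow X T n) K" for n
  define E where "E = P closure_of range t"
  have cpt: "compact_space P" and haus: "Hausdorff_space P"
    using X by (auto simp: P_def flow_def compact_space_product_topology Hausdorff_space_product_topology)
  have P: "p \<in> K \<rightarrow>\<^sub>E K" if "p \<in> topspace P" for p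
    using that by (simp add: P_def K_def)
  have tP: "t n \<in> topspace P" for n
    using flow_pow_in_topspace[OF X] by (auto simp: P_def t_def K_def)
  have clE: "closedin P E" unfolding E_def by simp
  have EP: "E \<subseteq> topspace P" using clE closedin_subset by blast
  have tE: "t n \<in> E" for n
    unfolding E_def using closure_of_subset[of "range t" P] tP by blast
  have cl: "f ` E \<subseteq> X closure_of (f ` range t)" if "continuous_map P X f" for f
    unfolding E_def by (rule continuous_map_image_closure_subset[OF that])
  have ev: "continuous_map P X (\<lambda>p. p z)" if "z \<in> K" for z
    using that unfolding P_def by (rule continuous_map_product_projection)
  have left: "continuous_map P P (\<lambda>p. compose K (t n) p)" for n
    unfolding P_def continuous_map_componentwise
  proof (intro conjI ballI)
    show "(\<lambda>p. compose K (t n) p) ` topspace (product_topology (\<lambda>_. X) K) \<subseteq> extensional K"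
      by (auto simp: compose_def)
    fix z assume z: "z \<in> K"
    have "continuous_map P X (\<lambda>p. flow_pow X T n (p z))"
      using continuous_map_compose[OF ev[OF z] continuous_map_flow_pow[OF X]] by (simp add: o_def)
    then have "continuous_map P X (\<lambda>p. compose K (t n) p z)"
      by (rule continuous_map_eq) (use z P in \<open>auto simp: compose_def t_def PiE_def\<close>)
    then show "continuous_map (product_topology (\<lambda>_. X) K) X (\<lambda>p. compose K (t n) p z)"
      by (simp add: P_def)
  qed
  have right: "continuous_map P P (\<lambda>p. compose K p q)" if q: "q \<in> topspace P" for q
    unfolding P_def continuous_map_componentwise
  proof (intro conjI ballI)
    show "(\<lambda>p. compose K p q) ` topspace (product_topology (\<lambda>_. X) K) \<subseteq> extensional K"
      by (auto simp: compose_def)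
    fix z assume z: "z \<in> K"
    then have "continuous_map P X (\<lambda>p. p (q z))" using ev P[OF q] by blast
    then show "continuous_map (product_topology (\<lambda>_. X) K) X (\<lambda>p. compose K p q z)"
      using z by (simp add: P_def compose_def)
  qed
  have sub: "f ` E \<subseteq> E" if "continuous_map P P f" "f ` range t \<subseteq> E" for f
  proof -
    have "f ` E \<subseteq> P closure_of (f ` range t)"
      unfolding E_def by (rule continuous_map_image_closure_subset[OF that(1)])
    also have "\<dots> \<subseteq> E" using closure_of_minimal[OF that(2) clE] .
    finally show ?thesis .
  qed
  have "compose K (t n) (t m) = t (n + m)" for n m
    using flow_pow_add[OF X] flow_pow_in_topspace[OF X]
    by (auto simp: compose_def t_def K_def fun_eq_iff)
  then have "compose K (t n) ` range t \<subseteq> E" for n using tE by auto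
  then have tE': "compose K (t n) q \<in> E" if "q \<in> E" for n q
    using subsetD[OF sub[OF left] imageI[OF that]] by simp
  have EE: "compose K p q \<in> E" if "p \<in> E" "q \<in> E" for p q
  proof -
    have "(\<lambda>p. compose K p q) ` range t \<subseteq> E" using tE'[OF that(2)] by auto
    then show ?thesis
      using subsetD[OF sub[OF right[OF subsetD[OF EP that(2)]]] imageI[OF that(1)]] by simp
  qed
  have assoc: "compose K (compose K p q) r = compose K p (compose K q r)"
    if "r \<in> topspace P" for p q r
    using P[OF that] by (auto simp: compose_def fun_eq_iff)
  obtain q where q: "q \<in> E" "q x = y"
  proof -
    have "x \<in> K" using x by (simp add: K_def)
    have "compactin X ((\<lambda>p. p x) ` E)"
      by (rule image_compactin[OF closedin_compact_space[OF cpt clE] ev[OF \<open>x \<in> K\<close>]])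
    then have "closedin X ((\<lambda>p. p x) ` E)"
      using X by (intro compactin_imp_closedin) (simp_all add: flow_def)
    moreover have "orbit X T x \<subseteq> (\<lambda>p. p x) ` E"
    proof
      fix z assume "z \<in> orbit X T x"
      then obtain n where "z = t n x" using x by (auto simp: orbit_def t_def K_def)
      then show "z \<in> (\<lambda>p. p x) ` E" using tE by auto
    qed
    ultimately have "X closure_of orbit X T x \<subseteq> (\<lambda>p. p x) ` E" by (rule closure_of_minimal[rotated])
    with y have "y \<in> (\<lambda>p. p x) ` E" by (rule subsetD[rotated])
    then show thesis by (rule imageE) (use that in simp)
  qed
  let ?L = "(\<lambda>p. compose K p q) ` E"
  have LE: "?L \<subseteq> E" using EE q by auto
  have qP: "q \<in> topspace P" using q EP by auto
  have "compactin P ?L"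
    by (rule image_compactin[OF closedin_compact_space[OF cpt clE] right[OF qP]])
  then have cptL: "compact_space (subtopology P ?L)" by (simp add: compact_space_subtopology)
  have topL: "topspace (subtopology P ?L) = ?L" using LE EP by auto
  obtain u where u: "u \<in> topspace (subtopology P ?L)" "compose K u u = u"
  proof (rule Ellis_Numakura[OF cptL, of "compose K"])
    show "Hausdorff_space (subtopology P ?L)" using haus by (rule Hausdorff_space_subtopology)
    show "topspace (subtopology P ?L) \<noteq> {}" using q unfolding topL by auto
    show closed: "compose K a b \<in> topspace (subtopology P ?L)"
      if ab: "a \<in> topspace (subtopology P ?L)" "b \<in> topspace (subtopology P ?L)" for a b
    proof -
      obtain r where r: "r \<in> E" "b = compose K r q" using ab(2) unfolding topL by (rule imageE)
      have "a \<in> E" using ab(1) LE unfolding topL by auto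
      then show ?thesis
        unfolding topL r(2) assoc[OF qP, symmetric] by (intro imageI EE r)
    qed
    show "compose K (compose K a b) c = compose K a (compose K b c)"
      if "a \<in> topspace (subtopology P ?L)" "b \<in> topspace (subtopology P ?L)"
        "c \<in> topspace (subtopology P ?L)" for a b c
      using assoc[of c] that EP LE topL by auto
    show "continuous_map (subtopology P ?L) (subtopology P ?L) (\<lambda>p. compose K p b)"
      if "b \<in> topspace (subtopology P ?L)" for b
      using right[of b] that closed[OF _ that]
      by (auto simp: continuous_map_in_subtopology continuous_map_from_subtopology topL)
  qed
  from u(1) obtain s where s: "s \<in> E" "u = compose K s q" unfolding topL by auto
  have uE: "u \<in> E" using u(1) LE unfolding topL by auto
  \<comment> \<open>\<open>z\<close> and \<open>u z\<close> are proximal, as \<open>u\<close> sends both to \<open>u z\<close>.\<close>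
  have u_id: "u z = z" if z: "z \<in> K" for z
  proof (rule ccontr)
    assume ne: "u z \<noteq> z"
    have uz: "u z \<in> K" using P[OF subsetD[OF EP uE]] z by (rule PiE_mem)
    then obtain V where V: "openin (prod_topology X X) V" "\<And>z. z \<in> K \<Longrightarrow> (z, z) \<in> V"
      "\<And>n. (flow_pow X T n z, flow_pow X T n (u z)) \<notin> V"
      using D z ne unfolding distal_flow_def K_def by metis
    have "continuous_map P (prod_topology X X) (\<lambda>p. (p z, p (u z)))"
      using ev z uz by (simp add: continuous_map_pairwise o_def)
    then have op: "openin P {p \<in> topspace P. (p z, p (u z)) \<in> V}"
      using V(1) by (rule openin_continuous_map_preimage)
    have "u (u z) = u z" using u(2) z by (metis compose_eq)
    then have "u \<in> {p \<in> topspace P. (p z, p (u z)) \<in> V}"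
      using uE EP V(2)[OF uz] by auto
    with op uE have "\<exists>p\<in>range t. p \<in> {p \<in> topspace P. (p z, p (u z)) \<in> V}"
      unfolding E_def in_closure_of by (auto simp only: Bex_def)
    then obtain n where "(t n z, t n (u z)) \<in> V" by auto
    then show False using V(3)[of n] z uz by (simp add: t_def)
  qed
  have yK: "y \<in> K" using subsetD[OF closure_of_subset_topspace y] by (simp add: K_def)
  have "s y = x"
    using u_id[of x] s(2) q(2) x by (simp add: compose_def K_def)
  moreover have "s y \<in> X closure_of ((\<lambda>p. p y) ` range t)"
    using subsetD[OF cl[OF ev[OF yK]] imageI[OF s(1)]] .
  moreover have "(\<lambda>p. p y) ` range t = orbit X T y"
    using yK by (simp add: orbit_def t_def image_image)
  ultimately show ?thesis by simp
qed

lemma dense_orbit_upper_bound: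
  fixes h :: "'a \<Rightarrow> real"
  assumes dense: "X closure_of orbit X T x0 = topspace X" and h: "continuous_map X euclideanreal h"
    and le: "\<And>n. h (flow_pow X T n x0) \<le> c" and X: "flow X T" "x0 \<in> topspace X"
    and x: "x \<in> topspace X"
  shows "h x \<le> c"
proof -
  let ?S = "{x \<in> topspace X. h x \<in> {..c}}"
  have "closedin X ?S" by (rule closedin_continuous_map_preimage[OF h]) simp
  moreover have "orbit X T x0 \<subseteq> ?S"
    using le flow_pow_in_topspace[OF X] by (auto simp: orbit_def)
  ultimately have "X closure_of orbit X T x0 \<subseteq> ?S" by (rule closure_of_minimal[rotated])
  then show ?thesis using x dense by auto
qed

lemma distal_flow_dense_orbit_imp_minimal:
  assumes D: "distal_flow X T" and x: "x \<in> topspace X" "X closure_of orbit X T x = topspace X"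
  shows "minimal_flow X T"
  unfolding minimal_flow_def
proof (intro conjI ballI)
  show X: "flow X T" using D by (simp add: distal_flow_def)
  fix y assume y: "y \<in> topspace X"
  let ?C = "X closure_of orbit X T y"
  have "x \<in> ?C" by (rule distal_flow_orbit_closure_sym[OF D x(1)]) (use x(2) y in simp)
  have "flow_pow X T n x \<in> ?C" for n
  proof -
    have "flow_pow X T n (flow_pow X T m y) \<in> orbit X T y" for m
      unfolding orbit_def flow_pow_add[OF X y, symmetric] by (rule rangeI)
    then have "flow_pow X T n ` orbit X T y \<subseteq> orbit X T y"
      by (auto simp: orbit_def)
    then have "X closure_of (flow_pow X T n ` orbit X T y) \<subseteq> ?C" by (rule closure_of_mono)
    then have "flow_pow X T n ` ?C \<subseteq> ?C"
      by (rule order_trans[OF continuous_map_image_closure_subset[OF continuous_map_flow_pow[OF X]]])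
    then show ?thesis using \<open>x \<in> ?C\<close> by auto
  qed
  then have "orbit X T x \<subseteq> ?C" by (auto simp: orbit_def)
  then have "X closure_of orbit X T x \<subseteq> ?C" by (rule closure_of_minimal) simp
  then show "?C = topspace X" using x(2) closure_of_subset_topspace[of X "orbit X T y"] by simp
qed


section \<open>Polynomial phases\<close>

definition Delta :: "(int \<Rightarrow> complex) \<Rightarrow> int \<Rightarrow> complex" where
  "Delta f n = f (n + 1) * cnj (f n)"

text \<open>A phase of degree \<open>d\<close> is what remains of \<open>n \<mapsto> e(p(n))\<close>, \<open>p\<close> a real polynomial of degree at
  most \<open>d\<close>, when the coefficients are forgotten: its \<open>d\<close>-th multiplicative difference is a
  constant \<open>c\<close>, namely \<open>e(d! a)\<close> for the coefficient \<open>a\<close> of \<open>n ^ d\<close>. In this form the class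
  is visibly closed under products and translations and, for fixed \<open>d\<close> and \<open>c\<close>, under
  pointwise limits.\<close>

definition phase :: "nat \<Rightarrow> complex \<Rightarrow> (int \<Rightarrow> complex) \<Rightarrow> bool" where
  "phase d c f \<longleftrightarrow> (\<forall>n. cmod (f n) = 1) \<and> (\<forall>n. (Delta ^^ d) f n = c)"

lemma mult_cnj_unit: "cmod z = 1 \<Longrightarrow> z * cnj z = 1"
  by (metis complex_norm_square mult.commute of_real_1 power_one)

lemma funpow_Delta_mult:
  "(Delta ^^ d) (\<lambda>n. f n * g n) = (\<lambda>n. (Delta ^^ d) f n * (Delta ^^ d) g n)"
  by (induction d) (auto simp: Delta_def fun_eq_iff)

lemma funpow_Delta_cnj: "(Delta ^^ d) (\<lambda>n. cnj (f n)) = (\<lambda>n. cnj ((Delta ^^ d) f n))"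
  by (induction d) (auto simp: Delta_def fun_eq_iff)

lemma funpow_Delta_shift: "(Delta ^^ d) (\<lambda>n. f (n + k)) = (\<lambda>n. (Delta ^^ d) f (n + k))"
  by (induction d) (auto simp: Delta_def fun_eq_iff algebra_simps)

lemma norm_funpow_Delta:
  assumes "\<And>n. cmod (f n) = 1"
  shows "cmod ((Delta ^^ d) f n) = 1"
  using assms by (induction d arbitrary: n) (auto simp: Delta_def norm_mult)

lemma funpow_Delta_one: "(Delta ^^ d) (\<lambda>_. 1) = (\<lambda>_. 1)"
  by (induction d) (auto simp: Delta_def fun_eq_iff)

lemma phaseI: "(\<And>n. cmod (f n) = 1) \<Longrightarrow> (\<And>n. (Delta ^^ d) f n = c) \<Longrightarrow> phase d c f"
  and phase_norm: "phase d c f \<Longrightarrow> cmod (f n) = 1"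
  and phase_funpow: "phase d c f \<Longrightarrow> (Delta ^^ d) f n = c"
  by (auto simp: phase_def)

lemma phase_norm_const: "phase d c f \<Longrightarrow> cmod c = 1"
  using norm_funpow_Delta[of f d 0] by (simp add: phase_def)

lemma phase_Suc: "phase (Suc d) c f \<longleftrightarrow> (\<forall>n. cmod (f n) = 1) \<and> phase d c (Delta f)"
  by (auto simp: phase_def funpow_swap1 Delta_def norm_mult)

lemma phase_mult: "phase d c f \<Longrightarrow> phase d c' g \<Longrightarrow> phase d (c * c') (\<lambda>n. f n * g n)"
  by (simp add: phase_def funpow_Delta_mult norm_mult)

lemma phase_cnj: "phase d c f \<Longrightarrow> phase d (cnj c) (\<lambda>n. cnj (f n))"
  by (simp add: phase_def funpow_Delta_cnj)

lemma phase_translate: "phase d c f \<Longrightarrow> phase d c (\<lambda>n. f (n + k))"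
  by (simp add: phase_def funpow_Delta_shift)

lemma phase_one: "phase d 1 (\<lambda>_. 1)"
  by (simp add: phase_def funpow_Delta_one)

lemma phase_lift: "phase d c f \<Longrightarrow> phase (Suc d) 1 f"
  using phase_norm_const[of d c f] by (simp add: phase_def Delta_def mult_cnj_unit)

lemma phase_lift_less: "d < e \<Longrightarrow> phase d c f \<Longrightarrow> phase e 1 f"
proof (induction e)
  case (Suc e)
  then show ?case by (cases "d = e") (auto intro: phase_lift)
qed simp

text \<open>A trivial top difference means that the difference one level below is already constant.\<close>

lemma phase_drop:
  assumes "phase (Suc d) 1 f"
  shows "\<exists>c. phase d c f"
proof -
  let ?h = "(Delta ^^ d) f"
  have n: "cmod (?h n) = 1" for n
    by (rule norm_funpow_Delta) (rule phase_norm[OF assms])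
  have "?h (n + 1) = ?h n" for n
  proof -
    have "?h (n + 1) * cnj (?h n) = 1"
      using phase_funpow[OF assms, of n] by (simp add: Delta_def)
    then have "?h (n + 1) * (?h n * cnj (?h n)) = ?h n" by (simp add: algebra_simps)
    then show ?thesis using mult_cnj_unit[OF n[of n]] by simp
  qed
  note step = this
  have "?h n = ?h 0" for n
  proof (induction n rule: int_induct[where k = 0])
    case (step2 i)
    then show ?case using step[of "i - 1"] by simp
  qed (use step in auto)
  then show ?thesis using phase_norm[OF assms] by (intro exI[of _ "?h 0"] phaseI)
qed

text \<open>Lowering the degree as long as the top constant is \<open>1\<close> ends at a constant that tells the phase
  from the function \<open>1\<close>. This is the invariant behind distality of the Weyl flow.\<close>

lemma phase_nontrivial_difference:
  assumes "phase d 1 f" "f \<noteq> (\<lambda>_. 1)"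
  obtains e c where "phase e c f" "c \<noteq> 1"
proof -
  have "\<exists>e c. phase e c f \<and> c \<noteq> 1"
    using assms
  proof (induction d)
    case 0
    then show ?case by (auto simp: phase_def fun_eq_iff)
  next
    case (Suc d)
    then obtain c where "phase d c f" using phase_drop by blast
    with Suc show ?case by (cases "c = 1") auto
  qed
  then show thesis using that by blast
qed

text \<open>Differencing with an arbitrary step \<open>h\<close> lowers the degree and raises the constant to the power
  \<open>h\<close>: the step \<open>h\<close> quotient is a product of \<open>h\<close> translates of the step \<open>1\<close> quotient.\<close>

lemma phase_difference:
  assumes "phase (Suc d) c f"
  shows "phase d (c ^ h) (\<lambda>n. f (n + int h) * cnj (f n))"
proof (induction h)
  case 0
  then show ?case using phase_norm[OF assms] phase_one by (simp add: mult_cnj_unit)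
next
  case (Suc h)
  have D: "phase d c (Delta f)" using assms by (simp add: phase_Suc)
  have "Delta f (n + int h) * (f (n + int h) * cnj (f n)) = f (n + int (Suc h)) * cnj (f n)" for n
  proof -
    have "Delta f (n + int h) * (f (n + int h) * cnj (f n)) =
      f (n + int (Suc h)) * (f (n + int h) * cnj (f (n + int h))) * cnj (f n)"
      by (simp add: Delta_def algebra_simps)
    then show ?thesis using phase_norm[OF assms] by (simp add: mult_cnj_unit)
  qed
  then show ?case
    using phase_mult[OF phase_translate[OF D, of "int h"] Suc.IH] by (simp only: power_Suc)
qed

text \<open>On a progression of step \<open>q\<close> the leading coefficient is multiplied by \<open>q ^ d\<close>. If \<open>c\<close> is a
  root of unity of order dividing \<open>q\<close> the constant becomes \<open>1\<close> and the degree drops.\<close>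

lemma phase_dilate:
  "phase d c f \<Longrightarrow> phase d (c ^ (q ^ d)) (\<lambda>n. f (int q * n + r))"
proof (induction d arbitrary: c f)
  case 0
  then show ?case
    using phase_norm_const[OF 0] phase_funpow[OF 0] by (intro phaseI) simp_all
next
  case (Suc d)
  have "phase d ((c ^ q) ^ (q ^ d)) (\<lambda>n. f (int q * n + r + int q) * cnj (f (int q * n + r)))"
    using Suc.IH[OF phase_difference[OF Suc.prems, of q]] by simp
  moreover have "(\<lambda>n. f (int q * n + r + int q) * cnj (f (int q * n + r))) =
      Delta (\<lambda>n. f (int q * n + r))"
    by (simp add: Delta_def fun_eq_iff algebra_simps)
  ultimately show ?case
    using phase_norm[OF Suc.prems] by (simp add: phase_Suc power_mult)
qed

definition is_phase :: "(int \<Rightarrow> complex) \<Rightarrow> bool" where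
  "is_phase f \<longleftrightarrow> (\<exists>d c. phase d c f)"

lemma is_phase_mult:
  assumes "is_phase f" "is_phase g"
  shows "is_phase (\<lambda>n. f n * g n)"
proof -
  obtain d c e c' where f: "phase d c f" and g: "phase e c' g"
    using assms by (auto simp: is_phase_def)
  let ?m = "Suc (max d e)"
  have "phase ?m (1 * 1) (\<lambda>n. f n * g n)"
    by (intro phase_mult phase_lift_less[OF _ f] phase_lift_less[OF _ g]) auto
  then show ?thesis unfolding is_phase_def by blast
qed

lemma is_phase_prod:
  "finite A \<Longrightarrow> (\<And>j. j \<in> A \<Longrightarrow> is_phase (f j)) \<Longrightarrow> is_phase (\<lambda>n. \<Prod>j\<in>A. f j n)"
proof (induction A rule: finite_induct)
  case empty
  then show ?case using phase_one[of 0] by (auto simp: is_phase_def)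
next
  case (insert x A)
  then show ?case by (simp add: is_phase_mult)
qed

lemma weyl_generator_cis: "weyl_generator k \<alpha> n = cis (2 * pi * \<alpha> * of_int n ^ k)"
  by (simp add: weyl_generator_def cis_conv_exp algebra_simps)

lemma prod_cis: "(\<Prod>j\<in>A. cis (f j)) = cis (\<Sum>j\<in>A. f j)"
  by (induction A rule: infinite_finite_induct) (auto simp: cis_mult)

text \<open>The polynomial \<open>(n + 1) ^ k - n ^ k\<close> has degree less than \<open>k\<close>; its binomial expansion drives
  the induction that every Weyl generator is a phase.\<close>

lemma Delta_weyl_generator:
  "Delta (weyl_generator k \<alpha>) = (\<lambda>n. \<Prod>j<k. weyl_generator j (\<alpha> * (k choose j)) n)"
proof
  fix n
  have "(of_int n + 1) ^ k = (\<Sum>j\<le>k. of_nat (k choose j) * of_int n ^ j :: real)"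
    by (subst binomial_ring) simp
  also have "\<dots> = (\<Sum>j<k. of_nat (k choose j) * of_int n ^ j) + of_int n ^ k"
    by (simp add: lessThan_Suc_atMost[symmetric])
  finally have "2 * pi * \<alpha> * (of_int n + 1) ^ k - 2 * pi * \<alpha> * of_int n ^ k =
      2 * pi * \<alpha> * (\<Sum>j<k. of_nat (k choose j) * of_int n ^ j :: real)"
    by (simp add: algebra_simps)
  also have "\<dots> = (\<Sum>j<k. 2 * pi * (\<alpha> * (k choose j)) * of_int n ^ j)"
    by (simp add: sum_distrib_left algebra_simps)
  finally show "Delta (weyl_generator k \<alpha>) n = (\<Prod>j<k. weyl_generator j (\<alpha> * (k choose j)) n)"
    by (simp add: Delta_def weyl_generator_cis prod_cis cis_cnj cis_mult algebra_simps)
qed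

lemma is_phase_weyl_generator: "is_phase (weyl_generator k \<alpha>)"
proof (induction k arbitrary: \<alpha> rule: less_induct)
  case (less k)
  have "is_phase (Delta (weyl_generator k \<alpha>))"
    unfolding Delta_weyl_generator by (intro is_phase_prod less) auto
  then obtain d c where "phase d c (Delta (weyl_generator k \<alpha>))" by (auto simp: is_phase_def)
  then have "phase (Suc d) c (weyl_generator k \<alpha>)"
    by (simp add: phase_Suc weyl_generator_cis)
  then show ?case by (auto simp: is_phase_def)
qed


section \<open>Uniform Weyl equidistribution\<close>

definition window :: "(int \<Rightarrow> complex) \<Rightarrow> nat \<Rightarrow> int \<Rightarrow> complex" where
  "window f N k = (\<Sum>i<N. f (k + int i))"

text \<open>The averages of \<open>f\<close> over long intervals do not depend on the position of the interval, up to a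
  small error. Comparing two positions avoids naming the limit of the averages, and makes the
  property linear and closed under uniform limits for trivial reasons.\<close>

definition uniform_means :: "(int \<Rightarrow> complex) \<Rightarrow> bool" where
  "uniform_means f \<longleftrightarrow> (\<forall>e>0. \<exists>N0. \<forall>N\<ge>N0. \<forall>k l.
     cmod (window f N k - window f N l) \<le> e * real N)"

definition uniform_means_zero :: "(int \<Rightarrow> complex) \<Rightarrow> bool" where
  "uniform_means_zero f \<longleftrightarrow> (\<forall>e>0. \<exists>N0. \<forall>N\<ge>N0. \<forall>k. cmod (window f N k) \<le> e * real N)"

lemma uniform_means_zero_imp:
  assumes "uniform_means_zero f"
  shows "uniform_means f"
  unfolding uniform_means_def
proof (intro allI impI)
  fix e :: real assume "e > 0"
  then obtain N0 where N0: "\<And>N k. N \<ge> N0 \<Longrightarrow> cmod (window f N k) \<le> e / 2 * real N"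
    using assms half_gt_zero unfolding uniform_means_zero_def by metis
  have "cmod (window f N k - window f N l) \<le> e * real N" if "N \<ge> N0" for N k l
    using norm_triangle_ineq4[of "window f N k" "window f N l"] N0[OF that, of k] N0[OF that, of l]
    by simp
  then show "\<exists>N0. \<forall>N\<ge>N0. \<forall>k l. cmod (window f N k - window f N l) \<le> e * real N" by blast
qed

lemma norm_window_le: "(\<And>n. cmod (f n) \<le> B) \<Longrightarrow> cmod (window f N k) \<le> real N * B"
  unfolding window_def using sum_norm_bound[of "{..<N}" "\<lambda>i. f (k + int i)" B] by simp

lemma window_add: "window f (M + N) k = window f M k + window f N (k + int M)"
proof -
  have "(\<Sum>i<M + N. f (k + int i)) = (\<Sum>i<M. f (k + int i)) + (\<Sum>i<N. f (k + int (M + i)))"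
    by (induction N) (auto simp: algebra_simps)
  then show ?thesis by (simp add: window_def algebra_simps)
qed

lemma window_sum: "window (\<lambda>n. \<Sum>h\<in>A. g h n) N k = (\<Sum>h\<in>A. window (g h) N k)"
  unfolding window_def by (rule sum.swap)

lemma uniform_means_add:
  assumes "uniform_means f" "uniform_means g"
  shows "uniform_means (\<lambda>n. f n + g n)"
  unfolding uniform_means_def
proof (intro allI impI)
  fix e :: real assume e: "e > 0"
  obtain N1 where N1: "\<And>N k l. N \<ge> N1 \<Longrightarrow> cmod (window f N k - window f N l) \<le> e / 2 * real N"
    using assms(1) half_gt_zero[OF e] unfolding uniform_means_def by metis
  obtain N2 where N2: "\<And>N k l. N \<ge> N2 \<Longrightarrow> cmod (window g N k - window g N l) \<le> e / 2 * real N"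
    using assms(2) half_gt_zero[OF e] unfolding uniform_means_def by metis
  have "cmod (window (\<lambda>n. f n + g n) N k - window (\<lambda>n. f n + g n) N l) \<le> e * real N"
    if N: "N \<ge> max N1 N2" for N k l
  proof -
    have "window (\<lambda>n. f n + g n) N k - window (\<lambda>n. f n + g n) N l =
        (window f N k - window f N l) + (window g N k - window g N l)"
      by (simp add: window_def sum.distrib)
    then show ?thesis
      using norm_triangle_ineq[of "window f N k - window f N l" "window g N k - window g N l"]
        N1[of N k l] N2[of N k l] N by simp
  qed
  then show "\<exists>N0. \<forall>N\<ge>N0. \<forall>k l.
      cmod (window (\<lambda>n. f n + g n) N k - window (\<lambda>n. f n + g n) N l) \<le> e * real N" by blast
qed

lemma uniform_means_scale:
  assumes "uniform_means f"
  shows "uniform_means (\<lambda>n. a * f n)"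
  unfolding uniform_means_def
proof (intro allI impI)
  fix e :: real assume e: "e > 0"
  define e' where "e' = e / (cmod a + 1)"
  have e': "e' > 0" "cmod a * e' \<le> e"
    using e by (auto simp: e'_def field_simps add_pos_nonneg)
  obtain N0 where N0: "\<And>N k l. N \<ge> N0 \<Longrightarrow> cmod (window f N k - window f N l) \<le> e' * real N"
    using assms e' unfolding uniform_means_def by metis
  have "cmod (window (\<lambda>n. a * f n) N k - window (\<lambda>n. a * f n) N l) \<le> e * real N"
    if "N \<ge> N0" for N k l
  proof -
    have "window (\<lambda>n. a * f n) N k - window (\<lambda>n. a * f n) N l = a * (window f N k - window f N l)"
      by (simp add: window_def sum_distrib_left right_diff_distrib)
    then have "cmod (window (\<lambda>n. a * f n) N k - window (\<lambda>n. a * f n) N l) \<le> cmod a * (e' * real N)"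
      using N0[OF that, of k l] by (simp add: norm_mult mult_left_mono)
    also have "\<dots> \<le> e * real N" using e'(2) mult_right_mono[of "cmod a * e'" e "real N"]
      by (simp add: mult.assoc)
    finally show ?thesis .
  qed
  then show "\<exists>N0. \<forall>N\<ge>N0. \<forall>k l.
      cmod (window (\<lambda>n. a * f n) N k - window (\<lambda>n. a * f n) N l) \<le> e * real N" by blast
qed

lemma uniform_means_closed:
  assumes "\<And>e. e > 0 \<Longrightarrow> \<exists>g. uniform_means g \<and> (\<forall>n. cmod (f n - g n) \<le> e)"
  shows "uniform_means f"
  unfolding uniform_means_def
proof (intro allI impI)
  fix e :: real assume e: "e > 0"
  then obtain g where g: "uniform_means g" "\<And>n. cmod (f n - g n) \<le> e / 3"
    using assms[of "e / 3"] by auto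
  obtain N0 where N0: "\<And>N k l. N \<ge> N0 \<Longrightarrow> cmod (window g N k - window g N l) \<le> e / 3 * real N"
    using g(1) e unfolding uniform_means_def by (metis divide_pos_pos zero_less_numeral)
  have d: "cmod (window f N k - window g N k) \<le> e / 3 * real N" for N k
  proof -
    have "window f N k - window g N k = window (\<lambda>n. f n - g n) N k"
      by (simp add: window_def sum_subtractf)
    then show ?thesis
      using norm_window_le[of "\<lambda>n. f n - g n", OF g(2), of N k] by (simp add: mult.commute)
  qed
  have "cmod (window f N k - window f N l) \<le> e * real N" if "N \<ge> N0" for N k l
  proof -
    have "window f N k - window f N l = (window f N k - window g N k)
        + (window g N k - window g N l) - (window f N l - window g N l)" by simp
    then have "cmod (window f N k - window f N l) \<le> cmod (window f N k - window g N k)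
        + cmod (window g N k - window g N l) + cmod (window f N l - window g N l)"
      by (smt (verit) norm_triangle_ineq norm_triangle_ineq4)
    then show ?thesis using d[of N k] d[of N l] N0[OF that, of k l] by simp
  qed
  then show "\<exists>N0. \<forall>N\<ge>N0. \<forall>k l. cmod (window f N k - window f N l) \<le> e * real N" by blast
qed

lemma norm_window_square_le:
  "(cmod (window g N k))\<^sup>2 \<le> real N * (\<Sum>i<N. (cmod (g (k + int i)))\<^sup>2)"
proof -
  have "(cmod (window g N k))\<^sup>2 \<le> (\<Sum>i<N. 1 * cmod (g (k + int i)))\<^sup>2"
    unfolding window_def by (intro power_mono) (simp_all add: norm_sum)
  also have "\<dots> \<le> (\<Sum>i<N. 1\<^sup>2) * (\<Sum>i<N. (cmod (g (k + int i)))\<^sup>2)"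
    by (rule Cauchy_Schwarz_ineq_sum)
  finally show ?thesis by simp
qed

text \<open>Averaging over \<open>H\<close> shifts changes a long mean very little, and by Cauchy--Schwarz the mean of the
  averaged function is bounded by its correlations. The \<open>H\<close> diagonal correlations contribute
  \<open>1 / H\<close> after normalisation, the others are small by assumption.\<close>

lemma van_der_Corput:
  assumes norm: "\<And>n. cmod (f n) = 1"
    and diff: "\<And>h. h > 0 \<Longrightarrow> uniform_means_zero (\<lambda>n. f (n + int h) * cnj (f n))"
  shows "uniform_means_zero f"
  unfolding uniform_means_zero_def
proof (intro allI impI)
  fix e :: real assume e: "e > 0"
  \<comment> \<open>The normalised bound is \<open>1 / H + d \<le> 2 * d = (e / 2)\<^sup>2\<close>; the rest of \<open>e\<close> pays for the shifts, at most \<open>2 * H\<close> in total.\<close>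
  define d where "d = e\<^sup>2 / 8"
  have d: "d > 0" using e by (simp add: d_def)
  define H where "H = nat \<lceil>1 / d\<rceil>"
  have H: "1 / d \<le> real H" unfolding H_def by linarith
  then have H0: "H > 0" using d by (cases "H = 0") auto
  have "\<exists>N0. \<forall>N\<ge>N0. \<forall>k. cmod (window (\<lambda>n. f (n + int h) * cnj (f n)) N k) \<le> d * real N"
    if "h > 0" for h
    using diff[OF that] d unfolding uniform_means_zero_def by simp
  then obtain N0 where N0: "\<And>h N k. h > 0 \<Longrightarrow> N \<ge> N0 h \<Longrightarrow>
      cmod (window (\<lambda>n. f (n + int h) * cnj (f n)) N k) \<le> d * real N"
    by metis
  define N1 where "N1 = Max (N0 ` {..H}) + nat \<lceil>4 * real H / e\<rceil>"
  have "cmod (window f N k) \<le> e * real N" if N: "N \<ge> N1" for N k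
  proof -
    have NH: "4 * real H / e \<le> real N" using N unfolding N1_def by linarith
    have N0': "N \<ge> N0 h" if "h \<le> H" for h
    proof -
      have "N0 h \<le> Max (N0 ` {..H})" using that by (intro Max_ge) auto
      then show ?thesis using N by (simp add: N1_def)
    qed
    define g where "g n = (\<Sum>h<H. f (n + int h))" for n
    have corr: "cmod (\<Sum>i<N. f (k + int i + int h) * cnj (f (k + int i + int h'))) \<le>
        (if h = h' then real N else 0) + d * real N"
      if hh: "h < H" "h' < H" for h h'
    proof -
      consider "h = h'" | "h' < h" | "h < h'" by linarith
      then show ?thesis
      proof cases
        case 1
        then show ?thesis using d norm by (simp add: mult_cnj_unit)
      next
        case 2
        have "(\<Sum>i<N. f (k + int i + int h) * cnj (f (k + int i + int h'))) =
            window (\<lambda>n. f (n + int (h - h')) * cnj (f n)) N (k + int h')"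
          unfolding window_def using 2 by (intro sum.cong) (auto simp: algebra_simps of_nat_diff)
        then show ?thesis using N0[of "h - h'" N "k + int h'"] N0'[of "h - h'"] 2 hh by simp
      next
        case 3
        have "(\<Sum>i<N. f (k + int i + int h) * cnj (f (k + int i + int h'))) =
            cnj (window (\<lambda>n. f (n + int (h' - h)) * cnj (f n)) N (k + int h))"
          unfolding window_def cnj_sum
          using 3 by (intro sum.cong) (auto simp: algebra_simps of_nat_diff)
        then show ?thesis using N0[of "h' - h" N "k + int h"] N0'[of "h' - h"] 3 hh by simp
      qed
    qed
    have "of_real (\<Sum>i<N. (cmod (g (k + int i)))\<^sup>2) =
        (\<Sum>i<N. \<Sum>h<H. \<Sum>h'<H. f (k + int i + int h) * cnj (f (k + int i + int h')))"
      unfolding of_real_sum complex_norm_square g_def by (simp add: sum_product)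
    also have "\<dots> = (\<Sum>h<H. \<Sum>i<N. \<Sum>h'<H. f (k + int i + int h) * cnj (f (k + int i + int h')))"
      by (rule sum.swap)
    also have "\<dots> = (\<Sum>h<H. \<Sum>h'<H. \<Sum>i<N. f (k + int i + int h) * cnj (f (k + int i + int h')))"
      by (rule sum.cong[OF refl], rule sum.swap)
    finally have eq: "of_real (\<Sum>i<N. (cmod (g (k + int i)))\<^sup>2) =
      (\<Sum>h<H. \<Sum>h'<H. \<Sum>i<N. f (k + int i + int h) * cnj (f (k + int i + int h')))" .
    have "(\<Sum>i<N. (cmod (g (k + int i)))\<^sup>2) = cmod (of_real (\<Sum>i<N. (cmod (g (k + int i)))\<^sup>2))"
      by (simp add: sum_nonneg del: of_real_sum)
    also have "\<dots> \<le> (\<Sum>h<H. \<Sum>h'<H. (if h = h' then real N else 0) + d * real N)"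
      unfolding eq by (intro sum_norm_le) (use corr in auto)
    also have "\<dots> = real H * real N + real H * real H * (d * real N)"
      by (simp add: sum.distrib algebra_simps)
    finally have g2: "(\<Sum>i<N. (cmod (g (k + int i)))\<^sup>2) \<le>
        real H * real N + real H * real H * (d * real N)" .
    have "(cmod (window g N k))\<^sup>2 \<le> real N * (real H * real N + real H * real H * (d * real N))"
      using norm_window_square_le[of g N k] mult_left_mono[OF g2, of "real N"] by simp
    also have "\<dots> = (real N)\<^sup>2 * (real H)\<^sup>2 * (1 / real H + d)"
      using H0 by (simp add: power2_eq_square field_simps)
    also have "\<dots> \<le> (real N)\<^sup>2 * (real H)\<^sup>2 * (e / 2)\<^sup>2"
    proof (intro mult_left_mono)
      have "1 / real H \<le> d" using H H0 d by (simp add: field_simps)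
      then show "1 / real H + d \<le> (e / 2)\<^sup>2" by (simp add: d_def power2_eq_square)
    qed simp
    finally have "(cmod (window g N k))\<^sup>2 \<le> (real N * real H * (e / 2))\<^sup>2"
      by (simp only: power_mult_distrib)
    then have wg: "cmod (window g N k) \<le> real N * real H * (e / 2)"
      by (rule power2_le_imp_le) (use e in simp)
    have shift: "cmod (window f N (k + int h) - window f N k) \<le> 2 * real H" if "h < H" for h
    proof -
      have "window f h k + window f N (k + int h) = window f N k + window f h (k + int N)"
        unfolding window_add[symmetric] by (simp add: add.commute)
      then have "window f N (k + int h) - window f N k = window f h (k + int N) - window f h k"
        by (simp add: algebra_simps)
      then have "cmod (window f N (k + int h) - window f N k) \<le>
          cmod (window f h (k + int N)) + cmod (window f h k)"
        by (simp add: norm_triangle_ineq4)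
      also have "\<dots> \<le> real h + real h"
        using norm_window_le[of f 1 h] norm by (intro add_mono) auto
      finally show ?thesis using that by simp
    qed
    have "window g N k = (\<Sum>h<H. window f N (k + int h))"
      unfolding g_def window_sum by (simp add: window_def algebra_simps)
    then have "of_nat H * window f N k =
        window g N k - (\<Sum>h<H. window f N (k + int h) - window f N k)"
      by (simp add: sum_subtractf)
    then have "real H * cmod (window f N k) \<le> cmod (window g N k) +
        cmod (\<Sum>h<H. window f N (k + int h) - window f N k)"
      by (metis norm_mult norm_of_nat norm_triangle_ineq4)
    also have "\<dots> \<le> real N * real H * (e / 2) + real H * (2 * real H)"
      using wg sum_norm_bound[of "{..<H}" "\<lambda>h. window f N (k + int h) - window f N k" "2 * real H"]
        shift by auto
    also have "\<dots> = real H * (real N * (e / 2) + 2 * real H)" by (simp add: algebra_simps)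
    finally have "cmod (window f N k) \<le> real N * (e / 2) + 2 * real H"
      using H0 by (simp add: mult_le_cancel_left_pos)
    also have "\<dots> \<le> e * real N" using NH e by (simp add: field_simps)
    finally show ?thesis .
  qed
  then show "\<exists>N0. \<forall>N\<ge>N0. \<forall>k. cmod (window f N k) \<le> e * real N" by blast
qed

text \<open>Induction on the degree: for degree one the window sums are geometric and bounded; in higher degree
  the differences of step \<open>h\<close> have constant \<open>c ^ h\<close>, again not a root of unity.\<close>

lemma phase_irrational_means_zero:
  "phase (Suc d) c f \<Longrightarrow> (\<And>q. q > 0 \<Longrightarrow> c ^ q \<noteq> 1) \<Longrightarrow> uniform_means_zero f"
proof (induction d arbitrary: c f)
  case 0
  have c1: "c \<noteq> 1" using 0(2)[of 1] by simp
  have nc: "cmod c = 1" using phase_norm_const[OF 0(1)] .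
  have step: "f (n + 1) = c * f n" for n
  proof -
    have "f (n + 1) * cnj (f n) = c" using phase_funpow[OF 0(1), of n] by (simp add: Delta_def)
    then have "f (n + 1) * (f n * cnj (f n)) = c * f n" by (simp add: algebra_simps)
    then show ?thesis using phase_norm[OF 0(1)] by (simp add: mult_cnj_unit)
  qed
  have "f (k + int i) = c ^ i * f k" for k i
  proof (induction i)
    case (Suc i)
    then show ?case using step[of "k + int i"] by (simp add: algebra_simps)
  qed simp
  then have "window f N k = (\<Sum>i<N. c ^ i) * f k" for N k
    by (simp add: window_def sum_distrib_right)
  then have w: "window f N k = (c ^ N - 1) / (c - 1) * f k" for N k
    by (simp add: geometric_sum[OF c1])
  have bound: "cmod (window f N k) \<le> 2 / cmod (c - 1)" for N k
  proof -
    have "cmod (c ^ N - 1) \<le> 2"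
      using norm_triangle_ineq4[of "c ^ N" 1] nc by (simp add: norm_power)
    then show ?thesis
      using phase_norm[OF 0(1)] by (simp add: w norm_mult norm_divide divide_right_mono)
  qed
  show ?case
    unfolding uniform_means_zero_def
  proof (intro allI impI)
    fix e :: real assume e: "e > 0"
    have "cmod (window f N k) \<le> e * real N" if "N \<ge> nat \<lceil>2 / cmod (c - 1) / e\<rceil>" for N k
    proof -
      have "2 / cmod (c - 1) / e \<le> real N" using that by linarith
      then have "2 / cmod (c - 1) \<le> real N * e" unfolding pos_divide_le_eq[OF e] .
      then show ?thesis using bound[of N k] by (simp add: mult.commute)
    qed
    then show "\<exists>N0. \<forall>N\<ge>N0. \<forall>k. cmod (window f N k) \<le> e * real N" by blast
  qed
next
  case (Suc d)
  show ?case
  proof (rule van_der_Corput)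
    show "cmod (f n) = 1" for n by (rule phase_norm[OF Suc.prems(1)])
    fix h :: nat assume h: "h > 0"
    show "uniform_means_zero (\<lambda>n. f (n + int h) * cnj (f n))"
    proof (rule Suc.IH)
      show "phase (Suc d) (c ^ h) (\<lambda>n. f (n + int h) * cnj (f n))"
        by (rule phase_difference[OF Suc.prems(1)])
      show "(c ^ h) ^ q \<noteq> 1" if "q > 0" for q
        using Suc.prems(2)[of "h * q"] h that by (simp add: power_mult)
    qed
  qed
qed

text \<open>A window splits, up to a boundary of length at most \<open>3 q\<close>, into windows of length \<open>N div q\<close> in
  the \<open>q\<close> residue classes.\<close>

lemma uniform_means_progressions:
  assumes q: "q > 0" and bd: "\<And>n. cmod (f n) \<le> 1"
    and r: "\<And>r. r < q \<Longrightarrow> uniform_means (\<lambda>n. f (int q * n + int r))"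
  shows "uniform_means f"
  unfolding uniform_means_def
proof (intro allI impI)
  fix e :: real assume e: "e > 0"
  have "\<exists>N0. \<forall>N\<ge>N0. \<forall>k l. cmod (window (\<lambda>n. f (int q * n + int r)) N k
      - window (\<lambda>n. f (int q * n + int r)) N l) \<le> e / 2 * real N" if "r < q" for r
    by (rule r[OF that, unfolded uniform_means_def, THEN spec, THEN mp, OF half_gt_zero[OF e]])
  then obtain N0 where N0: "\<And>r N k l. r < q \<Longrightarrow> N \<ge> N0 r \<Longrightarrow>
      cmod (window (\<lambda>n. f (int q * n + int r)) N k
      - window (\<lambda>n. f (int q * n + int r)) N l) \<le> e / 2 * real N"
    by metis
  \<comment> \<open>Both windows lose \<open>3 * q\<close> by alignment, together at most \<open>e / 2 * N\<close>.\<close>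
  define N1 where "N1 = q * Max (N0 ` {..<q}) + nat \<lceil>12 * real q / e\<rceil>"
  have split: "window f (q * M) (int q * k) = (\<Sum>r<q. window (\<lambda>n. f (int q * n + int r)) M k)"
    for M k
  proof (induction M)
    case (Suc M)
    have "window f (q * Suc M) (int q * k) =
        window f (q * M) (int q * k) + window f q (int q * (k + int M))"
      using window_add[of f "q * M" q "int q * k"] by (simp add: algebra_simps)
    also have "window f q (int q * (k + int M)) = (\<Sum>r<q. f (int q * (k + int M) + int r))"
      by (simp add: window_def)
    finally show ?case using Suc.IH by (simp add: window_def sum.distrib)
  qed (simp add: window_def)
  have "cmod (window f N k - window f N l) \<le> e * real N" if N: "N \<ge> N1" for N k l
  proof -
    define M where "M = N div q"
    have NM: "N = q * M + N mod q" by (simp add: M_def)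
    have Nq: "12 * real q / e \<le> real N" using N unfolding N1_def by linarith
    have M: "M \<ge> N0 r" if "r < q" for r
    proof -
      have "N0 r \<le> Max (N0 ` {..<q})" using that by (intro Max_ge) auto
      moreover have "Max (N0 ` {..<q}) * q \<le> N" using N by (simp add: N1_def mult.commute)
      then have "Max (N0 ` {..<q}) \<le> M" using q by (simp add: M_def less_eq_div_iff_mult_less_eq)
      ultimately show ?thesis by simp
    qed
    have align: "cmod (window f N k - window f (q * M) (int q * (k div int q))) \<le> 3 * real q" for k
    proof -
      define t where "t = nat (k mod int q)"
      have t: "int t = k mod int q" "t < q" using q by (auto simp: t_def nat_less_iff)
      let ?k = "int q * (k div int q)"
      have k: "?k + int t = k" by (simp add: t)
      have "window f t ?k + window f N k = window f (t + N) ?k"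
        using window_add[of f t N ?k] k by simp
      also have "t + N = q * M + (t + N mod q)" using NM by simp
      also have "window f \<dots> ?k =
          window f (q * M) ?k + window f (t + N mod q) (?k + int (q * M))"
        by (rule window_add)
      finally have "window f N k - window f (q * M) ?k =
          window f (t + N mod q) (?k + int (q * M)) - window f t ?k"
        by (simp add: algebra_simps)
      then have "cmod (window f N k - window f (q * M) ?k) \<le>
          cmod (window f (t + N mod q) (?k + int (q * M))) + cmod (window f t ?k)"
        by (simp add: norm_triangle_ineq4)
      also have "\<dots> \<le> real (t + N mod q) * 1 + real t * 1"
        by (intro add_mono norm_window_le bd)
      also have "\<dots> \<le> 3 * real q"
      proof -
        have "N mod q < q" using q by simp
        then have "t + N mod q + t \<le> 3 * q" using t(2) by linarith
        then have "real (t + N mod q + t) \<le> real (3 * q)" by (rule of_nat_mono)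
        then show ?thesis by simp
      qed
      finally show ?thesis .
    qed
    let ?k = "k div int q" and ?l = "l div int q"
    have "window f (q * M) (int q * ?k) - window f (q * M) (int q * ?l) =
        (\<Sum>r<q. window (\<lambda>n. f (int q * n + int r)) M ?k - window (\<lambda>n. f (int q * n + int r)) M ?l)"
      by (simp add: split sum_subtractf)
    also have "cmod \<dots> \<le> real (card {..<q}) * (e / 2 * real M)"
      by (rule sum_norm_bound) (use N0 M in auto)
    also have "\<dots> = e / 2 * real (q * M)" by simp
    also have "\<dots> \<le> e / 2 * real N"
      using e NM by (intro mult_left_mono of_nat_mono) (linarith, simp)
    finally have mid: "cmod (window f (q * M) (int q * ?k) - window f (q * M) (int q * ?l)) \<le> e / 2 * real N" .
    have "window f N k - window f N l = (window f N k - window f (q * M) (int q * ?k))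
        + (window f (q * M) (int q * ?k) - window f (q * M) (int q * ?l))
        - (window f N l - window f (q * M) (int q * ?l))" by simp
    then have "cmod (window f N k - window f N l) \<le> cmod (window f N k - window f (q * M) (int q * ?k))
        + cmod (window f (q * M) (int q * ?k) - window f (q * M) (int q * ?l))
        + cmod (window f N l - window f (q * M) (int q * ?l))"
      by (smt (verit) norm_triangle_ineq norm_triangle_ineq4)
    also have "\<dots> \<le> 3 * real q + e / 2 * real N + 3 * real q"
      using align mid by (intro add_mono) auto
    also have "\<dots> \<le> e * real N" using Nq e by (simp add: field_simps)
    finally show ?thesis .
  qed
  then show "\<exists>N0. \<forall>N\<ge>N0. \<forall>k l. cmod (window f N k - window f N l) \<le> e * real N" by blast
qed

text \<open>Either the top constant is no root of unity and the means tend to zero, or the phase has smaller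
  degree on each residue class modulo the order of the root of unity.\<close>

lemma phase_uniform_means: "phase d c f \<Longrightarrow> uniform_means f"
proof (induction d arbitrary: c f)
  case 0
  then have "f = (\<lambda>n. c)" by (auto simp: phase_def)
  then show ?case by (auto simp: uniform_means_def window_def)
next
  case (Suc d)
  show ?case
  proof (cases "\<exists>q>0. c ^ q = 1")
    case True
    then obtain q where q: "q > 0" "c ^ q = 1" by blast
    show ?thesis
    proof (rule uniform_means_progressions[OF q(1)])
      show "cmod (f n) \<le> 1" for n using phase_norm[OF Suc.prems] by simp
      fix r assume "r < q"
      have "c ^ (q ^ Suc d) = 1" using q(2) by (simp add: power_mult)
      then have "phase (Suc d) 1 (\<lambda>n. f (int q * n + int r))"
        using phase_dilate[OF Suc.prems, of q "int r"] by simp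
      then obtain c' where "phase d c' (\<lambda>n. f (int q * n + int r))" using phase_drop by blast
      then show "uniform_means (\<lambda>n. f (int q * n + int r))" by (rule Suc.IH)
    qed
  next
    case False
    then show ?thesis
      by (intro uniform_means_zero_imp phase_irrational_means_zero[OF Suc.prems]) blast
  qed
qed

section \<open>Means of Weyl functions\<close>

inductive_set phase_span :: "(int \<Rightarrow> complex) set" where
  scaled: "is_phase f \<Longrightarrow> (\<lambda>n. a * f n) \<in> phase_span"
| sum: "f \<in> phase_span \<Longrightarrow> g \<in> phase_span \<Longrightarrow> (\<lambda>n. f n + g n) \<in> phase_span"

lemma phase_span_uniform_means: "f \<in> phase_span \<Longrightarrow> uniform_means f"
  by (induction rule: phase_span.induct)
    (auto simp: is_phase_def intro: uniform_means_scale uniform_means_add phase_uniform_means)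

lemma phase_span_bounded: "f \<in> phase_span \<Longrightarrow> \<exists>B. \<forall>n. cmod (f n) \<le> B"
proof (induction rule: phase_span.induct)
  case (scaled f a)
  then show ?case by (auto simp: is_phase_def norm_mult phase_norm)
next
  case (sum f g)
  then obtain A B where "\<And>n. cmod (f n) \<le> A" "\<And>n. cmod (g n) \<le> B" by blast
  then have "cmod (f n + g n) \<le> A + B" for n by (rule norm_triangle_mono)
  then show ?case by blast
qed

lemma phase_span_const: "(\<lambda>n. c) \<in> phase_span"
proof -
  have "is_phase (\<lambda>_. 1)" using phase_one[of 0] unfolding is_phase_def by blast
  then show ?thesis using phase_span.scaled[of "\<lambda>_. 1" c] by simp
qed

lemma phase_span_scale_mult:
  assumes "is_phase p" and "g \<in> phase_span"
  shows "(\<lambda>n. a * p n * g n) \<in> phase_span"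
  using assms(2)
proof (induction rule: phase_span.induct)
  case (scaled f b)
  have "(\<lambda>n. (a * b) * (p n * f n)) \<in> phase_span"
    by (intro phase_span.scaled is_phase_mult assms(1) scaled)
  then show ?case by (simp add: algebra_simps)
next
  case (sum f g)
  then show ?case using phase_span.sum[OF sum.IH] by (simp add: distrib_left)
qed

lemma phase_span_mult:
  assumes "f \<in> phase_span" and "g \<in> phase_span"
  shows "(\<lambda>n. f n * g n) \<in> phase_span"
  using assms(1)
proof (induction rule: phase_span.induct)
  case (scaled f a)
  then show ?case by (rule phase_span_scale_mult[OF _ assms(2)])
next
  case (sum f h)
  then show ?case using phase_span.sum[OF sum.IH] by (simp add: distrib_right)
qed

lemma phase_span_cnj: "f \<in> phase_span \<Longrightarrow> (\<lambda>n. cnj (f n)) \<in> phase_span"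
proof (induction rule: phase_span.induct)
  case (scaled f a)
  then have "is_phase (\<lambda>n. cnj (f n))" unfolding is_phase_def using phase_cnj by blast
  then show ?case using phase_span.scaled[of _ "cnj a"] by simp
next
  case (sum f g)
  then show ?case using phase_span.sum[OF sum.IH] by simp
qed

lemma phase_span_translate: "f \<in> phase_span \<Longrightarrow> (\<lambda>n. f (n + k)) \<in> phase_span"
proof (induction rule: phase_span.induct)
  case (scaled f a)
  then have "is_phase (\<lambda>n. f (n + k))" unfolding is_phase_def using phase_translate by blast
  then show ?case by (rule phase_span.scaled)
next
  case (sum f g)
  show ?case using phase_span.sum[OF sum.IH] .
qed

text \<open>An invariant closed algebra that contains the generators, hence the whole Weyl algebra, and whose
  elements have computable means, as they are approximated by finite sums of phases.\<close>

definition phase_closure :: "(int \<Rightarrow> complex) set" where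
  "phase_closure = {f. \<forall>e>0. \<exists>g\<in>phase_span. \<forall>n. cmod (f n - g n) \<le> e}"

lemma phase_span_subset_closure: "f \<in> phase_span \<Longrightarrow> f \<in> phase_closure"
  unfolding phase_closure_def mem_Collect_eq by (intro allI impI bexI[of _ f]) auto

lemma phase_closureE:
  assumes "f \<in> phase_closure" "e > 0"
  obtains g where "g \<in> phase_span" "\<And>n. cmod (f n - g n) \<le> e"
  using assms unfolding phase_closure_def by blast

lemma phase_closure_bounded:
  assumes "f \<in> phase_closure"
  obtains B where "B > 0" "\<And>n. cmod (f n) \<le> B"
proof -
  obtain g where g: "g \<in> phase_span" "\<And>n. cmod (f n - g n) \<le> 1"
    using phase_closureE[OF assms zero_less_one] by blast
  obtain A where A: "\<And>n. cmod (g n) \<le> A" using phase_span_bounded[OF g(1)] by blast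
  have "cmod (f n) \<le> \<bar>A\<bar> + 1" for n
    using norm_triangle_ineq2[of "f n" "g n"] g(2)[of n] A[of n] by linarith
  then show thesis by (intro that[of "\<bar>A\<bar> + 1"]) auto
qed

lemma phase_closure_algebra: "invariant_closed_algebra phase_closure"
  unfolding invariant_closed_algebra_def
proof (intro conjI ballI allI impI)
  show "phase_closure \<subseteq> linf"
  proof
    fix f assume "f \<in> phase_closure"
    then obtain B where "\<And>n. cmod (f n) \<le> B" using phase_closure_bounded by blast
    then show "f \<in> linf" by (auto simp: linf_def intro!: boundedI)
  qed
next
  fix c show "(\<lambda>n. c) \<in> phase_closure"
    by (intro phase_span_subset_closure phase_span_const)
next
  fix f g assume fg: "f \<in> phase_closure" "g \<in> phase_closure"
  show "(\<lambda>n. f n + g n) \<in> phase_closure"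
    unfolding phase_closure_def mem_Collect_eq
  proof (intro allI impI)
    fix e :: real assume e: "e > 0"
    obtain f' where f': "f' \<in> phase_span" "\<And>n. cmod (f n - f' n) \<le> e / 2"
      using phase_closureE[OF fg(1) half_gt_zero[OF e]] by blast
    obtain g' where g': "g' \<in> phase_span" "\<And>n. cmod (g n - g' n) \<le> e / 2"
      using phase_closureE[OF fg(2) half_gt_zero[OF e]] by blast
    have "cmod ((f n + g n) - (f' n + g' n)) \<le> e" for n
      using norm_triangle_mono[OF f'(2)[of n] g'(2)[of n]] by (simp add: algebra_simps)
    then show "\<exists>h\<in>phase_span. \<forall>n. cmod (f n + g n - h n) \<le> e"
      by (intro bexI[OF _ phase_span.sum[OF f'(1) g'(1)]]) simp
  qed
  show "(\<lambda>n. f n * g n) \<in> phase_closure"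
    unfolding phase_closure_def mem_Collect_eq
  proof (intro allI impI)
    fix e :: real assume e: "e > 0"
    obtain A where A: "A > 0" "\<And>n. cmod (f n) \<le> A" using phase_closure_bounded[OF fg(1)] by blast
    obtain B where B: "B > 0" "\<And>n. cmod (g n) \<le> B" using phase_closure_bounded[OF fg(2)] by blast
    \<comment> \<open>\<open>g'\<close> is bounded by \<open>B + d \<le> B + 1\<close>.\<close>
    define d where "d = min 1 (e / (A + B + 1))"
    have AB: "A + B + 1 > 0" using A(1) B(1) by simp
    then have d: "d > 0" "d \<le> 1" using e by (auto simp: d_def)
    have "d \<le> e / (A + B + 1)" by (simp add: d_def)
    then have d3: "d * (A + B + 1) \<le> e" unfolding pos_le_divide_eq[OF AB] .
    obtain f' where f': "f' \<in> phase_span" "\<And>n. cmod (f n - f' n) \<le> d"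
      using phase_closureE[OF fg(1) d(1)] by blast
    obtain g' where g': "g' \<in> phase_span" "\<And>n. cmod (g n - g' n) \<le> d"
      using phase_closureE[OF fg(2) d(1)] by blast
    have "cmod (f n * g n - f' n * g' n) \<le> e" for n
    proof -
      have "cmod (g' n) \<le> B + 1"
        using norm_triangle_ineq2[of "g' n" "g n"] g'(2)[of n] B(2)[of n] d(2)
        by (simp add: norm_minus_commute)
      then have "cmod (f n * (g n - g' n) + (f n - f' n) * g' n) \<le> A * d + d * (B + 1)"
        using A B f'(2)[of n] g'(2)[of n] d(1)
        by (intro norm_triangle_mono) (auto simp: norm_mult intro!: mult_mono)
      also have "\<dots> \<le> e" using d3 by (simp add: algebra_simps)
      finally show ?thesis by (simp add: algebra_simps)
    qed
    then show "\<exists>h\<in>phase_span. \<forall>n. cmod (f n * g n - h n) \<le> e"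
      by (intro bexI[OF _ phase_span_mult[OF f'(1) g'(1)]]) simp
  qed
next
  fix f assume f: "f \<in> phase_closure"
  show "(\<lambda>n. cnj (f n)) \<in> phase_closure"
    unfolding phase_closure_def mem_Collect_eq
  proof (intro allI impI)
    fix e :: real assume "e > 0"
    then obtain g where g: "g \<in> phase_span" "\<And>n. cmod (f n - g n) \<le> e"
      using phase_closureE[OF f] by blast
    have "cmod (cnj (f n) - cnj (g n)) \<le> e" for n
      using g(2)[of n] by (metis complex_cnj_diff complex_mod_cnj)
    then show "\<exists>h\<in>phase_span. \<forall>n. cmod (cnj (f n) - h n) \<le> e"
      by (intro bexI[OF _ phase_span_cnj[OF g(1)]]) simp
  qed
next
  fix f k assume f: "f \<in> phase_closure"
  show "(\<lambda>n. f (n + k)) \<in> phase_closure"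
    unfolding phase_closure_def mem_Collect_eq
  proof (intro allI impI)
    fix e :: real assume "e > 0"
    then obtain g where g: "g \<in> phase_span" "\<And>n. cmod (f n - g n) \<le> e"
      using phase_closureE[OF f] by blast
    then show "\<exists>h\<in>phase_span. \<forall>n. cmod (f (n + k) - h n) \<le> e"
      by (intro bexI[OF _ phase_span_translate[OF g(1), of k]]) simp
  qed
next
  fix fs :: "nat \<Rightarrow> int \<Rightarrow> complex" and f
  assume fs: "(\<forall>i. fs i \<in> phase_closure) \<and> uniform_limit UNIV fs f sequentially"
  show "f \<in> phase_closure"
    unfolding phase_closure_def mem_Collect_eq
  proof (intro allI impI)
    fix e :: real assume e: "e > 0"
    have "\<forall>\<^sub>F i in sequentially. \<forall>n\<in>UNIV. dist (fs i n) (f n) < e / 2"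
      using fs e unfolding uniform_limit_iff by (meson half_gt_zero)
    then obtain i where i: "\<And>n. dist (fs i n) (f n) < e / 2"
      by (auto simp: eventually_sequentially)
    obtain g where g: "g \<in> phase_span" "\<And>n. cmod (fs i n - g n) \<le> e / 2"
      using phase_closureE[of "fs i" "e / 2"] fs e by auto
    have "cmod (f n - g n) \<le> e" for n
    proof -
      have "cmod ((f n - fs i n) + (fs i n - g n)) \<le> e / 2 + e / 2"
        using i[of n] g(2)[of n]
        by (intro norm_triangle_mono) (auto simp: dist_norm norm_minus_commute)
      then show ?thesis by simp
    qed
    then show "\<exists>g\<in>phase_span. \<forall>n. cmod (f n - g n) \<le> e" using g(1) by blast
  qed
qed

theorem weyl_algebra_uniform_means:
  assumes "f \<in> weyl_algebra"
  shows "uniform_means f"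
proof -
  have "weyl_generator k \<alpha> \<in> phase_closure" for k \<alpha>
  proof -
    have "weyl_generator k \<alpha> \<in> phase_span"
      using phase_span.scaled[OF is_phase_weyl_generator, of 1 k \<alpha>] by simp
    then show ?thesis by (rule phase_span_subset_closure)
  qed
  then have "f \<in> phase_closure"
    using assms phase_closure_algebra unfolding weyl_algebra_def by blast
  show ?thesis
  proof (rule uniform_means_closed)
    fix e :: real assume "e > 0"
    then obtain g where "g \<in> phase_span" "\<And>n. cmod (f n - g n) \<le> e"
      using phase_closureE[OF \<open>f \<in> phase_closure\<close>] by blast
    then show "\<exists>g. uniform_means g \<and> (\<forall>n. cmod (f n - g n) \<le> e)"
      using phase_span_uniform_means by blast
  qed
qed


section \<open>The algebra of a transitive flow\<close>

lemma alI:
  assumes X: "flow X T" "x0 \<in> topspace X" and F: "continuous_map X euclidean F"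
    and f: "\<And>n. f n = F (flow_pow X T n x0)"
  shows "f \<in> al X T x0"
proof -
  have "compactin euclidean (F ` topspace X)"
    using X(1) by (intro image_compactin[OF _ F]) (simp add: flow_def compact_space_def)
  then have "bounded (F ` topspace X)" using compact_imp_bounded by simp
  moreover have "range f \<subseteq> F ` topspace X" using f flow_pow_in_topspace[OF X] by auto
  ultimately have "f \<in> linf" by (simp add: linf_def bounded_subset)
  then show ?thesis unfolding al_def using F f by blast
qed

lemma alE:
  assumes "f \<in> al X T x0"
  obtains F where "continuous_map X euclidean F" "\<And>n. f n = F (flow_pow X T n x0)"
  using assms unfolding al_def by blast

text \<open>Continuous functions that are uniformly close on a dense orbit are uniformly close everywhere, so
  the functions representing a uniformly convergent sequence form a uniform Cauchy sequence.\<close>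

lemma al_uniform_limit:
  assumes X: "flow X T" "x0 \<in> topspace X" and dense: "X closure_of orbit X T x0 = topspace X"
    and fs: "\<And>i. fs i \<in> al X T x0" and lim: "uniform_limit UNIV fs f sequentially"
  shows "f \<in> al X T x0"
proof -
  have "\<exists>F. continuous_map X euclidean F \<and> (\<forall>n. fs i n = F (flow_pow X T n x0))" for i
    using fs[of i] by (simp add: al_def)
  then obtain F where F: "\<And>i. continuous_map X euclidean (F i)"
    and Ff: "\<And>i n. fs i n = F i (flow_pow X T n x0)" by metis
  have Cauchy: "\<exists>N. \<forall>m n x. N \<le> m \<longrightarrow> N \<le> n \<longrightarrow> x \<in> topspace X \<longrightarrow> dist (F m x) (F n x) < e"
    if e: "e > 0" for e
  proof -
    have "\<forall>\<^sub>F i in sequentially. \<forall>n\<in>UNIV. dist (fs i n) (f n) < e / 4"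
      using lim[unfolded uniform_limit_iff, THEN spec, of "e / 4"] e by simp
    then obtain N where N: "\<And>i n. i \<ge> N \<Longrightarrow> dist (fs i n) (f n) < e / 4"
      by (auto simp: eventually_sequentially)
    have "dist (F m x) (F n x) < e" if mn: "N \<le> m" "N \<le> n" and x: "x \<in> topspace X" for m n x
    proof -
      have "norm (F m x - F n x) \<le> e / 2"
      proof (rule dense_orbit_upper_bound[OF dense _ _ X x])
        show "continuous_map X euclideanreal (\<lambda>x. norm (F m x - F n x))"
          by (intro continuous_map_norm continuous_map_diff F)
        fix k
        have "dist (fs m k) (fs n k) \<le> dist (fs m k) (f k) + dist (fs n k) (f k)"
          by (rule dist_triangle2)
        then show "norm (F m (flow_pow X T k x0) - F n (flow_pow X T k x0)) \<le> e / 2"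
          using N[OF mn(1), of k] N[OF mn(2), of k] by (simp add: Ff dist_norm)
      qed
      then show ?thesis using e by (simp add: dist_norm)
    qed
    then show ?thesis by blast
  qed
  obtain G where G: "continuous_map X euclidean G"
    and FG: "\<And>e. 0 < e \<Longrightarrow> \<forall>\<^sub>F i in sequentially. \<forall>x\<in>topspace X. dist (F i x) (G x) < e"
  proof (rule Met_TC.continuous_map_uniformly_Cauchy_limit[of X F])
    show "Met_TC.mcomplete TYPE(complex)"
      by (simp add: mcomplete_iff_complete complete_UNIV)
    show "\<forall>\<^sub>F n in sequentially. continuous_map X Met_TC.mtopology (F n)"
      using F by simp
  qed (use Cauchy that in auto)
  show ?thesis
  proof (rule alI[OF X G])
    fix n
    let ?x = "flow_pow X T n x0"
    have "(\<lambda>i. F i ?x) \<longlonglongrightarrow> G ?x"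
      unfolding tendsto_iff
    proof (intro allI impI)
      fix e :: real assume "e > 0"
      from FG[OF this] show "\<forall>\<^sub>F i in sequentially. dist (F i ?x) (G ?x) < e"
        by (rule eventually_mono) (use flow_pow_in_topspace[OF X] in simp)
    qed
    moreover have "(\<lambda>i. F i ?x) \<longlonglongrightarrow> f n"
      using tendsto_uniform_limitI[OF lim, of n] by (simp add: Ff)
    ultimately show "f n = G ?x" by (rule LIMSEQ_unique[rotated])
  qed
qed

lemma al_invariant_closed_algebra:
  assumes X: "flow X T" "x0 \<in> topspace X" and dense: "X closure_of orbit X T x0 = topspace X"
  shows "invariant_closed_algebra (al X T x0)"
  unfolding invariant_closed_algebra_def
proof (intro conjI ballI allI impI)
  show "al X T x0 \<subseteq> linf" by (auto simp: al_def)
next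
  fix c show "(\<lambda>n. c) \<in> al X T x0" by (rule alI[OF X, where F = "\<lambda>_. c"]) auto
next
  fix f g assume "f \<in> al X T x0" "g \<in> al X T x0"
  then obtain F G where F: "continuous_map X euclidean F" "\<And>n. f n = F (flow_pow X T n x0)"
    and G: "continuous_map X euclidean G" "\<And>n. g n = G (flow_pow X T n x0)"
    by (elim alE) blast
  show "(\<lambda>n. f n + g n) \<in> al X T x0"
    by (rule alI[OF X continuous_map_add[OF F(1) G(1)]]) (simp add: F G)
  have "continuous_map X euclidean (\<lambda>x. F x * G x)"
    using F(1) G(1) unfolding continuous_map_atin by (auto intro!: tendsto_intros)
  then show "(\<lambda>n. f n * g n) \<in> al X T x0"
    by (rule alI[OF X]) (simp add: F G)
next
  fix f assume "f \<in> al X T x0"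
  then obtain F where F: "continuous_map X euclidean F" "\<And>n. f n = F (flow_pow X T n x0)"
    by (elim alE) blast
  have "continuous_map X euclidean (\<lambda>x. cnj (F x))"
    using F(1) unfolding continuous_map_atin by (auto intro!: tendsto_cnj)
  then show "(\<lambda>n. cnj (f n)) \<in> al X T x0"
    by (rule alI[OF X]) (simp add: F)
  fix k
  have "continuous_map X euclidean (F \<circ> flow_pow X T k)"
    by (rule continuous_map_compose[OF continuous_map_flow_pow[OF X(1)] F(1)])
  then show "(\<lambda>n. f (n + k)) \<in> al X T x0"
    by (rule alI[OF X]) (simp add: F flow_pow_add[OF X, symmetric] add.commute)
next
  fix fs :: "nat \<Rightarrow> int \<Rightarrow> complex" and f
  assume "(\<forall>i. fs i \<in> al X T x0) \<and> uniform_limit UNIV fs f sequentially"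
  then show "f \<in> al X T x0" using al_uniform_limit[OF X dense] by blast
qed

section \<open>Weyl functions are distal\<close>

type_synonym weyl_point = "nat \<times> real \<times> int \<Rightarrow> complex"

text \<open>One point carries all generators at once: \<open>weyl_base\<close> lists the sequences \<open>n \<mapsto> e(n ^ k \<alpha>)\<close>,
  and the acting homeomorphism translates all of them simultaneously. Hence a single flow
  represents the whole Weyl algebra, and products of flows can be avoided.\<close>

definition weyl_base :: weyl_point where
  "weyl_base = (\<lambda>(k, \<alpha>, m). weyl_generator k \<alpha> m)"

definition weyl_shift :: "int \<Rightarrow> weyl_point \<Rightarrow> weyl_point" where
  "weyl_shift n x = (\<lambda>(k, \<alpha>, m). x (k, \<alpha>, m + n))"

definition weyl_space :: "weyl_point set" where
  "weyl_space = closure (range (\<lambda>n. weyl_shift n weyl_base))"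

lemma weyl_shift_add: "weyl_shift m (weyl_shift n x) = weyl_shift (m + n) x"
  and weyl_shift_0: "weyl_shift 0 x = x"
  by (auto simp: weyl_shift_def fun_eq_iff algebra_simps)

lemma continuous_on_weyl_shift: "continuous_on S (weyl_shift n)"
proof (rule continuous_on_coordinatewise_then_product)
  fix i :: "nat \<times> real \<times> int"
  obtain k \<alpha> m where "i = (k, \<alpha>, m)" by (cases i)
  then show "continuous_on S (\<lambda>x. weyl_shift n x i)"
    by (simp add: weyl_shift_def continuous_on_product_coordinates[THEN continuous_on_subset])
qed

lemma weyl_shift_in_space: "x \<in> weyl_space \<Longrightarrow> weyl_shift n x \<in> weyl_space"
proof -
  have "weyl_shift n ` range (\<lambda>n. weyl_shift n weyl_base) \<subseteq> weyl_space"
    unfolding weyl_space_def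
    by (rule order_trans[OF _ closure_subset]) (auto simp: weyl_shift_add)
  then have "weyl_shift n ` weyl_space \<subseteq> weyl_space"
    unfolding weyl_space_def
    by (intro image_closure_subset continuous_on_weyl_shift closed_closure)
  then show "x \<in> weyl_space \<Longrightarrow> weyl_shift n x \<in> weyl_space" by auto
qed

lemma continuous_on_funpow_Delta:
  assumes "\<And>n. continuous_on S (\<lambda>x. u x n)"
  shows "continuous_on S (\<lambda>x. (Delta ^^ d) (u x) n)"
  by (induction d arbitrary: n) (auto simp: Delta_def intro!: continuous_intros assms)

text \<open>Being a phase with given degree and constant is a closed, translation invariant condition, so it
  passes from the base point to its orbit closure.\<close>

lemma weyl_space_phase:
  assumes "phase d c (weyl_generator k \<alpha>)" "x \<in> weyl_space"
  shows "phase d c (\<lambda>m. x (k, \<alpha>, m))"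
proof -
  let ?S = "{x. phase d c (\<lambda>m. x (k, \<alpha>, m))} :: weyl_point set"
  have coord: "continuous_on UNIV (\<lambda>x :: weyl_point. x i)" for i
    by (rule continuous_on_product_coordinates)
  have "closed ?S"
    unfolding phase_def
    by (intro closed_Collect_conj closed_Collect_all closed_Collect_eq continuous_on_const
        continuous_on_norm coord continuous_on_funpow_Delta)
  moreover have "range (\<lambda>n. weyl_shift n weyl_base) \<subseteq> ?S"
    using phase_translate[OF assms(1)] by (auto simp: weyl_shift_def weyl_base_def)
  ultimately have "weyl_space \<subseteq> ?S" unfolding weyl_space_def by (rule closure_minimal[rotated])
  then show ?thesis using assms(2) by auto
qed

lemma weyl_space_norm: "x \<in> weyl_space \<Longrightarrow> cmod (x i) = 1"
proof -
  assume x: "x \<in> weyl_space"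
  obtain k \<alpha> m where i: "i = (k, \<alpha>, m)" by (cases i)
  obtain d c where "phase d c (weyl_generator k \<alpha>)"
    using is_phase_weyl_generator[of k \<alpha>] by (auto simp: is_phase_def)
  from weyl_space_phase[OF this x] show ?thesis unfolding i by (rule phase_norm)
qed

lemma compact_weyl_space: "compact weyl_space"
proof -
  let ?B = "Pi\<^sub>E UNIV (\<lambda>_. sphere 0 1) :: weyl_point set"
  have "compactin (product_topology (\<lambda>_. euclidean) UNIV) ?B"
    by (subst compactin_PiE) simp
  then have "compact ?B" by (simp add: euclidean_product_topology)
  moreover have "weyl_space = ?B \<inter> weyl_space" using weyl_space_norm by auto
  moreover have "closed weyl_space" by (simp add: weyl_space_def)
  ultimately show ?thesis by (metis compact_Int_closed)
qed

lemma weyl_base_in_space: "weyl_base \<in> weyl_space"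
  using closure_subset[of "range (\<lambda>n. weyl_shift n weyl_base)"] weyl_shift_0[of weyl_base]
  unfolding weyl_space_def by (metis rangeI subsetD)

abbreviation "weyl_top \<equiv> top_of_set weyl_space"

lemma weyl_flow: "flow weyl_top (weyl_shift 1)"
proof -
  have "continuous_map weyl_top weyl_top (weyl_shift n)" for n
    using weyl_shift_in_space by (auto simp: continuous_on_weyl_shift)
  moreover have haus: "Hausdorff_space (euclidean :: weyl_point topology)"
    unfolding euclidean_product_topology[symmetric] by (simp add: Hausdorff_space_product_topology)
  ultimately have "homeomorphic_maps weyl_top weyl_top (weyl_shift 1) (weyl_shift (- 1))"
    by (simp add: homeomorphic_maps_def weyl_shift_add weyl_shift_0)
  then show ?thesis
    using weyl_base_in_space compact_weyl_space homeomorphic_maps_imp_map haus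
    by (auto simp: flow_def compact_space_subtopology Hausdorff_space_subtopology)
qed

lemma weyl_flow_pow: "x \<in> weyl_space \<Longrightarrow> flow_pow weyl_top (weyl_shift 1) n x = weyl_shift n x"
  using flow_pow_eqI[OF weyl_flow, of "\<lambda>n. weyl_shift n x"] weyl_shift_in_space
  by (simp add: weyl_shift_add weyl_shift_0 add.commute)

text \<open>If two points differ in the sequence with index \<open>(k, \<alpha>)\<close>, the quotient of these sequences is a
  phase with constant \<open>c * cnj c = 1\<close> that is not identically \<open>1\<close>. Some iterated difference of it
  is a constant other than \<open>1\<close>, and this constant does not change along the orbit.\<close>

lemma weyl_flow_distal: "distal_flow weyl_top (weyl_shift 1)"
proof (rule distal_flowI_invariant[OF weyl_flow])
  fix x y assume "x \<in> topspace weyl_top" "y \<in> topspace weyl_top" and ne: "x \<noteq> y"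
  then have xy: "x \<in> weyl_space" "y \<in> weyl_space" by simp_all
  obtain k \<alpha> m where m: "x (k, \<alpha>, m) \<noteq> y (k, \<alpha>, m)"
    using ne by (auto simp: fun_eq_iff)
  obtain d c where ph: "phase d c (weyl_generator k \<alpha>)"
    using is_phase_weyl_generator[of k \<alpha>] by (auto simp: is_phase_def)
  define u where "u x y m = x (k, \<alpha>, m) * cnj (y (k, \<alpha>, m))" for x y :: weyl_point and m
  have "phase d (c * cnj c) (u x y)"
    unfolding u_def by (intro phase_mult phase_cnj weyl_space_phase[OF ph] xy)
  then have u1: "phase d 1 (u x y)" using phase_norm_const[OF ph] by (simp add: mult_cnj_unit)
  have "u x y m * y (k, \<alpha>, m) = x (k, \<alpha>, m) * (y (k, \<alpha>, m) * cnj (y (k, \<alpha>, m)))"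
    by (simp add: u_def)
  then have "u x y m \<noteq> 1" using m weyl_space_norm[OF xy(2)] by (auto simp: mult_cnj_unit)
  then have "u x y \<noteq> (\<lambda>_. 1)" by auto
  with u1 obtain e c' where e: "phase e c' (u x y)" "c' \<noteq> 1" by (rule phase_nontrivial_difference)
  let ?I = "\<lambda>p. (Delta ^^ e) (u (fst p) (snd p)) 0"
  have "continuous_on S (\<lambda>p. u (fst p) (snd p) n)" for n S
    unfolding u_def
    by (intro continuous_intros continuous_on_compose2[OF continuous_on_product_coordinates]) auto
  then have "continuous_on (weyl_space \<times> weyl_space) ?I" by (rule continuous_on_funpow_Delta)
  then have "continuous_map (prod_topology weyl_top weyl_top) euclidean ?I"
    by (simp add: prod_topology_subtopology_eu)
  moreover have "?I (weyl_shift n x, weyl_shift n y) = c'" for n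
  proof -
    have "u (weyl_shift n x) (weyl_shift n y) = (\<lambda>m. u x y (m + n))"
      by (simp add: u_def weyl_shift_def fun_eq_iff)
    then show ?thesis using phase_funpow[OF phase_translate[OF e(1), of n], of 0] by simp
  qed
  moreover have "?I (z, z) = 1" if "z \<in> weyl_space" for z
  proof -
    have "u z z = (\<lambda>_. 1)" using weyl_space_norm[OF that] by (simp add: u_def mult_cnj_unit fun_eq_iff)
    then show ?thesis by (simp add: funpow_Delta_one)
  qed
  ultimately show "\<exists>I c. continuous_map (prod_topology weyl_top weyl_top) euclidean I \<and>
      (\<forall>n. I (flow_pow weyl_top (weyl_shift 1) n x, flow_pow weyl_top (weyl_shift 1) n y) = c) \<and>
      (\<forall>z\<in>topspace weyl_top. I (z, z) \<noteq> (c :: complex))"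
    using e(2) by (intro exI[of _ ?I] exI[of _ c']) (auto simp: weyl_flow_pow xy)
qed

lemma weyl_base_dense:
  "weyl_top closure_of orbit weyl_top (weyl_shift 1) weyl_base = topspace weyl_top"
proof -
  have "orbit weyl_top (weyl_shift 1) weyl_base = range (\<lambda>n. weyl_shift n weyl_base)"
    by (simp add: orbit_def weyl_flow_pow[OF weyl_base_in_space])
  moreover have "range (\<lambda>n. weyl_shift n weyl_base) \<subseteq> weyl_space"
    using weyl_shift_in_space[OF weyl_base_in_space] by auto
  ultimately show ?thesis
    by (simp add: closure_of_subtopology weyl_space_def[symmetric] Int_absorb1)
qed

theorem weyl_algebra_subset_distal_functions: "weyl_algebra \<subseteq> distal_functions"
proof -
  let ?A = "al weyl_top (weyl_shift 1) weyl_base"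
  have base: "weyl_base \<in> topspace weyl_top" using weyl_base_in_space by simp
  have "weyl_generator k \<alpha> \<in> ?A" for k \<alpha>
  proof (rule alI[OF weyl_flow base])
    show "continuous_map weyl_top euclidean (\<lambda>x. x (k, \<alpha>, 0))"
      by (simp add: continuous_on_product_coordinates[THEN continuous_on_subset])
    show "weyl_generator k \<alpha> n = flow_pow weyl_top (weyl_shift 1) n weyl_base (k, \<alpha>, 0)" for n
      unfolding weyl_flow_pow[OF weyl_base_in_space] by (simp add: weyl_shift_def weyl_base_def)
  qed
  then have "weyl_algebra \<subseteq> ?A"
    using al_invariant_closed_algebra[OF weyl_flow base weyl_base_dense]
    unfolding weyl_algebra_def by (intro Inter_lower) simp
  also have "\<dots> \<subseteq> distal_functions"
    by (intro al_subset_distal_functions weyl_flow_distal base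
        distal_flow_dense_orbit_imp_minimal[OF weyl_flow_distal base weyl_base_dense])
  finally show ?thesis .
qed


section \<open>Two invariant measures exclude Weyl functions\<close>

lemma space_borel_sigma [simp]: "space (borel_sigma X) = topspace X"
  by (simp add: borel_sigma_def space_measure_of_conv)

lemma sets_borel_sigma: "sets (borel_sigma X) = sigma_sets (topspace X) {U. openin X U}"
  unfolding borel_sigma_def by (rule sets_measure_of) (auto dest: openin_subset)

lemma openin_sets_borel_sigma: "openin X U \<Longrightarrow> U \<in> sets (borel_sigma X)"
  by (simp add: sets_borel_sigma sigma_sets.Basic)

lemma measurable_borel_sigmaI:
  assumes "f \<in> space M \<rightarrow> topspace Y" "\<And>U. openin Y U \<Longrightarrow> f -` U \<inter> space M \<in> sets M"
  shows "f \<in> measurable M (borel_sigma Y)"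
  unfolding borel_sigma_def
  by (rule measurable_measure_of) (use assms in \<open>auto dest: openin_subset\<close>)

lemma continuous_map_measurable_borel_sigma:
  assumes "continuous_map X Y f"
  shows "f \<in> measurable (borel_sigma X) (borel_sigma Y)"
proof (rule measurable_borel_sigmaI)
  show "f \<in> space (borel_sigma X) \<rightarrow> topspace Y" using assms by (simp add: continuous_map_def)
  fix U assume "openin Y U"
  then have "openin X {x \<in> topspace X. f x \<in> U}" by (rule openin_continuous_map_preimage[OF assms])
  moreover have "f -` U \<inter> space (borel_sigma X) = {x \<in> topspace X. f x \<in> U}" by auto
  ultimately show "f -` U \<inter> space (borel_sigma X) \<in> sets (borel_sigma X)"
    by (simp add: openin_sets_borel_sigma)
qed

lemma continuous_map_borel_measurable:
  fixes F :: "'a \<Rightarrow> 'b::topological_space"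
  assumes "continuous_map X euclidean F"
  shows "F \<in> borel_measurable (borel_sigma X)"
proof (rule borel_measurableI)
  fix S :: "'b set" assume "open S"
  then have "openin X {x \<in> topspace X. F x \<in> S}"
    by (intro openin_continuous_map_preimage[OF assms]) simp
  moreover have "F -` S \<inter> space (borel_sigma X) = {x \<in> topspace X. F x \<in> S}" by auto
  ultimately show "F -` S \<inter> space (borel_sigma X) \<in> sets (borel_sigma X)"
    by (simp add: openin_sets_borel_sigma)
qed

lemma invariant_probD:
  assumes "invariant_prob X T M"
  shows "space M = topspace X" "sets M = sets (borel_sigma X)" "prob_space M"
    "\<And>A. A \<in> sets (borel_sigma X) \<Longrightarrow> emeasure M (T -` A \<inter> topspace X) = emeasure M A"
  using assms by (auto simp: invariant_prob_def)

lemma flow_measurable: "flow X T \<Longrightarrow> T \<in> measurable (borel_sigma X) (borel_sigma X)"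
  unfolding flow_def
  by (intro continuous_map_measurable_borel_sigma homeomorphic_imp_continuous_map) simp

lemma invariant_prob_integrable:
  fixes F :: "'a \<Rightarrow> complex"
  assumes X: "flow X T" and M: "invariant_prob X T M" and F: "continuous_map X euclidean F"
  shows "integrable M F"
proof -
  interpret prob_space M by (rule invariant_probD(3)[OF M])
  have "compactin euclidean (F ` topspace X)"
    using X by (intro image_compactin[OF _ F]) (simp add: flow_def compact_space_def)
  then have "bounded (F ` topspace X)" using compact_imp_bounded by simp
  then obtain B where "\<And>x. x \<in> topspace X \<Longrightarrow> norm (F x) \<le> B" unfolding bounded_iff by auto
  then have "AE x in M. norm (F x) \<le> B" using invariant_probD(1)[OF M] by (intro AE_I2) simp
  moreover have "F \<in> borel_measurable M"
    using continuous_map_borel_measurable[OF F] measurable_cong_sets[OF invariant_probD(2)[OF M] refl]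
    by blast
  ultimately show ?thesis by (rule integrable_const_bound)
qed

lemma invariant_prob_integral:
  fixes F :: "'a \<Rightarrow> complex"
  assumes X: "flow X T" and M: "invariant_prob X T M" and F: "continuous_map X euclidean F"
  shows "(\<integral>x. F (flow_pow X T (int i) x) \<partial>M) = (\<integral>x. F x \<partial>M)"
proof -
  note D = invariant_probD[OF M]
  have T: "T \<in> measurable M M"
    using flow_measurable[OF X] measurable_cong_sets[OF D(2) D(2)] by blast
  have "distr M M T = M"
    by (rule measure_eqI) (use D T in \<open>auto simp: emeasure_distr\<close>)
  then have inv: "(\<integral>x. G (T x) \<partial>M) = (\<integral>x. G x \<partial>M)" if G: "continuous_map X euclidean G"
    for G :: "'a \<Rightarrow> complex"
    using integral_distr[OF T, of G] continuous_map_borel_measurable[OF G]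
      measurable_cong_sets[OF D(2) refl] by (metis (mono_tags, lifting))
  show ?thesis
  proof (induction i)
    case (Suc i)
    let ?G = "F \<circ> flow_pow X T (int i)"
    have "F (flow_pow X T (int (Suc i)) x) = ?G (T x)" if "x \<in> topspace X" for x
      using flow_pow_add[OF X that, of "int i" 1] flow_pow_add1[OF X that, of 0]
      by (simp add: add.commute)
    then have "(\<integral>x. F (flow_pow X T (int (Suc i)) x) \<partial>M) = (\<integral>x. ?G (T x) \<partial>M)"
      using D(1) by (intro Bochner_Integration.integral_cong) auto
    also have "\<dots> = (\<integral>x. ?G x \<partial>M)"
      by (rule inv) (rule continuous_map_compose[OF continuous_map_flow_pow[OF X] F])
    finally show ?case using Suc by simp
  qed simp
qed

text \<open>The average \<open>A\<close> of \<open>F\<close> over \<open>N\<close> steps is nearly constant along the orbit of \<open>x0\<close>, hence by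
  density on the whole space, while its integral against an invariant measure is that of \<open>F\<close>.
  Thus the integrals against any two invariant measures nearly agree.\<close>

lemma uniform_means_integral_eq:
  fixes F :: "'a \<Rightarrow> complex"
  assumes X: "flow X T" "x0 \<in> topspace X" and dense: "X closure_of orbit X T x0 = topspace X"
    and F: "continuous_map X euclidean F" and um: "uniform_means (\<lambda>n. F (flow_pow X T n x0))"
    and M: "invariant_prob X T M" "invariant_prob X T M'"
  shows "(\<integral>x. F x \<partial>M) = (\<integral>x. F x \<partial>M')"
proof -
  let ?f = "\<lambda>n. F (flow_pow X T n x0)"
  have "cmod ((\<integral>x. F x \<partial>M) - (\<integral>x. F x \<partial>M')) \<le> e" if e: "e > 0" for e
  proof -
    obtain N0 where N0: "\<And>N k l. N \<ge> N0 \<Longrightarrow> cmod (window ?f N k - window ?f N l) \<le> e / 2 * real N"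
      using um[unfolded uniform_means_def, THEN spec, THEN mp, OF half_gt_zero[OF e]] by blast
    define N where "N = max 1 N0"
    have N: "N \<ge> 1" "N \<ge> N0" by (auto simp: N_def)
    define A where "A x = (\<Sum>i<N. F (flow_pow X T (int i) x))" for x
    let ?w = "window ?f N 0"
    have Fi: "continuous_map X euclidean (\<lambda>x. F (flow_pow X T (int i) x))" for i
      using continuous_map_compose[OF continuous_map_flow_pow[OF X(1)] F] by (simp add: o_def)
    have contA: "continuous_map X euclidean A"
      unfolding A_def by (intro continuous_map_sum Fi) simp
    have contD: "continuous_map X euclideanreal (\<lambda>x. norm (A x - ?w))"
      by (intro continuous_map_norm continuous_map_diff contA) simp
    have le: "norm (A x - ?w) \<le> e / 2 * real N" if x: "x \<in> topspace X" for x
    proof (rule dense_orbit_upper_bound[OF dense contD _ X x])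
      fix k
      have "A (flow_pow X T k x0) = window ?f N k"
        by (simp add: A_def window_def flow_pow_add[OF X, symmetric] add.commute)
      then show "norm (A (flow_pow X T k x0) - ?w) \<le> e / 2 * real N"
        using N0[OF N(2), of k 0] by simp
    qed
    have near: "cmod (of_nat N * (\<integral>x. F x \<partial>M) - ?w) \<le> e / 2 * real N"
      if M: "invariant_prob X T M" for M
    proof -
      interpret prob_space M by (rule invariant_probD(3)[OF M])
      note int = invariant_prob_integrable[OF X(1) M]
      have "(\<integral>x. A x \<partial>M) = (\<Sum>i<N. \<integral>x. F (flow_pow X T (int i) x) \<partial>M)"
        unfolding A_def by (rule Bochner_Integration.integral_sum) (rule int[OF Fi])
      also have "\<dots> = of_nat N * (\<integral>x. F x \<partial>M)"
        by (simp add: invariant_prob_integral[OF X(1) M F])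
      finally have "of_nat N * (\<integral>x. F x \<partial>M) - ?w = (\<integral>x. A x - ?w \<partial>M)"
        using Bochner_Integration.integral_diff[OF int[OF contA], of "\<lambda>_. ?w"]
        by (simp add: prob_space)
      also have "cmod \<dots> \<le> (\<integral>x. norm (A x - ?w) \<partial>M)" by (rule integral_norm_bound)
      also have "\<dots> \<le> e / 2 * real N"
      proof (rule integral_le_const)
        show "integrable M (\<lambda>x. norm (A x - ?w))"
          by (intro integrable_norm Bochner_Integration.integrable_diff int[OF contA]) simp
        show "AE x in M. norm (A x - ?w) \<le> e / 2 * real N"
          by (rule AE_I2) (use le invariant_probD(1)[OF M] in simp)
      qed
      finally show ?thesis .
    qed
    let ?I = "\<integral>x. F x \<partial>M" and ?I' = "\<integral>x. F x \<partial>M'"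
    have "real N * cmod (?I - ?I') = cmod (of_nat N * (?I - ?I'))"
      unfolding norm_mult norm_of_nat ..
    also have "of_nat N * (?I - ?I') = (of_nat N * ?I - ?w) - (of_nat N * ?I' - ?w)"
      unfolding right_diff_distrib by simp
    also have "cmod \<dots> \<le> cmod (of_nat N * ?I - ?w) + cmod (of_nat N * ?I' - ?w)"
      by (rule norm_triangle_ineq4)
    also have "\<dots> \<le> e / 2 * real N + e / 2 * real N"
      by (rule add_mono[OF near[OF M(1)] near[OF M(2)]])
    also have "\<dots> = real N * e" by (simp add: algebra_simps)
    finally show ?thesis by (rule mult_left_le_imp_le) (use N(1) in simp)
  qed
  then have "cmod ((\<integral>x. F x \<partial>M) - (\<integral>x. F x \<partial>M')) \<le> 0"
    by (rule field_le_epsilon[of _ 0, unfolded add_0_left])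
  then show ?thesis by simp
qed

text \<open>For metric flows this says that there are two invariant measures; a continuous function that witnesses the
  failure is kept, as it is also what lies outside the Weyl algebra.\<close>

definition has_distinct_means :: "'a topology \<Rightarrow> ('a \<Rightarrow> 'a) \<Rightarrow> bool" where
  "has_distinct_means X T \<longleftrightarrow> (\<exists>M M' (F :: 'a \<Rightarrow> complex).
     invariant_prob X T M \<and> invariant_prob X T M' \<and> continuous_map X euclidean F \<and>
     (\<integral>x. F x \<partial>M) \<noteq> (\<integral>x. F x \<partial>M'))"

lemma has_distinct_means_not_strictly_ergodic:
  assumes "has_distinct_means X T"
  shows "\<not> strictly_ergodic X T"
proof
  assume "strictly_ergodic X T"
  then have unique: "\<exists>!M. invariant_prob X T M" by (simp add: strictly_ergodic_def)
  obtain M M' and F :: "'a \<Rightarrow> complex" where M: "invariant_prob X T M" "invariant_prob X T M'"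
    and ne: "(\<integral>x. F x \<partial>M) \<noteq> (\<integral>x. F x \<partial>M')"
    using assms unfolding has_distinct_means_def by (elim exE conjE)
  have "M = M'" using ex1E[OF unique] M by metis
  with ne show False by simp
qed

lemma has_distinct_means_not_al_subset_weyl:
  assumes "has_distinct_means X T" "minimal_flow X T" "x0 \<in> topspace X"
  shows "\<not> al X T x0 \<subseteq> weyl_algebra"
proof
  assume sub: "al X T x0 \<subseteq> weyl_algebra"
  obtain M M' and F :: "'a \<Rightarrow> complex" where M: "invariant_prob X T M" "invariant_prob X T M'"
    and F: "continuous_map X euclidean F"
    and ne: "(\<integral>x. F x \<partial>M) \<noteq> (\<integral>x. F x \<partial>M')"
    using assms(1) unfolding has_distinct_means_def by (elim exE conjE)
  have X: "flow X T" and dense: "X closure_of orbit X T x0 = topspace X"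
    using assms(2,3) by (auto simp: minimal_flow_def)
  have "(\<lambda>n. F (flow_pow X T n x0)) \<in> al X T x0" by (rule alI[OF X assms(3) F]) simp
  then have "uniform_means (\<lambda>n. F (flow_pow X T n x0))"
    using sub by (intro weyl_algebra_uniform_means) auto
  from uniform_means_integral_eq[OF X assms(3) dense F this M] ne show False by simp
qed

lemma has_distinct_means_iso:
  assumes hom: "homeomorphic_map X Y h" and X: "flow X T"
    and S: "\<And>x. x \<in> topspace X \<Longrightarrow> S (h x) = h (T x)" and means: "has_distinct_means X T"
  shows "has_distinct_means Y S"
proof -
  have Y: "flow Y S" by (rule flow_iso[OF hom X S])
  have h: "continuous_map X Y h" by (rule homeomorphic_imp_continuous_map[OF hom])
  obtain g where "homeomorphic_maps X Y h g" using hom homeomorphic_map_maps by blast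
  then have g: "continuous_map Y X g" and gh: "\<And>x. x \<in> topspace X \<Longrightarrow> g (h x) = x"
    by (auto simp: homeomorphic_maps_def)
  have hX: "h x \<in> topspace Y" if "x \<in> topspace X" for x
    using h that by (auto simp: continuous_map_def)
  have push: "invariant_prob Y S (distr M (borel_sigma Y) h)"
    and integral: "(\<integral>y. F (g y) \<partial>(distr M (borel_sigma Y) h)) = (\<integral>x. F x \<partial>M)"
    if M: "invariant_prob X T M" and F: "continuous_map X euclidean F"
    for M and F :: "'a \<Rightarrow> complex"
  proof -
    note D = invariant_probD[OF M]
    have hM: "h \<in> measurable M (borel_sigma Y)"
      using continuous_map_measurable_borel_sigma[OF h] measurable_cong_sets[OF D(2) refl] by blast
    let ?N = "distr M (borel_sigma Y) h"
    show "invariant_prob Y S ?N"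
      unfolding invariant_prob_def
    proof (intro conjI ballI)
      show "prob_space ?N" by (rule prob_space.prob_space_distr[OF D(3) hM])
      fix A assume "A \<in> sets ?N"
      then have A: "A \<in> sets (borel_sigma Y)" by simp
      have SA: "S -` A \<inter> topspace Y \<in> sets (borel_sigma Y)"
        using measurable_sets[OF flow_measurable[OF Y] A] by simp
      have hA: "h -` A \<inter> topspace X \<in> sets (borel_sigma X)"
        using measurable_sets[OF hM A] D(1,2) by simp
      have TX: "T x \<in> topspace X" if "x \<in> topspace X" for x
        using homeomorphic_imp_continuous_map[of X X T] X that
        by (auto simp: flow_def continuous_map_def)
      have "emeasure ?N (S -` A \<inter> topspace Y) = emeasure M (h -` (S -` A \<inter> topspace Y) \<inter> topspace X)"
        using emeasure_distr[OF hM SA] D(1) by simp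
      also have "h -` (S -` A \<inter> topspace Y) \<inter> topspace X = T -` (h -` A \<inter> topspace X) \<inter> topspace X"
        using S hX TX by auto
      also have "emeasure M \<dots> = emeasure M (h -` A \<inter> topspace X)" by (rule D(4)[OF hA])
      also have "\<dots> = emeasure ?N A" using emeasure_distr[OF hM A] D(1) by simp
      finally show "emeasure ?N (S -` A \<inter> topspace Y) = emeasure ?N A" .
    qed auto
    have "continuous_map Y euclidean (\<lambda>y. F (g y))"
      using continuous_map_compose[OF g F] by (simp add: o_def)
    then have "(\<integral>y. F (g y) \<partial>?N) = (\<integral>x. F (g (h x)) \<partial>M)"
      by (intro integral_distr[OF hM] continuous_map_borel_measurable)
    also have "\<dots> = (\<integral>x. F x \<partial>M)"
      using D(1) gh by (intro Bochner_Integration.integral_cong) auto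
    finally show "(\<integral>y. F (g y) \<partial>?N) = (\<integral>x. F x \<partial>M)" .
  qed
  obtain M M' and F :: "'a \<Rightarrow> complex" where M: "invariant_prob X T M" "invariant_prob X T M'"
    and F: "continuous_map X euclidean F"
    and ne: "(\<integral>x. F x \<partial>M) \<noteq> (\<integral>x. F x \<partial>M')"
    using means unfolding has_distinct_means_def by (elim exE conjE)
  have "continuous_map Y euclidean (\<lambda>y. F (g y))"
    using continuous_map_compose[OF g F] by (simp add: o_def)
  then show ?thesis
    unfolding has_distinct_means_def
    using push[OF M(1) F] push[OF M(2) F] integral[OF M(1) F] integral[OF M(2) F] ne
    by (intro exI[of _ "distr M (borel_sigma Y) h"] exI[of _ "distr M' (borel_sigma Y) h"]
        exI[of _ "\<lambda>y. F (g y)"]) simp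
qed


section \<open>An odometer\<close>

text \<open>At level \<open>j\<close> a tent of width \<open>2 ^ (j + 1)\<close> will stand on the digits \<open>{0..<radix j}\<close>. The
  exponent leaves it a proportion \<open>2 ^ (j + 1) / radix j = (1 / 2) ^ (j + 3)\<close> of the digits,
  which is summable with sum \<open>1 / 4\<close>.\<close>

definition radix :: "nat \<Rightarrow> int" where
  "radix j = 2 ^ (2 * j + 4)"

definition block :: "nat \<Rightarrow> int" where
  "block k = (\<Prod>j<k. radix j)"

lemma radix_pos [simp]: "radix j > 0"
  by (simp add: radix_def)

lemma block_pos [simp]: "block k > 0"
  by (simp add: block_def prod_pos)

lemma block_neq_0 [simp]: "block k \<noteq> 0"
  using block_pos[of k] by (simp del: block_pos)

lemma block_Suc: "block (Suc k) = block k * radix k"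
  by (simp add: block_def)

lemma block_dvd: "j \<le> k \<Longrightarrow> block j dvd block k"
  unfolding block_def by (intro prod_dvd_prod_subset) auto

lemma block_mono: "j \<le> k \<Longrightarrow> block j \<le> block k"
  using zdvd_imp_le[OF block_dvd block_pos] .

text \<open>The inverse limit of the groups \<open>\<int> / block k \<int>\<close>, a point being its coherent sequence of residues.
  The quotient \<open>z (Suc j) div block j\<close> is the digit of \<open>z\<close> at level \<open>j\<close>.\<close>

definition odometer :: "(nat \<Rightarrow> int) set" where
  "odometer = {z. \<forall>k. z k \<in> {0..<block k} \<and> z (Suc k) mod block k = z k}"

definition odo_shift :: "int \<Rightarrow> (nat \<Rightarrow> int) \<Rightarrow> nat \<Rightarrow> int" where
  "odo_shift n z = (\<lambda>k. (z k + n) mod block k)"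

definition residues_of :: "int \<Rightarrow> nat \<Rightarrow> int" where
  "residues_of n = (\<lambda>k. n mod block k)"

lemma odometerD:
  assumes "z \<in> odometer"
  shows "0 \<le> z k" "z k < block k" "z (Suc k) mod block k = z k"
  using assms by (auto simp: odometer_def)

lemma odometer_mod:
  assumes "z \<in> odometer" "m \<le> k"
  shows "z k mod block m = z m"
  using assms(2)
proof (induction k rule: dec_induct)
  case base
  then show ?case using odometerD[OF assms(1), of m] by simp
next
  case (step k)
  have "z (Suc k) mod block m = z (Suc k) mod block k mod block m"
    using block_dvd[OF step(1)] by (simp add: mod_mod_cancel)
  then show ?case using step odometerD(3)[OF assms(1)] by simp
qed

lemma odo_shift_in_odometer: "z \<in> odometer \<Longrightarrow> odo_shift n z \<in> odometer"
proof -
  assume z: "z \<in> odometer"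
  have "(z (Suc k) + n) mod block (Suc k) mod block k = (z k + n) mod block k" for k
  proof -
    have "(z (Suc k) + n) mod block (Suc k) mod block k = (z (Suc k) + n) mod block k"
      by (rule mod_mod_cancel) (simp add: block_dvd)
    also have "\<dots> = (z (Suc k) mod block k + n) mod block k" by (simp add: mod_add_left_eq)
    finally show ?thesis by (simp only: odometerD(3)[OF z])
  qed
  then show ?thesis by (simp add: odometer_def odo_shift_def)
qed

lemma odo_shift_add: "odo_shift m (odo_shift n z) = odo_shift (n + m) z"
  by (simp add: odo_shift_def mod_add_left_eq add.assoc)

lemma odo_shift_0: "z \<in> odometer \<Longrightarrow> odo_shift 0 z = z"
  using odometerD by (simp add: odo_shift_def fun_eq_iff)

lemma residues_of_in_odometer: "residues_of n \<in> odometer"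
  by (simp add: odometer_def residues_of_def mod_mod_cancel block_dvd)

lemma odo_shift_residues_of: "odo_shift m (residues_of n) = residues_of (n + m)"
  by (simp add: odo_shift_def residues_of_def mod_add_left_eq)

lemma continuous_on_coordinate:
  fixes \<psi> :: "'a::discrete_topology \<Rightarrow> 'b::topological_space"
  shows "continuous_on S (\<lambda>z :: 'i \<Rightarrow> 'a. \<psi> (z k))"
  using continuous_on_compose2[OF Topological_Spaces.continuous_on_discrete[of UNIV \<psi>]
      continuous_on_product_coordinates[THEN continuous_on_subset[OF _ subset_UNIV]]] by simp

lemma continuous_on_discrete2:
  fixes f :: "'x::topological_space \<Rightarrow> 'a::discrete_topology" and g :: "'x \<Rightarrow> 'b::discrete_topology"
  assumes "continuous_on S f" "continuous_on S g"
  shows "continuous_on S (\<lambda>x. h (f x) (g x))"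
  unfolding continuous_on_def
proof
  fix x assume "x \<in> S"
  then have "\<forall>\<^sub>F y in at x within S. f y = f x" "\<forall>\<^sub>F y in at x within S. g y = g x"
    using assms by (simp_all add: continuous_on_def tendsto_discrete)
  then have "\<forall>\<^sub>F y in at x within S. h (f y) (g y) = h (f x) (g x)"
    by eventually_elim simp
  then show "((\<lambda>y. h (f y) (g y)) \<longlongrightarrow> h (f x) (g x)) (at x within S)"
    by (rule tendsto_eventually)
qed

lemma continuous_on_odo_shift: "continuous_on S (odo_shift n)"
  unfolding odo_shift_def
  by (intro continuous_on_coordinatewise_then_product continuous_on_coordinate)

lemma compact_odometer: "compact odometer"
proof -
  let ?B = "Pi\<^sub>E UNIV (\<lambda>k. {0..<block k})"
  have "compactin (product_topology (\<lambda>_. euclidean) UNIV) ?B"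
    by (subst compactin_PiE) (simp add: finite_imp_compact)
  then have B: "compact ?B" by (simp add: euclidean_product_topology)
  have C: "closed {z :: nat \<Rightarrow> int. \<forall>k. z (Suc k) mod block k = z k}"
    by (intro closed_Collect_all closed_Collect_eq continuous_on_coordinate
        continuous_on_product_coordinates)
  have "odometer = ?B \<inter> {z. \<forall>k. z (Suc k) mod block k = z k}"
    by (auto simp: odometer_def)
  then show ?thesis using compact_Int_closed[OF B C] by simp
qed

section \<open>A continuous cocycle with a discontinuous transfer function\<close>

definition tent :: "real \<Rightarrow> real" where
  "tent x = max 0 (1 - \<bar>x - 1\<bar>)"

lemma tent_lipschitz: "\<bar>tent x - tent y\<bar> \<le> \<bar>x - y\<bar>"
  unfolding tent_def by linarith

lemma tent_eq_0: "x \<le> 0 \<or> x \<ge> 2 \<Longrightarrow> tent x = 0"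
  unfolding tent_def by linarith

lemma tent_eq_self: "0 \<le> x \<Longrightarrow> x \<le> 1 \<Longrightarrow> tent x = x"
  unfolding tent_def by linarith

definition height :: "nat \<Rightarrow> (nat \<Rightarrow> int) \<Rightarrow> real" where
  "height j z = tent (of_int (z (Suc j) div block j) / 2 ^ j)"

text \<open>Adding one to \<open>z\<close> increases its digit at level \<open>j\<close> by at most one, which changes the height by at
  most the slope \<open>(1 / 2) ^ j\<close>, or resets the maximal digit to zero; the tent vanishes at both ends.\<close>

lemma height_step:
  assumes z: "z \<in> odometer"
  shows "\<bar>height j (odo_shift 1 z) - height j z\<bar> \<le> (1 / 2) ^ j"
proof -
  define a where "a = z (Suc j)"
  have a: "0 \<le> a" "a < block j * radix j"
    using odometerD[OF z, of "Suc j"] by (simp_all add: a_def block_Suc)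
  have next': "odo_shift 1 z (Suc j) = (a + 1) mod (block j * radix j)"
    by (simp add: odo_shift_def a_def block_Suc)
  show ?thesis
  proof (cases "a + 1 < block j * radix j")
    case True
    let ?d = "a div block j" and ?d' = "(a + 1) div block j"
    have "?d \<le> ?d'" by (intro zdiv_mono1) auto
    moreover have "?d' \<le> (a + block j) div block j"
      using block_pos[of j] by (intro zdiv_mono1) linarith+
    then have "?d' \<le> ?d + 1" using block_pos[of j] by simp
    ultimately have d: "\<bar>real_of_int ?d' - real_of_int ?d\<bar> \<le> 1" by linarith
    have "\<bar>height j (odo_shift 1 z) - height j z\<bar> \<le> \<bar>real_of_int ?d' / 2 ^ j - real_of_int ?d / 2 ^ j\<bar>"
      using tent_lipschitz a True unfolding height_def next' a_def[symmetric] by simp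
    also have "\<dots> = \<bar>real_of_int ?d' - real_of_int ?d\<bar> / 2 ^ j"
      by (simp add: diff_divide_distrib[symmetric])
    also have "\<dots> \<le> (1 / 2) ^ j" using d by (simp add: power_one_over divide_right_mono)
    finally show ?thesis .
  next
    case False
    then have a': "a + 1 = block j * radix j" using a by simp
    have "odo_shift 1 z (Suc j) = 0" unfolding next' a' by simp
    then have "height j (odo_shift 1 z) = 0" by (simp add: height_def tent_eq_0)
    moreover have "height j z = 0"
    proof -
      have "block j * (radix j - 1) \<le> a"
        unfolding right_diff_distrib mult_1_right using a' block_pos[of j] by linarith
      then have "block j * (radix j - 1) div block j \<le> a div block j" by (intro zdiv_mono1) auto
      then have d: "radix j - 1 \<le> a div block j" using block_pos[of j] by simp
      have "(1::int) \<le> 2 ^ j" by simp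
      then have "(2::int) * 2 ^ j + 1 \<le> 2 ^ j * 4" by linarith
      also have "\<dots> = 2 ^ (j + 2)" by (simp add: power_add)
      also have "\<dots> \<le> radix j" unfolding radix_def by (intro power_increasing) auto
      finally have "2 * 2 ^ j \<le> a div block j" using d by linarith
      then have "real_of_int (2 * 2 ^ j) \<le> real_of_int (a div block j)" by (simp only: of_int_le_iff)
      then have "2 \<le> real_of_int (a div block j) / 2 ^ j" by (simp add: field_simps)
      then show ?thesis by (simp add: height_def a_def[symmetric] tent_eq_0)
    qed
    ultimately show ?thesis by simp
  qed
qed

text \<open>Formally the cocycle is the coboundary of \<open>transfer_fun\<close>. Its series converges uniformly, so the
  cocycle is continuous, whereas the series of heights diverges at points that stand near the top of
  infinitely many tents; there \<open>transfer_fun\<close> takes an arbitrary value.\<close>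

definition cocycle :: "(nat \<Rightarrow> int) \<Rightarrow> real" where
  "cocycle z = (\<Sum>j. height j (odo_shift 1 z) - height j z)"

definition transfer_fun :: "(nat \<Rightarrow> int) \<Rightarrow> real" where
  "transfer_fun z = (\<Sum>j. height j z)"

lemma summable_height_step:
  "z \<in> odometer \<Longrightarrow> summable (\<lambda>j. height j (odo_shift 1 z) - height j z)"
  by (rule summable_comparison_test'[where g = "\<lambda>j. (1 / 2) ^ j" and N = 0])
    (use height_step in \<open>auto simp: summable_geometric\<close>)

lemma continuous_on_cocycle: "continuous_on odometer cocycle"
proof -
  have lim: "uniform_limit odometer (\<lambda>n z. \<Sum>j<n. height j (odo_shift 1 z) - height j z) cocycle sequentially"
    unfolding cocycle_def
    by (rule Weierstrass_m_test[where M = "\<lambda>j. (1 / 2) ^ j"])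
      (use height_step in \<open>auto simp: summable_geometric\<close>)
  have "continuous_on odometer (\<lambda>z. \<Sum>j<n. height j (odo_shift 1 z) - height j z)" for n
    unfolding height_def odo_shift_def
    by (intro continuous_on_sum continuous_on_diff continuous_on_coordinate)
  then show ?thesis
    by (intro uniform_limit_theorem[OF _ lim] always_eventually) simp_all
qed

lemma cocycle_coboundary:
  assumes z: "z \<in> odometer" and s: "summable (\<lambda>j. height j z)"
  shows "summable (\<lambda>j. height j (odo_shift 1 z))"
    and "transfer_fun (odo_shift 1 z) = transfer_fun z + cocycle z"
proof -
  have "summable (\<lambda>j. (height j (odo_shift 1 z) - height j z) + height j z)"
    by (rule summable_add[OF summable_height_step[OF z] s])
  then show "summable (\<lambda>j. height j (odo_shift 1 z))" by simp
  have "cocycle z + transfer_fun z = (\<Sum>j. (height j (odo_shift 1 z) - height j z) + height j z)"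
    unfolding cocycle_def transfer_fun_def by (rule suminf_add[OF summable_height_step[OF z] s])
  then show "transfer_fun (odo_shift 1 z) = transfer_fun z + cocycle z"
    by (simp add: transfer_fun_def)
qed

lemma height_residues_of_small:
  assumes "0 \<le> n" "n < block j"
  shows "height j (residues_of n) = 0"
proof -
  have "n < block (Suc j)" using assms(2) block_mono[of j "Suc j"] by simp
  then show ?thesis using assms by (simp add: height_def residues_of_def tent_eq_0)
qed

lemma int_less_block: "int m < block m"
proof (induction m)
  case (Suc m)
  have "2 \<le> radix m" using power_increasing[of 1 "2 * m + 4" "2::int"] by (simp add: radix_def)
  then have "block m * 2 \<le> block m * radix m" by (intro mult_left_mono) (simp_all add: less_imp_le)
  then show ?case using Suc unfolding block_Suc of_nat_Suc by linarith
qed (simp add: block_def)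

lemma summable_height_residues_of:
  assumes "0 \<le> n"
  shows "summable (\<lambda>j. height j (residues_of n))"
proof (rule summable_finite[of "{..nat n}"])
  fix j assume "j \<notin> {..nat n}"
  then have "n < int j" by auto
  then show "height j (residues_of n) = 0"
    using int_less_block[of j] by (intro height_residues_of_small[OF assms]) simp
qed simp

section \<open>The skew product\<close>

type_synonym skew_point = "(nat \<Rightarrow> int) \<times> complex"

definition skew_space :: "skew_point set" where
  "skew_space = odometer \<times> sphere 0 1"

definition skew :: "skew_point \<Rightarrow> skew_point" where
  "skew p = (odo_shift 1 (fst p), snd p * cis (2 * pi * cocycle (fst p)))"

lemma skew_pair: "skew (z, w) = (odo_shift 1 z, w * cis (2 * pi * cocycle z))"
  by (simp add: skew_def)

definition unskew :: "skew_point \<Rightarrow> skew_point" where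
  "unskew p = (odo_shift (- 1) (fst p), snd p * cis (- (2 * pi * cocycle (odo_shift (- 1) (fst p)))))"

abbreviation "skew_top \<equiv> top_of_set skew_space"

lemma skew_in_space: "p \<in> skew_space \<Longrightarrow> skew p \<in> skew_space"
  and unskew_in_space: "p \<in> skew_space \<Longrightarrow> unskew p \<in> skew_space"
  by (auto simp: skew_space_def skew_def unskew_def odo_shift_in_odometer norm_mult)

lemma skew_unskew: "p \<in> skew_space \<Longrightarrow> skew (unskew p) = p"
  and unskew_skew: "p \<in> skew_space \<Longrightarrow> unskew (skew p) = p"
  by (auto simp: skew_space_def skew_def unskew_def odo_shift_add odo_shift_0 mult.assoc cis_mult)

lemma continuous_on_skew: "continuous_on skew_space skew"
  unfolding skew_def skew_space_def
  by (intro continuous_intros continuous_on_compose2[OF continuous_on_odo_shift]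
      continuous_on_compose2[OF continuous_on_cocycle]) auto

lemma continuous_on_unskew: "continuous_on skew_space unskew"
  unfolding unskew_def skew_space_def
  by (intro continuous_intros continuous_on_compose2[OF continuous_on_odo_shift]
      continuous_on_compose2[OF continuous_on_cocycle])
    (auto simp: odo_shift_in_odometer intro!: continuous_intros)

lemma metrizable_skew_top: "metrizable_space skew_top"
proof -
  have "(euclidean :: int topology) = discrete_topology UNIV"
    by (simp add: topology_eq Topological_Spaces.open_discrete)
  then have "metrizable_space (product_topology (\<lambda>_::nat. euclidean :: int topology) UNIV)"
    by (simp add: metrizable_space_product_topology metrizable_space_discrete_topology)
  then have "metrizable_space (euclidean :: (nat \<Rightarrow> int) topology)"
    by (simp only: euclidean_product_topology)
  then have "metrizable_space (prod_topology (euclidean :: (nat \<Rightarrow> int) topology) (euclidean :: complex topology))"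
    unfolding metrizable_space_prod_topology using metrizable_space_euclidean by blast
  then show ?thesis unfolding prod_topology_euclidean by (rule metrizable_space_subtopology)
qed

lemma skew_flow: "flow skew_top skew"
proof -
  have "homeomorphic_maps skew_top skew_top skew unskew"
    using skew_in_space unskew_in_space
    by (auto simp: homeomorphic_maps_def skew_unskew unskew_skew continuous_on_skew continuous_on_unskew)
  moreover have "compact skew_space"
    unfolding skew_space_def by (intro compact_Times compact_odometer compact_sphere)
  moreover have "(residues_of 0, 1) \<in> skew_space"
    by (simp add: skew_space_def residues_of_in_odometer)
  ultimately show ?thesis
    using metrizable_imp_Hausdorff_space[OF metrizable_skew_top] homeomorphic_maps_imp_map
    by (auto simp: flow_def compact_space_subtopology)
qed

text \<open>The difference of the residues at each level is invariant, and separates points over different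
  base points; over one base point the flow acts by rotations of the circle.\<close>

lemma skew_distal: "distal_flow skew_top skew"
proof (rule distal_flowI_invariant[OF skew_flow])
  fix p q assume pq: "p \<in> topspace skew_top" "q \<in> topspace skew_top" and ne: "p \<noteq> q"
  let ?T = "flow_pow skew_top skew"
  have prod: "prod_topology skew_top skew_top = top_of_set (skew_space \<times> skew_space)"
    by (simp add: prod_topology_subtopology_eu)
  have odo: "fst p \<in> odometer" "fst q \<in> odometer" "cmod (snd p) = 1" "cmod (snd q) = 1"
    using pq by (auto simp: skew_space_def)
  show "\<exists>I c. continuous_map (prod_topology skew_top skew_top) euclidean I \<and>
      (\<forall>n. I (?T n p, ?T n q) = (c :: complex)) \<and> (\<forall>z\<in>topspace skew_top. I (z, z) \<noteq> c)"
  proof (cases "fst p = fst q")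
    case False
    then obtain k where k: "fst p k \<noteq> fst q k" by auto
    define J :: "skew_point \<Rightarrow> skew_point \<Rightarrow> complex"
      where "J x y = of_int ((fst x k - fst y k) mod block k)" for x y
    have "J (skew x) (skew y) = J x y" for x y
    proof -
      have "((fst x k + 1) mod block k - (fst y k + 1) mod block k) mod block k =
          (fst x k - fst y k) mod block k"
        by (simp add: mod_diff_eq)
      then show ?thesis by (simp add: J_def skew_def odo_shift_def)
    qed
    then have inv: "J (?T n p) (?T n q) = J p q" for n
      by (intro flow_pow_invariant[OF skew_flow pq])
    have "continuous_on (skew_space \<times> skew_space) (\<lambda>x. J (fst x) (snd x))"
      unfolding J_def
      by (rule continuous_on_discrete2; rule continuous_on_compose2[OF
            continuous_on_product_coordinates[THEN continuous_on_subset], of UNIV])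
        (intro continuous_intros | simp)+
    then have "continuous_map (prod_topology skew_top skew_top) euclidean (\<lambda>x. J (fst x) (snd x))"
      unfolding prod by simp
    moreover have "J p q \<noteq> 0"
    proof
      assume "J p q = 0"
      then have "(fst p k - fst q k) mod block k = 0" by (simp add: J_def)
      then have "fst p k mod block k = fst q k mod block k" by (simp add: mod_eq_dvd_iff dvd_eq_mod_eq_0)
      then show False using k odometerD[OF odo(1), of k] odometerD[OF odo(2), of k] by simp
    qed
    ultimately show ?thesis
      using inv by (intro exI[of _ "\<lambda>x. J (fst x) (snd x)"] exI[of _ "J p q"]) (auto simp: J_def)
  next
    case True
    define J :: "skew_point \<Rightarrow> skew_point \<Rightarrow> complex"
      where "J x y = (if fst x = fst y then snd x * cnj (snd y) else 0)" for x y
    have "J (skew x) (skew y) = J x y" if "x \<in> topspace skew_top" "y \<in> topspace skew_top" for x y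
    proof -
      have xy: "fst x \<in> odometer" "fst y \<in> odometer" using that by (auto simp: skew_space_def)
      have "fst x = fst y" if "odo_shift 1 (fst x) = odo_shift 1 (fst y)"
        using arg_cong[OF that, of "odo_shift (- 1)"] xy by (simp add: odo_shift_add odo_shift_0)
      moreover have "w * cis a * (cnj v * cnj (cis a)) = w * cnj v" for w v a
        using mult_cnj_unit[of "cis a"] by (simp add: algebra_simps)
      ultimately show ?thesis by (auto simp: J_def skew_def)
    qed
    then have inv: "J (?T n p) (?T n q) = J p q" for n
      by (intro flow_pow_invariant[OF skew_flow pq])
    have Jpq: "J p q = snd p * cnj (snd q)" using True by (simp add: J_def)
    have "J p q \<noteq> 0" using odo(3,4) by (auto simp: Jpq)
    then have inv': "snd (?T n p) * cnj (snd (?T n q)) = J p q" for n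
      using inv[of n] by (simp add: J_def split: if_splits)
    have ne1: "J p q \<noteq> 1"
    proof
      assume "J p q = 1"
      then have "snd p * (cnj (snd q) * snd q) = snd q" by (simp add: Jpq mult.assoc[symmetric])
      then have "snd p = snd q" using mult_cnj_unit[OF odo(4)] by (simp add: mult.commute)
      then show False using ne True by (simp add: prod_eq_iff)
    qed
    let ?I = "\<lambda>x :: skew_point \<times> skew_point. snd (fst x) * cnj (snd (snd x))"
    have "continuous_map (prod_topology skew_top skew_top) euclidean ?I"
      unfolding prod by (simp, intro continuous_intros)
    moreover have "?I (z, z) = 1" if "z \<in> skew_space" for z
      using that by (auto simp: skew_space_def mult_cnj_unit)
    ultimately show ?thesis
      using inv' ne1 by (intro exI[of _ ?I] exI[of _ "J p q"]) auto
  qed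
qed

lemma skew_pow_residues_of:
  "flow_pow skew_top skew (int n) (residues_of 0, 1) =
    (residues_of (int n), cis (2 * pi * transfer_fun (residues_of (int n))))"
proof (induction n)
  case 0
  have "height j (residues_of 0) = 0" for j by (rule height_residues_of_small) auto
  then show ?case by (simp add: transfer_fun_def)
next
  case (Suc n)
  have base: "(residues_of 0, 1) \<in> topspace skew_top"
    by (simp add: skew_space_def residues_of_in_odometer)
  have "transfer_fun (residues_of (int n + 1)) =
      transfer_fun (residues_of (int n)) + cocycle (residues_of (int n))"
    using cocycle_coboundary(2)[OF residues_of_in_odometer summable_height_residues_of, of "int n"]
    by (simp add: odo_shift_residues_of)
  moreover have "flow_pow skew_top skew (int n + 1) (residues_of 0, 1) =
      skew (residues_of (int n), cis (2 * pi * transfer_fun (residues_of (int n))))"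
    using flow_pow_add1[OF skew_flow base, of "int n"] unfolding Suc .
  moreover have "int (Suc n) = int n + 1" by simp
  ultimately show ?case
    by (simp only: skew_pair odo_shift_residues_of cis_mult distrib_left)
qed

text \<open>To reach \<open>(z, w)\<close>, start at the residue \<open>z k\<close>, which fixes all levels up to \<open>k\<close>, and use the
  digit at level \<open>k\<close> to climb the tent to any desired height: the \<open>2 ^ k\<close> steps on its left side
  have height \<open>(1 / 2) ^ k\<close> each, and no higher tent has started yet.\<close>

lemma skew_orbit_approximation:
  assumes z: "z \<in> odometer" and w: "cmod w = 1"
  obtains n \<delta> where "\<And>m. m \<le> k \<Longrightarrow> residues_of (int n) m = z m" and "\<bar>\<delta>\<bar> \<le> (1 / 2) ^ k"
    and "cis (2 * pi * transfer_fun (residues_of (int n))) = w * cis (2 * pi * \<delta>)"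
proof -
  define \<theta> where "\<theta> = Arg w / (2 * pi)"
  have "w \<noteq> 0" using w by auto
  then have w_cis: "w = cis (2 * pi * \<theta>)" using cis_Arg[of w] w by (simp add: \<theta>_def sgn_div_norm)
  define s where "s = (\<Sum>j<k. height j z)"
  \<comment> \<open>The levels below \<open>k\<close> contribute \<open>s\<close>; level \<open>k\<close> has to supply the rest of the angle modulo \<open>1\<close>.\<close>
  define i where "i = \<lfloor>2 ^ k * frac (\<theta> - s)\<rfloor>"
  have fr: "0 \<le> frac (\<theta> - s)" "frac (\<theta> - s) < 1" by (simp_all add: frac_lt_1)
  have i0: "0 \<le> i" using fr by (simp add: i_def)
  have i1: "i < 2 ^ k"
  proof -
    have "2 ^ k * frac (\<theta> - s) < 2 ^ k" using fr by simp
    then show ?thesis by (simp add: i_def floor_less_iff)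
  qed
  have i_approx: "real_of_int i \<le> 2 ^ k * frac (\<theta> - s)" "2 ^ k * frac (\<theta> - s) < real_of_int i + 1"
    unfolding i_def by linarith+
  define n where "n = z k + i * block k"
  have zk: "0 \<le> z k" "z k < block k" using odometerD[OF z] by auto
  have n0: "0 \<le> n" using zk i0 by (simp add: n_def)
  have n_less: "n < block (Suc k)"
  proof -
    have "n < (i + 1) * block k" using zk by (simp add: n_def algebra_simps)
    also have "\<dots> \<le> 2 ^ k * block k" using i1 by (intro mult_right_mono less_imp_le[OF block_pos]) auto
    also have "\<dots> \<le> radix k * block k"
      unfolding radix_def by (intro mult_right_mono power_increasing) (auto intro: less_imp_le)
    finally show ?thesis by (simp add: block_Suc mult.commute)
  qed
  have res: "residues_of n m = z m" if "m \<le> k" for m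
  proof -
    have "n mod block m = z k mod block m"
      using block_dvd[OF that] by (simp add: n_def mod_add_right_eq[symmetric])
    then show ?thesis using odometer_mod[OF z that] by (simp add: residues_of_def)
  qed
  have "height j (residues_of n) = height j z" if "j < k" for j
    using res[of "Suc j"] that by (simp add: height_def)
  moreover have hk: "height k (residues_of n) = real_of_int i / 2 ^ k"
  proof -
    have "n div block k = i" using zk by (simp add: n_def)
    then have "height k (residues_of n) = tent (real_of_int i / 2 ^ k)"
      using n0 n_less by (simp add: height_def residues_of_def)
    also have "real_of_int i \<le> 2 ^ k" using i1
      by (metis less_imp_le of_int_le_iff of_int_numeral of_int_power)
    then have "tent (real_of_int i / 2 ^ k) = real_of_int i / 2 ^ k"
      using i0 by (intro tent_eq_self) auto
    finally show ?thesis .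
  qed
  moreover have "height j (residues_of n) = 0" if "j > k" for j
    using n0 n_less block_mono[of "Suc k" j] that by (intro height_residues_of_small) auto
  then have "transfer_fun (residues_of n) = (\<Sum>j<Suc k. height j (residues_of n))"
    unfolding transfer_fun_def by (intro suminf_finite) auto
  ultimately have R: "transfer_fun (residues_of n) = s + real_of_int i / 2 ^ k"
    by (simp add: s_def)
  define \<delta> where "\<delta> = real_of_int i / 2 ^ k - frac (\<theta> - s)"
  have "\<bar>\<delta>\<bar> \<le> (1 / 2) ^ k"
  proof -
    have "\<delta> = (real_of_int i - 2 ^ k * frac (\<theta> - s)) / 2 ^ k" by (simp add: \<delta>_def field_simps)
    then have "\<bar>\<delta>\<bar> = \<bar>real_of_int i - 2 ^ k * frac (\<theta> - s)\<bar> / 2 ^ k" by simp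
    also have "\<dots> \<le> 1 / 2 ^ k" using i_approx by (intro divide_right_mono) auto
    finally show ?thesis by (simp add: power_one_over)
  qed
  moreover have "cis (2 * pi * transfer_fun (residues_of n)) = w * cis (2 * pi * \<delta>)"
  proof -
    have t: "transfer_fun (residues_of n) = \<theta> + \<delta> + (- of_int \<lfloor>\<theta> - s\<rfloor>)"
      unfolding R \<delta>_def frac_def by simp
    have e: "2 * pi * transfer_fun (residues_of n) =
        2 * pi * \<theta> + 2 * pi * \<delta> + 2 * pi * (- of_int \<lfloor>\<theta> - s\<rfloor>)"
      unfolding t by (simp only: distrib_left)
    have "cis (2 * pi * transfer_fun (residues_of n)) =
        cis (2 * pi * \<theta>) * cis (2 * pi * \<delta>) * cis (2 * pi * (- of_int \<lfloor>\<theta> - s\<rfloor>))"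
      by (simp only: cis_mult e)
    also have "cis (2 * pi * (- of_int \<lfloor>\<theta> - s\<rfloor>)) = 1" by (rule cis_multiple_2pi) simp
    finally show ?thesis by (simp only: w_cis mult_1_right)
  qed
  ultimately show thesis using that[of "nat n" \<delta>] res n0 by simp
qed

lemma skew_dense_orbit:
  "skew_top closure_of orbit skew_top skew (residues_of 0, 1) = topspace skew_top"
proof -
  let ?O = "orbit skew_top skew (residues_of 0, 1)"
  have "skew_space \<subseteq> closure ?O"
  proof
    fix p assume "p \<in> skew_space"
    then obtain z w where p: "p = (z, w)" and z: "z \<in> odometer" and w: "cmod w = 1"
      by (auto simp: skew_space_def)
    have "\<exists>n \<delta>. (\<forall>m\<le>k. residues_of (int n) m = z m) \<and> \<bar>\<delta>\<bar> \<le> (1 / 2) ^ k \<and>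
        cis (2 * pi * transfer_fun (residues_of (int n))) = w * cis (2 * pi * \<delta>)" for k
      by (rule skew_orbit_approximation[OF z w, of k]) blast
    then obtain n \<delta> where n: "\<And>m k. m \<le> k \<Longrightarrow> residues_of (int (n k)) m = z m"
      and \<delta>: "\<And>k. \<bar>\<delta> k\<bar> \<le> (1 / 2) ^ k"
      and R: "\<And>k. cis (2 * pi * transfer_fun (residues_of (int (n k)))) = w * cis (2 * pi * \<delta> k)"
      by metis
    have "\<delta> \<longlonglongrightarrow> 0"
    proof (rule Lim_null_comparison)
      show "\<forall>\<^sub>F k in sequentially. norm (\<delta> k) \<le> (1 / 2) ^ k" using \<delta> by simp
      show "(\<lambda>k. (1 / 2) ^ k :: real) \<longlonglongrightarrow> 0" by (rule LIMSEQ_realpow_zero) auto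
    qed
    then have "(\<lambda>k. w * cis (2 * pi * \<delta> k)) \<longlonglongrightarrow> w * cis (2 * pi * 0)"
      by (intro tendsto_intros)
    moreover have "(\<lambda>k. residues_of (int (n k))) \<longlonglongrightarrow> z"
    proof -
      have "(\<lambda>k. residues_of (int (n k)) m) \<longlonglongrightarrow> z m" for m
        by (rule tendsto_eventually) (use n in \<open>auto simp: eventually_sequentially\<close>)
      then have "limitin (product_topology (\<lambda>_. euclidean) UNIV) (\<lambda>k. residues_of (int (n k))) z sequentially"
        by (simp add: limitin_componentwise)
      then show ?thesis by (simp add: euclidean_product_topology)
    qed
    ultimately have lim: "(\<lambda>k. (residues_of (int (n k)), w * cis (2 * pi * \<delta> k))) \<longlonglongrightarrow> p"
      unfolding p by (intro tendsto_Pair) simp_all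
    have "(residues_of (int (n k)), w * cis (2 * pi * \<delta> k)) \<in> closure ?O" for k
    proof -
      have "(residues_of (int (n k)), w * cis (2 * pi * \<delta> k)) \<in> ?O"
        unfolding orbit_def R[symmetric] skew_pow_residues_of[symmetric] by (rule rangeI)
      then show ?thesis using closure_subset by (rule subsetD[rotated])
    qed
    then show "p \<in> closure ?O"
      by (intro Lim_in_closed_set[OF closed_closure _ _ lim]) auto
  qed
  moreover have "?O \<subseteq> skew_space"
  proof -
    have "(residues_of 0, 1) \<in> topspace skew_top"
      by (simp add: skew_space_def residues_of_in_odometer)
    from flow_pow_in_topspace[OF skew_flow this] show ?thesis
      by (simp add: orbit_def image_subset_iff)
  qed
  ultimately show ?thesis
    by (simp add: closure_of_subtopology Int_absorb1 Int_absorb2)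
qed

lemma skew_minimal: "minimal_flow skew_top skew"
  by (rule distal_flow_dense_orbit_imp_minimal[OF skew_distal _ skew_dense_orbit])
    (simp add: skew_space_def residues_of_in_odometer)


section \<open>The uniform measure on the odometer\<close>

text \<open>Second countability makes a map into a countable product of copies of \<open>int\<close> Borel measurable as
  soon as its coordinates are.\<close>

instance int :: second_countable_topology
proof
  have "open = generate_topology (range (\<lambda>x::int. {x}))"
  proof (intro ext iffI)
    fix S :: "int set"
    have "generate_topology (range (\<lambda>x::int. {x})) (\<Union>x\<in>S. {x})"
      by (rule generate_topology_Union) (rule generate_topology.Basis, rule rangeI)
    then show "generate_topology (range (\<lambda>x::int. {x})) S" by simp
  qed (rule Topological_Spaces.open_discrete)
  then show "\<exists>B::int set set. countable B \<and> open = generate_topology B"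
    by (intro exI[of _ "range (\<lambda>x. {x})"] conjI countable_image countableI_type)
qed

definition digit_space :: "(nat \<Rightarrow> int) measure" where
  "digit_space = PiM UNIV (\<lambda>j. measure_pmf (pmf_of_set {0..<radix j}))"

text \<open>Digits are reduced modulo the radix, so that every sequence of integers, and not only almost every
  one, yields a point of the odometer.\<close>

definition of_digits :: "(nat \<Rightarrow> int) \<Rightarrow> nat \<Rightarrow> int" where
  "of_digits \<omega> = (\<lambda>k. \<Sum>j<k. (\<omega> j mod radix j) * block j)"

text \<open>The empty set makes the family closed under intersections.\<close>

definition cylinders :: "(nat \<Rightarrow> int) set set" where
  "cylinders = insert {} {{z \<in> odometer. z k = a} |k a. True}"

definition cylinder_algebra :: "(nat \<Rightarrow> int) measure" where
  "cylinder_algebra = sigma odometer cylinders"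

definition odo_measure :: "(nat \<Rightarrow> int) measure" where
  "odo_measure = distr digit_space cylinder_algebra of_digits"

lemma of_digits_bounds: "0 \<le> of_digits \<omega> k \<and> of_digits \<omega> k < block k"
proof (induction k)
  case 0
  then show ?case by (simp add: of_digits_def block_def)
next
  case (Suc k)
  let ?d = "\<omega> k mod radix k"
  have d0: "0 \<le> ?d" by (rule pos_mod_sign[OF radix_pos])
  have "?d < radix k" by (rule pos_mod_bound[OF radix_pos])
  then have "?d + 1 \<le> radix k" by (rule zless_imp_add1_zle)
  then have "(?d + 1) * block k \<le> radix k * block k"
    by (intro mult_right_mono less_imp_le[OF block_pos])
  then have "?d * block k + block k \<le> block (Suc k)"
    by (simp add: block_Suc algebra_simps)
  moreover have "0 \<le> ?d * block k"
    using d0 by (intro mult_nonneg_nonneg less_imp_le[OF block_pos])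
  moreover have "of_digits \<omega> (Suc k) = of_digits \<omega> k + ?d * block k"
    by (simp add: of_digits_def)
  ultimately show ?case using Suc by linarith
qed

lemma of_digits_in_odometer: "of_digits \<omega> \<in> odometer"
proof -
  have "of_digits \<omega> (Suc k) mod block k = of_digits \<omega> k" for k
  proof -
    have "of_digits \<omega> (Suc k) mod block k = of_digits \<omega> k mod block k"
      by (simp add: of_digits_def)
    then show ?thesis using of_digits_bounds[of \<omega> k] by simp
  qed
  then show ?thesis using of_digits_bounds by (simp add: odometer_def)
qed

lemma of_digits_digit: "of_digits \<omega> (Suc j) div block j = \<omega> j mod radix j"
proof -
  have "of_digits \<omega> (Suc j) = of_digits \<omega> j + (\<omega> j mod radix j) * block j"
    by (simp add: of_digits_def)
  then show ?thesis using of_digits_bounds[of \<omega> j] by simp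
qed

lemma digit_expansion: "(\<Sum>j<k. (a div block j mod radix j) * block j) = a mod block k"
proof (induction k)
  case 0
  then show ?case by (simp add: block_def)
next
  case (Suc k)
  have "a mod block (Suc k) = block k * (a div block k mod radix k) + a mod block k"
    unfolding block_Suc by (rule zmod_zmult2_eq) (rule less_imp_le[OF radix_pos])
  then show ?case using Suc by (simp add: algebra_simps)
qed

text \<open>Residues modulo \<open>block k\<close> correspond to the first \<open>k\<close> digits; this makes all of them equally likely.\<close>

lemma of_digits_eq_iff:
  assumes "a \<in> {0..<block k}"
  shows "of_digits \<omega> k = a \<longleftrightarrow> (\<forall>j<k. \<omega> j mod radix j = a div block j mod radix j)"
proof
  assume a: "of_digits \<omega> k = a"
  show "\<forall>j<k. \<omega> j mod radix j = a div block j mod radix j"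
  proof (intro allI impI)
    fix j assume "j < k"
    then have "a mod block (Suc j) = of_digits \<omega> (Suc j)"
      using odometer_mod[OF of_digits_in_odometer, of "Suc j" k \<omega>] a by simp
    moreover have "a mod block (Suc j) = block j * (a div block j mod radix j) + a mod block j"
      unfolding block_Suc by (rule zmod_zmult2_eq) (rule less_imp_le[OF radix_pos])
    then have "a mod block (Suc j) div block j = a div block j mod radix j" by simp
    ultimately show "\<omega> j mod radix j = a div block j mod radix j" by (simp add: of_digits_digit)
  qed
next
  assume "\<forall>j<k. \<omega> j mod radix j = a div block j mod radix j"
  then have "of_digits \<omega> k = (\<Sum>j<k. (a div block j mod radix j) * block j)"
    unfolding of_digits_def by (intro sum.cong) auto
  then show "of_digits \<omega> k = a" using assms by (simp add: digit_expansion)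
qed

lemma prob_space_digit_space: "prob_space digit_space"
  unfolding digit_space_def by (intro prob_space_PiM prob_space_measure_pmf)

lemma space_digit_space [simp]: "space digit_space = UNIV"
  by (simp add: digit_space_def space_PiM)

lemma measurable_digit: "(\<lambda>\<omega>. f (\<omega> j)) \<in> measurable digit_space (count_space UNIV)"
proof -
  have "(\<lambda>\<omega>. \<omega> j) \<in> measurable digit_space (measure_pmf (pmf_of_set {0..<radix j}))"
    unfolding digit_space_def by (rule measurable_component_singleton) simp
  then show ?thesis by (rule measurable_compose) simp
qed

lemma digit_space_cylinder:
  "emeasure digit_space {\<omega>. \<forall>j\<in>J. \<omega> j \<in> A j} =
    (\<Prod>j\<in>J. emeasure (measure_pmf (pmf_of_set {0..<radix j})) (A j))" if "finite J"
proof -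
  interpret product_prob_space "\<lambda>j. measure_pmf (pmf_of_set {0..<radix j})" UNIV
    by (rule product_prob_spaceI) (rule prob_space_measure_pmf)
  show ?thesis
    using emeasure_PiM_Collect[of J A] that by (simp add: digit_space_def space_PiM)
qed

lemma emeasure_digit:
  assumes "D \<subseteq> {0..<radix j}"
  shows "emeasure (measure_pmf (pmf_of_set {0..<radix j})) {x. x mod radix j \<in> D} =
    ennreal (real (card D) / real_of_int (radix j))"
proof -
  have "{0..<radix j} \<inter> {x. x mod radix j \<in> D} = D" using assms by auto
  moreover have "card {0..<radix j} = nat (radix j)" by simp
  ultimately show ?thesis
    using radix_pos[of j] by (subst emeasure_pmf_of_set) (auto simp: less_imp_le)
qed

lemma space_cylinder_algebra [simp]: "space cylinder_algebra = odometer"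
  by (simp add: cylinder_algebra_def space_measure_of_conv)

lemma sets_cylinder_algebra: "sets cylinder_algebra = sigma_sets odometer cylinders"
  unfolding cylinder_algebra_def by (rule sets_measure_of) (auto simp: cylinders_def)

lemma of_digits_vimage:
  "of_digits -` {z \<in> odometer. z k = a} =
    (if a \<in> {0..<block k} then {\<omega>. \<forall>j\<in>{..<k}. \<omega> j \<in> {x. x mod radix j \<in> {a div block j mod radix j}}} else {})"
proof (cases "a \<in> {0..<block k}")
  case True
  then show ?thesis using of_digits_eq_iff[OF True] by (auto simp: of_digits_in_odometer)
next
  case False
  then show ?thesis using of_digits_bounds[of _ k] by auto
qed

lemma measurable_of_digits: "of_digits \<in> measurable digit_space cylinder_algebra"
  unfolding cylinder_algebra_def
proof (rule measurable_measure_of)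
  show "cylinders \<subseteq> Pow odometer" by (auto simp: cylinders_def)
  show "of_digits \<in> space digit_space \<rightarrow> odometer" by (simp add: of_digits_in_odometer)
  fix C assume "C \<in> cylinders"
  then consider "C = {}" | k a where "C = {z \<in> odometer. z k = a}" by (auto simp: cylinders_def)
  then show "of_digits -` C \<inter> space digit_space \<in> sets digit_space"
  proof cases
    case 2
    have "{\<omega> \<in> space digit_space. \<forall>j\<in>{..<k}. \<omega> j \<in> {x. x mod radix j \<in> {a div block j mod radix j}}}
        \<in> sets digit_space"
    proof (rule sets.sets_Collect_finite_All)
      fix j
      have "(\<lambda>\<omega>. \<omega> j) -` {x. x mod radix j \<in> {a div block j mod radix j}} \<inter> space digit_space
          \<in> sets digit_space"
        by (rule measurable_sets[OF measurable_digit[of "\<lambda>x. x"]]) simp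
      then show "{\<omega> \<in> space digit_space. \<omega> j \<in> {x. x mod radix j \<in> {a div block j mod radix j}}}
          \<in> sets digit_space"
        by (simp add: vimage_def)
    qed simp
    then show ?thesis unfolding 2 of_digits_vimage by simp
  qed simp
qed

lemma prob_space_odo_measure: "prob_space odo_measure"
  unfolding odo_measure_def
  by (rule prob_space.prob_space_distr[OF prob_space_digit_space measurable_of_digits])

lemma space_odo_measure [simp]: "space odo_measure = odometer"
  and sets_odo_measure: "sets odo_measure = sets cylinder_algebra"
  by (simp_all add: odo_measure_def)

lemma measurable_odo_measure: "measurable odo_measure N = measurable cylinder_algebra N"
  by (rule measurable_cong_sets[OF sets_odo_measure refl])

lemma cylinder_in_sets: "{z \<in> odometer. z k = a} \<in> sets cylinder_algebra"
  unfolding sets_cylinder_algebra by (rule sigma_sets.Basic) (auto simp: cylinders_def)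

lemma emeasure_odo_cylinder:
  "emeasure odo_measure {z \<in> odometer. z k = a} =
    (if a \<in> {0..<block k} then ennreal (1 / real_of_int (block k)) else 0)"
proof (cases "a \<in> {0..<block k}")
  case True
  have "emeasure odo_measure {z \<in> odometer. z k = a} = emeasure digit_space
      {\<omega>. \<forall>j\<in>{..<k}. \<omega> j \<in> {x. x mod radix j \<in> {a div block j mod radix j}}}"
    unfolding odo_measure_def emeasure_distr[OF measurable_of_digits cylinder_in_sets]
      of_digits_vimage using True by simp
  also have "\<dots> = (\<Prod>j<k. ennreal (1 / real_of_int (radix j)))"
    by (subst digit_space_cylinder, simp, intro prod.cong refl, subst emeasure_digit) auto
  also have "\<dots> = ennreal (\<Prod>j<k. 1 / real_of_int (radix j))"
    by (rule prod_ennreal) (simp add: less_imp_le)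
  also have "(\<Prod>j<k. 1 / real_of_int (radix j)) = 1 / real_of_int (block k)"
    by (simp add: block_def prod_dividef)
  finally show ?thesis using True by simp
next
  case False
  then have empty: "{z \<in> odometer. z k = a} = {}" using odometerD by auto
  show ?thesis unfolding empty using False by auto
qed

lemma measurable_coordinate:
  "(\<lambda>z. f (z k)) \<in> measurable cylinder_algebra (count_space UNIV)"
proof (rule measurableI)
  fix A
  have "(\<Union>a\<in>f -` A. {z \<in> odometer. z k = a}) \<in> sets cylinder_algebra"
    by (rule sets.countable_UN') (simp_all add: image_subset_iff cylinder_in_sets)
  moreover have "(\<lambda>z. f (z k)) -` A \<inter> space cylinder_algebra = (\<Union>a\<in>f -` A. {z \<in> odometer. z k = a})"
    by auto
  ultimately show "(\<lambda>z. f (z k)) -` A \<inter> space cylinder_algebra \<in> sets cylinder_algebra" by simp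
qed simp

lemma measurable_coordinate_borel:
  fixes f :: "int \<Rightarrow> 'b::topological_space"
  shows "(\<lambda>z. f (z k)) \<in> borel_measurable cylinder_algebra"
  by (rule measurable_compose[OF measurable_coordinate[of "\<lambda>x. x"]]) simp

lemma odo_shift_vimage:
  "odo_shift 1 -` {z \<in> odometer. z k = a} \<inter> odometer =
    (if a \<in> {0..<block k} then {z \<in> odometer. z k = (a - 1) mod block k} else {})"
proof (cases "a \<in> {0..<block k}")
  case True
  have "(z k + 1) mod block k = a \<longleftrightarrow> z k = (a - 1) mod block k" if "z \<in> odometer" for z
  proof
    assume a: "(z k + 1) mod block k = a"
    have "(a - 1) mod block k = z k mod block k" unfolding a[symmetric] mod_diff_left_eq by simp
    then show "z k = (a - 1) mod block k" using odometerD[OF that, of k] by simp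
  next
    assume "z k = (a - 1) mod block k"
    then have "(z k + 1) mod block k = a mod block k" by (simp add: mod_add_left_eq)
    then show "(z k + 1) mod block k = a" using True by simp
  qed
  then have "z \<in> odo_shift 1 -` {z \<in> odometer. z k = a} \<inter> odometer \<longleftrightarrow>
      z \<in> {z \<in> odometer. z k = (a - 1) mod block k}" for z
    using odo_shift_in_odometer[of z 1] by (simp add: odo_shift_def conj_commute cong: conj_cong)
  then show ?thesis using True by (simp add: set_eq_iff)
next
  case False
  then show ?thesis using odometerD[OF odo_shift_in_odometer] by auto
qed

lemma measurable_odo_shift: "odo_shift 1 \<in> measurable cylinder_algebra cylinder_algebra"
proof -
  have "odo_shift 1 \<in> measurable cylinder_algebra (sigma odometer cylinders)"
  proof (rule measurable_measure_of)
    show "cylinders \<subseteq> Pow odometer" by (auto simp: cylinders_def)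
    show "odo_shift 1 \<in> space cylinder_algebra \<rightarrow> odometer" by (simp add: odo_shift_in_odometer)
    fix C assume "C \<in> cylinders"
    then consider "C = {}" | k a where "C = {z \<in> odometer. z k = a}" by (auto simp: cylinders_def)
    then show "odo_shift 1 -` C \<inter> space cylinder_algebra \<in> sets cylinder_algebra"
    proof cases
      case 2
      show ?thesis unfolding 2 space_cylinder_algebra odo_shift_vimage
        by (simp add: cylinder_in_sets)
    qed simp
  qed
  then show ?thesis by (simp add: cylinder_algebra_def)
qed

lemma Int_stable_cylinders: "Int_stable cylinders"
proof (rule Int_stableI)
  have one: "{z \<in> odometer. z k = a} \<inter> {z \<in> odometer. z l = b} \<in> cylinders" if "k \<le> l" for k l a b
  proof (cases "b mod block k = a")
    case True
    then have "{z \<in> odometer. z k = a} \<inter> {z \<in> odometer. z l = b} = {z \<in> odometer. z l = b}"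
      using odometer_mod[OF _ that] by auto
    then show ?thesis by (auto simp: cylinders_def)
  next
    case False
    then have "{z \<in> odometer. z k = a} \<inter> {z \<in> odometer. z l = b} = {}"
      using odometer_mod[OF _ that] by auto
    then show ?thesis by (simp add: cylinders_def)
  qed
  fix C D assume C: "C \<in> cylinders" and D: "D \<in> cylinders"
  show "C \<inter> D \<in> cylinders"
  proof (cases "C = {} \<or> D = {}")
    case True
    then show ?thesis by (auto simp: cylinders_def)
  next
    case False
    then obtain k a l b where "C = {z \<in> odometer. z k = a}" "D = {z \<in> odometer. z l = b}"
      using C D by (auto simp: cylinders_def)
    then show ?thesis using one[of k l a b] one[of l k b a] by (cases "k \<le> l") (auto simp: Int_commute)
  qed
qed

text \<open>The shift permutes the cylinders of one level, and they all have the same measure.\<close>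

lemma odo_measure_invariant: "distr odo_measure cylinder_algebra (odo_shift 1) = odo_measure"
proof -
  have m: "odo_shift 1 \<in> measurable odo_measure cylinder_algebra"
    unfolding measurable_odo_measure by (rule measurable_odo_shift)
  show ?thesis
  proof (rule measure_eqI_generator_eq[OF Int_stable_cylinders, of odometer _ _ "\<lambda>_. odometer"])
    show "cylinders \<subseteq> Pow odometer" by (auto simp: cylinders_def)
    show "sets (distr odo_measure cylinder_algebra (odo_shift 1)) = sigma_sets odometer cylinders"
      "sets odo_measure = sigma_sets odometer cylinders"
      by (simp_all add: sets_odo_measure sets_cylinder_algebra)
    have "odometer = {z \<in> odometer. z 0 = 0}"
      using odometerD[of _ 0] by (force simp: block_def)
    then have "odometer \<in> cylinders" by (auto simp: cylinders_def)
    then show "range (\<lambda>_. odometer) \<subseteq> cylinders" by auto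
    show "emeasure (distr odo_measure cylinder_algebra (odo_shift 1)) odometer \<noteq> \<infinity>"
      using prob_space.emeasure_space_1[OF prob_space.prob_space_distr[OF prob_space_odo_measure m]]
      by simp
    fix C assume "C \<in> cylinders"
    then consider "C = {}" | k a where "C = {z \<in> odometer. z k = a}" by (auto simp: cylinders_def)
    then show "emeasure (distr odo_measure cylinder_algebra (odo_shift 1)) C = emeasure odo_measure C"
    proof cases
      case 2
      have "(a - 1) mod block k \<in> {0..<block k}"
        using pos_mod_sign[OF block_pos] pos_mod_bound[OF block_pos] by auto
      then show ?thesis
        unfolding 2 emeasure_distr[OF m cylinder_in_sets] space_odo_measure odo_shift_vimage
        by (simp add: emeasure_odo_cylinder)
    qed simp
  qed auto
qed

section \<open>Invariant measures of the skew product\<close>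

lemma measurable_height: "height j \<in> borel_measurable odo_measure"
proof -
  have "(\<lambda>z. tent (of_int (z (Suc j) div block j) / 2 ^ j)) \<in> borel_measurable cylinder_algebra"
    by (rule measurable_coordinate_borel)
  then show ?thesis
    unfolding measurable_odo_measure height_def[abs_def] .
qed

definition tall :: "nat \<Rightarrow> (nat \<Rightarrow> int) set" where
  "tall j = {z \<in> odometer. height j z \<noteq> 0}"

lemma tall_sets: "tall j \<in> sets odo_measure"
proof -
  have "height j -` (- {0}) \<inter> space odo_measure \<in> sets odo_measure"
    by (rule measurable_sets[OF measurable_height]) simp
  moreover have "height j -` (- {0}) \<inter> space odo_measure = tall j" by (auto simp: tall_def)
  ultimately show ?thesis by simp
qed

lemma measure_tall_le: "measure odo_measure (tall j) \<le> (1 / 8) * (1 / 2) ^ j"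
proof -
  let ?D = "{0..<2 * 2 ^ j :: int}"
  have D: "?D \<subseteq> {0..<radix j}"
  proof -
    have "(2::int) * 2 ^ j = 2 ^ (j + 1)" by simp
    also have "\<dots> \<le> radix j" unfolding radix_def by (intro power_increasing) auto
    finally show ?thesis by auto
  qed
  have sub: "of_digits -` tall j \<subseteq> {\<omega>. \<forall>i\<in>{j}. \<omega> i \<in> {x. x mod radix i \<in> ?D}}"
  proof
    fix \<omega> assume "\<omega> \<in> of_digits -` tall j"
    then have "height j (of_digits \<omega>) \<noteq> 0" by (simp add: tall_def)
    then have "tent (of_int (\<omega> j mod radix j) / 2 ^ j) \<noteq> 0" by (simp add: height_def of_digits_digit)
    then have "real_of_int (\<omega> j mod radix j) / 2 ^ j < 2"
      using tent_eq_0[of "real_of_int (\<omega> j mod radix j) / 2 ^ j"] by linarith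
    then have "real_of_int (\<omega> j mod radix j) < real_of_int (2 * 2 ^ j)" by (simp add: field_simps)
    then have "\<omega> j mod radix j < 2 * 2 ^ j" by (simp only: of_int_less_iff)
    then show "\<omega> \<in> {\<omega>. \<forall>i\<in>{j}. \<omega> i \<in> {x. x mod radix i \<in> ?D}}" by simp
  qed
  have "emeasure odo_measure (tall j) = emeasure digit_space (of_digits -` tall j)"
    unfolding odo_measure_def using emeasure_distr[OF measurable_of_digits, of "tall j"] tall_sets
    by (simp add: sets_odo_measure)
  also have "\<dots> \<le> emeasure digit_space {\<omega>. \<forall>i\<in>{j}. \<omega> i \<in> {x. x mod radix i \<in> ?D}}"
  proof (rule emeasure_mono[OF sub])
    have "(\<lambda>\<omega>. \<omega> j) -` {x. x mod radix j \<in> ?D} \<inter> space digit_space \<in> sets digit_space"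
      by (rule measurable_sets[OF measurable_digit[of "\<lambda>x. x"]]) simp
    then show "{\<omega>. \<forall>i\<in>{j}. \<omega> i \<in> {x. x mod radix i \<in> ?D}} \<in> sets digit_space"
      by (simp add: vimage_def)
  qed
  also have "\<dots> = ennreal (real (card ?D) / real_of_int (radix j))"
    unfolding digit_space_cylinder[OF finite.insertI[OF finite.emptyI]] emeasure_digit[OF D]
    by (simp only: prod.insert[OF finite.emptyI] prod.empty empty_iff not_False_eq_True
        mult_1_right emeasure_digit[OF D])
  also have "real (card ?D) / real_of_int (radix j) = (1 / 8) * (1 / 2) ^ j"
  proof -
    have "real_of_int (radix j) = 16 * (2 ^ j * 2 ^ j)"
      unfolding radix_def power_add power_even_eq power2_eq_square by simp
    moreover have "card ?D = nat (2 * 2 ^ j)" by simp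
    then have "real (card ?D) = 2 * 2 ^ j" by simp
    moreover have cancel: "2 * x / (16 * (x * x)) = 1 / 8 * (1 / x)" if "x \<noteq> 0" for x :: real
      using that by (simp add: divide_simps)
    have "2 * 2 ^ j / (16 * (2 ^ j * 2 ^ j)) = 1 / 8 * (1 / 2 ^ j :: real)" by (rule cancel) simp
    ultimately show ?thesis by (simp only: power_one_over)
  qed
  finally have "emeasure odo_measure (tall j) \<le> ennreal ((1 / 8) * (1 / 2) ^ j)" .
  then show ?thesis unfolding measure_def by (intro enn2real_leI) simp_all
qed

lemma summable_measure_tall: "summable (\<lambda>j. measure odo_measure (tall j))"
  by (rule summable_comparison_test'[where g = "\<lambda>j. (1 / 8) * (1 / 2) ^ j" and N = 0])
    (use measure_tall_le in \<open>auto intro!: summable_mult summable_geometric\<close>)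

text \<open>By the first Borel--Cantelli lemma almost every point stands on only finitely many tents.\<close>

lemma AE_summable_height: "AE z in odo_measure. summable (\<lambda>j. height j z)"
proof -
  interpret prob_space odo_measure by (rule prob_space_odo_measure)
  have "AE z in odo_measure. eventually (\<lambda>j. z \<in> space odo_measure - tall j) sequentially"
    by (rule borel_cantelli_AE1[OF tall_sets _ summable_measure_tall])
      (simp add: emeasure_eq_measure)
  then show ?thesis
  proof (rule AE_mp, intro AE_I2 impI)
    fix z assume "eventually (\<lambda>j. z \<in> space odo_measure - tall j) sequentially"
    then have "eventually (\<lambda>j. height j z = 0) sequentially"
      by (rule eventually_mono) (simp add: tall_def)
    then show "summable (\<lambda>j. height j z)" using summable_cong[of "\<lambda>j. height j z" "\<lambda>_. 0"] by simp
  qed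
qed

lemma measurable_transfer_fun: "transfer_fun \<in> borel_measurable odo_measure"
  unfolding transfer_fun_def[abs_def] by (intro borel_measurable_suminf measurable_height)

definition graph_map :: "complex \<Rightarrow> (nat \<Rightarrow> int) \<Rightarrow> skew_point" where
  "graph_map c z = (z, c * cis (2 * pi * transfer_fun z))"

text \<open>The graph of \<open>c * cis (2 * pi * transfer_fun z)\<close> is invariant up to a null set, because the cocycle
  is the coboundary of \<open>transfer_fun\<close> almost everywhere. Each \<open>c\<close> of modulus one gives an invariant
  measure.\<close>

definition graph_measure :: "complex \<Rightarrow> skew_point measure" where
  "graph_measure c = distr odo_measure (borel_sigma skew_top) (graph_map c)"

lemma borel_measurable_cis_transfer_fun:
  "(\<lambda>z. c * cis (2 * pi * transfer_fun z)) \<in> borel_measurable odo_measure"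
proof -
  have "(\<lambda>x. c * cis (2 * pi * x)) \<in> borel_measurable borel"
    by (intro borel_measurable_continuous_onI continuous_intros)
  from measurable_compose[OF measurable_transfer_fun this] show ?thesis .
qed

lemma measurable_graph_map:
  assumes "cmod c = 1"
  shows "graph_map c \<in> measurable odo_measure (borel_sigma skew_top)"
proof (rule measurable_borel_sigmaI)
  show "graph_map c \<in> space odo_measure \<rightarrow> topspace skew_top"
    using assms by (auto simp: graph_map_def skew_space_def norm_mult)
  have "(\<lambda>z. z) \<in> borel_measurable odo_measure"
  proof (rule measurable_coordinatewise_then_product)
    show "(\<lambda>z. z k) \<in> borel_measurable odo_measure" for k
      unfolding measurable_odo_measure by (rule measurable_coordinate_borel)
  qed
  then have "graph_map c \<in> measurable odo_measure (borel \<Otimes>\<^sub>M borel)"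
    unfolding graph_map_def[abs_def] by (intro measurable_Pair borel_measurable_cis_transfer_fun)
  then have m: "graph_map c \<in> borel_measurable odo_measure" by (simp add: borel_prod)
  fix U assume "openin skew_top U"
  then obtain O' where O': "open O'" "U = skew_space \<inter> O'" unfolding openin_open by blast
  have "graph_map c -` U \<inter> space odo_measure = graph_map c -` O' \<inter> space odo_measure"
    using assms by (auto simp: O'(2) graph_map_def skew_space_def norm_mult)
  also have "\<dots> \<in> sets odo_measure" by (rule measurable_sets[OF m]) (use O' in simp)
  finally show "graph_map c -` U \<inter> space odo_measure \<in> sets odo_measure" .
qed

lemma graph_measure_invariant:
  assumes c: "cmod c = 1"
  shows "invariant_prob skew_top skew (graph_measure c)"
  unfolding invariant_prob_def
proof (intro conjI ballI)
  note g = measurable_graph_map[OF c]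
  show "space (graph_measure c) = topspace skew_top"
    "sets (graph_measure c) = sets (borel_sigma skew_top)"
    by (simp_all add: graph_measure_def)
  show "prob_space (graph_measure c)"
    unfolding graph_measure_def by (rule prob_space.prob_space_distr[OF prob_space_odo_measure g])
  fix A assume "A \<in> sets (graph_measure c)"
  then have A: "A \<in> sets (borel_sigma skew_top)" by (simp add: graph_measure_def)
  let ?sA = "skew -` A \<inter> topspace skew_top"
  have sA: "?sA \<in> sets (borel_sigma skew_top)"
    using measurable_sets[OF flow_measurable[OF skew_flow] A] by simp
  have gA: "graph_map c -` B \<inter> odometer \<in> sets odo_measure"
    if "B \<in> sets (borel_sigma skew_top)" for B
    using measurable_sets[OF g that] by simp
  have s: "odo_shift 1 \<in> measurable odo_measure cylinder_algebra"
    unfolding measurable_odo_measure by (rule measurable_odo_shift)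
  have gs: "odo_shift 1 -` (graph_map c -` A \<inter> odometer) \<inter> odometer \<in> sets odo_measure"
    using measurable_sets[OF s, of "graph_map c -` A \<inter> odometer"] gA[OF A]
    by (simp add: sets_odo_measure)
  have commute: "skew (graph_map c z) = graph_map c (odo_shift 1 z)"
    if "z \<in> odometer" "summable (\<lambda>j. height j z)" for z
    using cocycle_coboundary(2)[OF that]
    by (simp add: graph_map_def skew_pair cis_mult distrib_left mult.assoc)
  have gX: "graph_map c z \<in> skew_space" if "z \<in> odometer" for z
    using that c by (simp add: graph_map_def skew_space_def norm_mult)
  have "emeasure (graph_measure c) ?sA = emeasure odo_measure (graph_map c -` ?sA \<inter> odometer)"
    unfolding graph_measure_def using emeasure_distr[OF g sA] by simp
  also have "\<dots> = emeasure odo_measure (odo_shift 1 -` (graph_map c -` A \<inter> odometer) \<inter> odometer)"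
  proof (rule emeasure_eq_AE[OF _ gA[OF sA] gs])
    show "AE z in odo_measure. z \<in> graph_map c -` ?sA \<inter> odometer \<longleftrightarrow>
        z \<in> odo_shift 1 -` (graph_map c -` A \<inter> odometer) \<inter> odometer"
      using AE_summable_height
    proof (rule AE_mp, intro AE_I2 impI)
      fix z assume "z \<in> space odo_measure" "summable (\<lambda>j. height j z)"
      then show "z \<in> graph_map c -` ?sA \<inter> odometer \<longleftrightarrow>
          z \<in> odo_shift 1 -` (graph_map c -` A \<inter> odometer) \<inter> odometer"
        using commute[of z] gX[of z] odo_shift_in_odometer[of z 1] by simp
    qed
  qed
  also have "\<dots> = emeasure (distr odo_measure cylinder_algebra (odo_shift 1)) (graph_map c -` A \<inter> odometer)"
    using emeasure_distr[OF s, of "graph_map c -` A \<inter> odometer"] gA[OF A]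
    by (simp add: sets_odo_measure)
  also have "\<dots> = emeasure odo_measure (graph_map c -` A \<inter> odometer)"
    by (simp only: odo_measure_invariant)
  also have "\<dots> = emeasure (graph_measure c) A"
    unfolding graph_measure_def using emeasure_distr[OF g A] by simp
  finally show "emeasure (graph_measure c) ?sA = emeasure (graph_measure c) A" .
qed

text \<open>Outside a set of measure at most \<open>1 / 4\<close> all heights vanish and the integrand is \<open>1\<close>; since it has
  modulus one, the integral is at distance at most \<open>1 / 2\<close> from \<open>1\<close>.\<close>

lemma integral_cis_transfer_fun_nonzero:
  "(\<integral>z. cis (2 * pi * transfer_fun z) \<partial>odo_measure) \<noteq> 0"
proof
  interpret prob_space odo_measure by (rule prob_space_odo_measure)
  let ?f = "\<lambda>z. cis (2 * pi * transfer_fun z)"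
  assume zero: "(\<integral>z. ?f z \<partial>odo_measure) = 0"
  have meas: "?f \<in> borel_measurable odo_measure"
    using borel_measurable_cis_transfer_fun[of 1] by simp
  have int: "integrable odo_measure ?f"
    by (rule integrable_const_bound[OF _ meas, of 1]) simp
  define B where "B = (\<Union>j. tall j)"
  have B: "B \<in> sets odo_measure" unfolding B_def using tall_sets by auto
  have "measure odo_measure B \<le> (\<Sum>j. measure odo_measure (tall j))"
    unfolding B_def
    by (rule finite_measure_subadditive_countably[OF _ summable_measure_tall]) (use tall_sets in auto)
  also have "\<dots> \<le> (\<Sum>j. (1 / 8) * (1 / 2) ^ j)"
    by (intro suminf_le measure_tall_le summable_measure_tall summable_mult summable_geometric) simp
  also have "\<dots> = 1 / 4"
    using suminf_geometric[of "1 / 2 :: real"] by (subst suminf_mult) (auto simp: summable_geometric)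
  finally have mB: "measure odo_measure B \<le> 1 / 4" .
  have "1 = cmod (\<integral>z. ?f z - 1 \<partial>odo_measure)"
    using int zero prob_space by simp
  also have "\<dots> \<le> (\<integral>z. cmod (?f z - 1) \<partial>odo_measure)" by (rule integral_norm_bound)
  also have "\<dots> \<le> (\<integral>z. 2 * indicator B z \<partial>odo_measure)"
  proof (rule integral_mono)
    show "integrable odo_measure (\<lambda>z. cmod (?f z - 1))"
      by (intro integrable_norm Bochner_Integration.integrable_diff int) simp
    show "integrable odo_measure (\<lambda>z. 2 * indicator B z :: real)"
      using B by (intro integrable_mult_right integrable_real_indicator) (simp_all add: emeasure_eq_measure)
    fix z assume z: "z \<in> space odo_measure"
    show "cmod (?f z - 1) \<le> 2 * indicator B z"
    proof (cases "z \<in> B")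
      case True
      then show ?thesis using norm_triangle_ineq4[of "?f z" 1] by simp
    next
      case False
      then have "height j z = 0" for j using z by (auto simp: B_def tall_def)
      then show ?thesis using False by (simp add: transfer_fun_def)
    qed
  qed
  also have "\<dots> = 2 * measure odo_measure B"
  proof -
    have "B \<inter> odometer = B" by (auto simp: B_def tall_def)
    then show ?thesis by simp
  qed
  finally show False using mB by simp
qed

text \<open>The fibre coordinate has the integral \<open>c * I\<close> against \<open>graph_measure c\<close>, with \<open>I \<noteq> 0\<close>; the
  choices \<open>c = 1\<close> and \<open>c = - 1\<close> are told apart.\<close>

lemma skew_has_distinct_means: "has_distinct_means skew_top skew"
proof -
  let ?I = "\<integral>z. cis (2 * pi * transfer_fun z) \<partial>odo_measure"
  have F: "continuous_map skew_top euclidean (snd :: skew_point \<Rightarrow> complex)"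
    by (simp add: continuous_on_snd continuous_on_id)
  have integral: "(\<integral>p. snd p \<partial>graph_measure c) = c * ?I" if "cmod c = 1" for c
  proof -
    have "(\<integral>p. snd p \<partial>graph_measure c) = (\<integral>z. snd (graph_map c z) \<partial>odo_measure)"
      unfolding graph_measure_def
      by (rule integral_distr[OF measurable_graph_map[OF that] continuous_map_borel_measurable[OF F]])
    then show ?thesis by (simp add: graph_map_def)
  qed
  have "(\<integral>p. snd p \<partial>graph_measure 1) \<noteq> (\<integral>p. snd p \<partial>graph_measure (- 1))"
    using integral[of 1] integral[of "-1"] integral_cis_transfer_fun_nonzero by simp
  then show ?thesis
    unfolding has_distinct_means_def
    using graph_measure_invariant[of 1] graph_measure_invariant[of "-1"] F
    by (intro exI[of _ "graph_measure 1"] exI[of _ "graph_measure (-1)"] exI[of _ snd]) simp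
qed

section \<open>The Weyl algebra is a proper subalgebra\<close>

theorem corollary2p7:
  shows "weyl_algebra \<subset> distal_functions \<and>
    (\<exists>(X :: universe topology) T.
       metrizable_space X \<and> minimal_flow X T \<and> distal_flow X T \<and> \<not> strictly_ergodic X T \<and>
       (\<forall>x0\<in>topspace X. al X T x0 \<subseteq> distal_functions \<and> \<not> al X T x0 \<subseteq> weyl_algebra))"
proof -
  have "skew_top closure_of range (\<lambda>n. flow_pow skew_top skew n (residues_of 0, 1)) = topspace skew_top"
    using skew_dense_orbit by (simp add: orbit_def)
  then obtain X :: "universe topology" and h where h: "homeomorphic_map skew_top X h"
    using metrizable_imp_Hausdorff_space[OF metrizable_skew_top]
    by (elim separable_Hausdorff_embeds_in_universe[rotated])
  obtain g where "homeomorphic_maps skew_top X h g"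
    using h homeomorphic_map_maps by blast
  then have gh: "g (h p) = p" if "p \<in> topspace skew_top" for p
    using that by (simp add: homeomorphic_maps_def)
  define T where "T = h \<circ> skew \<circ> g"
  have T: "T (h p) = h (skew p)" if "p \<in> topspace skew_top" for p
    using gh[OF that] by (simp add: T_def)
  have metr: "metrizable_space X"
    using homeomorphic_metrizable_space[OF homeomorphic_map_imp_homeomorphic_space[OF h]]
      metrizable_skew_top by simp
  have min: "minimal_flow X T" by (rule minimal_flow_iso[OF h skew_flow T skew_minimal])
  have dist: "distal_flow X T" by (rule distal_flow_iso[OF h skew_flow T skew_distal])
  have means: "has_distinct_means X T"
    by (rule has_distinct_means_iso[OF h skew_flow T skew_has_distinct_means])
  have al: "al X T x0 \<subseteq> distal_functions \<and> \<not> al X T x0 \<subseteq> weyl_algebra"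
    if "x0 \<in> topspace X" for x0
    using al_subset_distal_functions[OF min dist that]
      has_distinct_means_not_al_subset_weyl[OF means min that] by simp
  have "topspace X \<noteq> {}"
    using min unfolding minimal_flow_def flow_def by (elim conjE)
  then obtain x0 where "x0 \<in> topspace X" by (meson ex_in_conv)
  then have "weyl_algebra \<noteq> distal_functions" using al by auto
  then have proper: "weyl_algebra \<subset> distal_functions"
    using weyl_algebra_subset_distal_functions by auto
  show ?thesis
  proof (rule conjI[OF proper], rule exI, rule exI)
    show "metrizable_space X \<and> minimal_flow X T \<and> distal_flow X T \<and> \<not> strictly_ergodic X T \<and>
       (\<forall>x0\<in>topspace X. al X T x0 \<subseteq> distal_functions \<and> \<not> al X T x0 \<subseteq> weyl_algebra)"
      using metr min dist has_distinct_means_not_strictly_ergodic[OF means] al by simp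
  qed
qed

end
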